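(* For every integer $n\ge 2$ the following identity holds in $\mathfrak P\subset\mathbb{C}(\widetilde{S}_\infty)$: $$\Sigma_{n-1}=R_n+\sum_{\substack{m_2,m_3,\dots\ge 0\\ 2m_2+3m_3+4m_4+\cdots=n-2}}\frac14\binom{n}{3}\binom{m_2+m_3+\cdots}{m_2,m_3,\dots}\prod_{s\ge 2}\big((s-1)R_s\big)^{m_s}+E_n,$$ where $E_n$ consists of terms of degree at most $n-4$, i.e. $E_n$ is a linear combination of products $M_{j_1}\cdots M_{j_r}$ ($r\ge 0$, $j_1,\dots,j_r\ge 2$) with $j_1+\cdots+j_r\le n-4$.
   Context: Partial permutations: for a finite set $A$, a partial permutation of $A$ is a pair $(d,w)$ with $d\subseteq A$ (the support) and $w:A\to A$ a bijection with $w(x)=x$ for $x\in A\setminus d$. They form a semigroup $\widetilde{S}_A$ under $(d_1,w_1)(d_2,w_2)=(d_1\cup d_2,w_1w_2)$; $\mathbb{C}(\widetilde{S}_A)$ is its semigroup algebra. For $A\subseteq B$ there is a homomorphism $\theta^B_A:\mathbb{C}(\widetilde{S}_B)\to\mathbb{C}(\widetilde{S}_A)$ sending $(d,w)$ to $(d,w|_A)$ if $d\subseteq A$ and to $0$ otherwise. $\mathbb{C}(\widetilde{S}_\infty)$ is the projective limit of the algebras $\mathbb{C}(\widetilde{S}_{\{1,\dots,q\}})$, $q\to\infty$, along these maps. Normalized conjugacy class indicators: for integers $k_1,\dots,k_m\ge1$, in $\mathbb{C}(\widetilde{S}_A)$ put $\Sigma_{k_1,\dots,k_m}=\sum_a (a_{1,1},\dots,a_{1,k_1})\cdots(a_{m,1},\dots,a_{m,k_m})$,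 the sum over all injective families $a=(a_{r,s})_{1\le r\le m,1\le s\le k_r}$ of elements of $A$; each summand is a product of disjoint cycles regarded as a partial permutation with support $\{a_{r,s}\}$. If some $k_i=0$ then $\Sigma_{k_1,\dots,k_m}=0$. These are compatible with the maps $\theta^B_A$ and define $\Sigma_{k_1,\dots,k_m}\in\mathbb{C}(\widetilde{S}_\infty)$. Jucys--Murphy moments: fix an extra symbol $\ast\notin A$. For $k\ge 1$ let $M_k\in\mathbb{C}(\widetilde{S}_A)$ be the sum, over all $(a_1,\dots,a_k)\in A^k$ such that the product of transpositions $(a_1\,\ast)\cdots(a_k\,\ast)$ fixes $\ast$, of this product restricted to $A$, regarded as a partial permutation with support $\{a_1,\dots,a_k\}$. (These are the moments of the Jucys--Murphy element $J=\sum_{a\in A}(a\,\ast)$.) They are compatible with the maps $\theta^B_A$ and define $M_k\in\mathbb{C}(\widetilde{S}_\infty)$. The $M_k$ commute; $\mathfrak P$ denotes the (commutative) algebra they generate. It is graded by $\deg M_k=k$. Free cumulants: let $NC(1,\dots,n)$ be the set of non-crossing partitions of $\{1,\dots,n\}$. For $\rho\in NC(1,\dots,n)$ put $M_\rho=\prod_{b\in\rho}M_{|b|}$, and $R_n=\sum_{\rho\in NC(1,\dots,n)}\mathrm{Moeb}_{\rho_{\mathrm{comp}}}M_\rho$, where $\rho_{\mathrm{comp}}$ is the Kreweras complement (the largest non-crossing partition of $\{1',\dots,n'\}$ such that $\rho\cup\rho_{\mathrm{comp}}$ is a non-crossing partition of $1<1'<2<2'<\cdots<n<n'$) and $\mathrm{Moeb}_\sigma=\prod_{b\in\sigma}(-1)^{|b|-1}c_{|b|-1}$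 with $c_k=\frac{(2k)!}{(k+1)!\,k!}$. $\binom{m_2+m_3+\cdots}{m_2,m_3,\dots}$ is the multinomial coefficient. *)

theory Defs
  imports
    Complex_Main
    "HOL-Library.Poly_Mapping"
    "HOL-Library.Multiset"
    "HOL-Library.Disjoint_Sets"
    "HOL-Combinatorics.Cycles"
begin

section \<open>Partial permutations\<close>

text \<open>
  A partial permutation \<open>(d, w)\<close> of a finite set \<open>A\<close> is encoded with \<open>w\<close> extended by the identity
  to the whole type.  The value then no longer mentions \<open>A\<close>: the partial permutations of \<open>A\<close> are
  those whose support is contained in \<open>A\<close>, and restricting \<open>w\<close> to a smaller set that still contains
  \<open>d\<close> leaves the value unchanged.
\<close>

typedef 'a pperm = "{(d :: 'a set, w :: 'a \<Rightarrow> 'a). finite d \<and> w permutes d}"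
  by (rule exI[of _ "({}, id)"]) (simp add: permutes_id)

setup_lifting type_definition_pperm

lift_definition pp_supp :: "'a pperm \<Rightarrow> 'a set" is fst .

lift_definition pp_perm :: "'a pperm \<Rightarrow> 'a \<Rightarrow> 'a" is snd .

lemma pp_eqI: "pp_supp p = pp_supp q \<Longrightarrow> pp_perm p = pp_perm q \<Longrightarrow> p = q"
  by transfer auto

lemma finite_pp_supp [simp]: "finite (pp_supp p)"
  by transfer auto

lemma pp_perm_permutes: "pp_perm p permutes pp_supp p"
  by transfer auto

text \<open>
  The monoid algebra of the library, \<^typ>\<open>'a \<Rightarrow>\<^sub>0 'b\<close>, is built over an additively written (not
  necessarily commutative) monoid.  So the product \<open>(d1, w1)(d2, w2) = (d1 \<union> d2, w1 w2)\<close> is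
  written \<open>+\<close>, and the neutral element \<open>({}, id)\<close> is written \<open>0\<close>.
\<close>

instantiation pperm :: (type) monoid_add
begin

lift_definition zero_pperm :: "'a pperm" is "({}, id)"
  by (simp add: permutes_id)

lift_definition plus_pperm :: "'a pperm \<Rightarrow> 'a pperm \<Rightarrow> 'a pperm"
  is "\<lambda>(d1, w1) (d2, w2). (d1 \<union> d2, w1 \<circ> w2)"
  by (auto intro!: permutes_compose intro: permutes_subset)

instance
  by standard (transfer; auto simp: o_assoc)+

end

lemma pp_supp_zero [simp]: "pp_supp 0 = {}"
  by transfer simp

lemma pp_perm_zero [simp]: "pp_perm 0 = id"
  by transfer simp

lemma pp_supp_plus [simp]: "pp_supp (p + q) = pp_supp p \<union> pp_supp q"
  by transfer auto

lemma pp_perm_plus [simp]: "pp_perm (p + q) = pp_perm p \<circ> pp_perm q"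
  by transfer auto


section \<open>The semigroup algebras and their projective limit\<close>

type_synonym 'a pp_alg = "'a pperm \<Rightarrow>\<^sub>0 complex"

definition pp_alg_on :: "'a set \<Rightarrow> 'a pp_alg set" where
  "pp_alg_on A = {f. \<forall>p \<in> Poly_Mapping.keys f. pp_supp p \<subseteq> A}"

definition pp_theta :: "'a set \<Rightarrow> 'a pp_alg \<Rightarrow> 'a pp_alg" where
  "pp_theta A f =
     (\<Sum>p \<in> Poly_Mapping.keys f.
        if pp_supp p \<subseteq> A then Poly_Mapping.single p (Poly_Mapping.lookup f p) else 0)"

lemma lookup_pp_theta:
  "Poly_Mapping.lookup (pp_theta A f) p = (if pp_supp p \<subseteq> A then Poly_Mapping.lookup f p else 0)"
proof -
  have "Poly_Mapping.lookup (pp_theta A f) p =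
      (\<Sum>r \<in> Poly_Mapping.keys f. Poly_Mapping.lookup
         (if pp_supp r \<subseteq> A then Poly_Mapping.single r (Poly_Mapping.lookup f r) else 0) p)"
    by (simp add: pp_theta_def lookup_sum)
  also have "\<dots> = (\<Sum>r \<in> Poly_Mapping.keys f. if r = p then
       (if pp_supp p \<subseteq> A then Poly_Mapping.lookup f p else 0) else 0)"
    by (intro sum.cong) (auto simp: lookup_single)
  also have "\<dots> = (if pp_supp p \<subseteq> A then Poly_Mapping.lookup f p else 0)"
    by (simp add: in_keys_iff)
  finally show ?thesis .
qed

lemma pp_theta_zero [simp]: "pp_theta A 0 = 0"
  by (rule poly_mapping_eqI) (simp add: lookup_pp_theta)

lemma pp_theta_add: "pp_theta A (f + g) = pp_theta A f + pp_theta A g"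
  by (rule poly_mapping_eqI) (simp add: lookup_pp_theta lookup_add)

lemma pp_theta_diff: "pp_theta A (f - g) = pp_theta A f - pp_theta A g"
  by (rule poly_mapping_eqI) (simp add: lookup_pp_theta lookup_minus)

lemma pp_theta_uminus: "pp_theta A (- f) = - pp_theta A f"
  by (rule poly_mapping_eqI) (simp add: lookup_pp_theta)

lemma pp_theta_sum: "pp_theta A (sum f I) = (\<Sum>i\<in>I. pp_theta A (f i))"
  by (induction I rule: infinite_finite_induct) (auto simp: pp_theta_add)

lemma pp_theta_single:
  "pp_theta A (Poly_Mapping.single p c) = (if pp_supp p \<subseteq> A then Poly_Mapping.single p c else 0)"
  by (rule poly_mapping_eqI) (auto simp: lookup_pp_theta lookup_single when_def)

lemma pp_theta_one [simp]: "pp_theta A 1 = 1"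
  unfolding single_one[symmetric] by (simp add: pp_theta_single del: single_one)

lemma pp_alg_sum_singles:
  "f = (\<Sum>p \<in> Poly_Mapping.keys f. Poly_Mapping.single p (Poly_Mapping.lookup f p))"
  by (rule poly_mapping_eqI) (simp add: lookup_sum lookup_single when_def in_keys_iff)

lemma pp_theta_mult: "pp_theta A (f * g) = pp_theta A f * pp_theta A g"
proof -
  have *: "pp_theta A (Poly_Mapping.single p c * Poly_Mapping.single q d) =
      pp_theta A (Poly_Mapping.single p c) * pp_theta A (Poly_Mapping.single q d)" for p q c d
    by (simp add: mult_single pp_theta_single)
  show ?thesis
    by (subst (1 2) pp_alg_sum_singles, subst (3) pp_alg_sum_singles, subst (4) pp_alg_sum_singles)
       (simp add: sum_product pp_theta_sum *)
qed

lemma pp_alg_on_iff_theta: "f \<in> pp_alg_on A \<longleftrightarrow> pp_theta A f = f"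
  unfolding pp_alg_on_def poly_mapping_eq_iff fun_eq_iff lookup_pp_theta
  by (auto simp: in_keys_iff)

text \<open>
  An element of the projective limit is the family of its images in the algebras over \<open>{1..q}\<close>.
\<close>

typedef pp_limit = "{f :: nat \<Rightarrow> nat pp_alg.
    (\<forall>q. f q \<in> pp_alg_on {1..q}) \<and> (\<forall>q r. q \<le> r \<longrightarrow> pp_theta {1..q} (f r) = f q)}"
  morphisms pp_proj Abs_pp_limit
  by (rule exI[of _ "\<lambda>_. 0"]) (simp add: pp_alg_on_def)

setup_lifting type_definition_pp_limit

lemma pp_limit_eqI: "(\<And>q. pp_proj x q = pp_proj y q) \<Longrightarrow> x = y"
  by (metis ext pp_proj_inject)

instantiation pp_limit :: ring_1
begin

lift_definition zero_pp_limit :: pp_limit is "\<lambda>_. 0"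
  by (simp add: pp_alg_on_iff_theta)
lift_definition one_pp_limit :: pp_limit is "\<lambda>_. 1"
  by (simp add: pp_alg_on_iff_theta)
lift_definition plus_pp_limit :: "pp_limit \<Rightarrow> pp_limit \<Rightarrow> pp_limit" is "\<lambda>f g q. f q + g q"
  by (simp add: pp_alg_on_iff_theta pp_theta_add)
lift_definition minus_pp_limit :: "pp_limit \<Rightarrow> pp_limit \<Rightarrow> pp_limit" is "\<lambda>f g q. f q - g q"
  by (simp add: pp_alg_on_iff_theta pp_theta_diff)
lift_definition uminus_pp_limit :: "pp_limit \<Rightarrow> pp_limit" is "\<lambda>f q. - f q"
  by (simp add: pp_alg_on_iff_theta pp_theta_uminus)
lift_definition times_pp_limit :: "pp_limit \<Rightarrow> pp_limit \<Rightarrow> pp_limit" is "\<lambda>f g q. f q * g q"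
  by (simp add: pp_alg_on_iff_theta pp_theta_mult)

instance
proof
  show "(0 :: pp_limit) \<noteq> 1"
    by transfer (simp add: fun_eq_iff)
qed (transfer; simp add: fun_eq_iff algebra_simps)+

end

lift_definition pp_scale :: "complex \<Rightarrow> pp_limit \<Rightarrow> pp_limit" (infixr "*\<^sub>C" 75)
  is "\<lambda>c f q. Poly_Mapping.map ((*) c) (f q)"
  by (simp add: mult_map_scale_conv_mult pp_alg_on_iff_theta pp_theta_mult pp_theta_single)

global_interpretation pp_limit: vector_space pp_scale
proof
  fix a b :: complex and x y :: pp_limit
  show "a *\<^sub>C (x + y) = a *\<^sub>C x + a *\<^sub>C y"
    by transfer (simp add: mult_map_scale_conv_mult algebra_simps)
  show "(a + b) *\<^sub>C x = a *\<^sub>C x + b *\<^sub>C x"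
    by transfer (simp add: mult_map_scale_conv_mult algebra_simps single_add)
  show "a *\<^sub>C b *\<^sub>C x = (a * b) *\<^sub>C x"
    by transfer (simp add: mult_map_scale_conv_mult mult.assoc[symmetric] mult_single)
  show "1 *\<^sub>C x = x"
    by transfer (simp add: mult_map_scale_conv_mult)
qed

text \<open>
  A sum of basis elements over those indices whose support lies in \<open>{1..q}\<close> is compatible with
  the maps.
\<close>

lemma pp_limit_sumI:
  fixes I :: "nat \<Rightarrow> 'i set" and g :: "'i \<Rightarrow> nat pperm"
  assumes fin: "\<And>q. finite (I q)"
    and mem: "\<And>q i. i \<in> I q \<longleftrightarrow> i \<in> J \<and> pp_supp (g i) \<subseteq> {1..q}"
  shows "(\<forall>q. (\<Sum>i\<in>I q. Poly_Mapping.single (g i) 1) \<in> pp_alg_on {1..q}) \<and>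
    (\<forall>q r. q \<le> r \<longrightarrow> pp_theta {1..q} (\<Sum>i\<in>I r. Poly_Mapping.single (g i) 1) =
                    (\<Sum>i\<in>I q. Poly_Mapping.single (g i) (1 :: complex)))"
proof -
  have *: "pp_theta {1..q} (\<Sum>i\<in>I r. Poly_Mapping.single (g i) 1) =
      (\<Sum>i\<in>I q. Poly_Mapping.single (g i) (1 :: complex))" if "q \<le> r" for q r
  proof -
    have sub: "{1..q} \<subseteq> {1..r}" using that by auto
    have eq: "I q = {i \<in> I r. pp_supp (g i) \<subseteq> {1..q}}"
      by (simp only: mem set_eq_iff mem_Collect_eq) (use sub in blast)
    show ?thesis
      unfolding pp_theta_sum pp_theta_single eq
      by (rule sum.inter_filter[OF fin, symmetric])
  qed
  then show ?thesis
    by (auto simp: pp_alg_on_iff_theta)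
qed


section \<open>Normalized conjugacy class indicators\<close>

text \<open>\<^const>\<open>cycle_of_list\<close> sends each entry of the list to the next one and the last to the first.\<close>

lift_definition cycle_pperm :: "'a list \<Rightarrow> 'a pperm" is "\<lambda>c. (set c, cycle_of_list c)"
  by (simp add: cycle_permutes)

text \<open>
  The family \<open>a\<close> is a list of lists, its \<open>r\<close>-th entry being the \<open>r\<close>-th cycle; the product of these
  cycles in the monoid of partial permutations is a \<^const>\<open>sum_list\<close>, as explained above.
\<close>

definition cc_families :: "nat list \<Rightarrow> 'a set \<Rightarrow> 'a list list set" where
  "cc_families ks A = {as. map length as = ks \<and> distinct (concat as) \<and> set (concat as) \<subseteq> A}"

definition cc_ind_on :: "'a set \<Rightarrow> nat list \<Rightarrow> 'a pp_alg" where
  "cc_ind_on A ks =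
     (if 0 \<in> set ks then 0
      else \<Sum>as \<in> cc_families ks A. Poly_Mapping.single (sum_list (map cycle_pperm as)) 1)"

lemma pp_supp_cycles: "pp_supp (sum_list (map cycle_pperm as)) = set (concat as)"
proof (induction as)
  case (Cons c as)
  have "pp_supp (cycle_pperm c) = set c" by transfer simp
  with Cons.IH show ?case by simp
qed simp

lemma finite_cc_families:
  assumes "finite A" shows "finite (cc_families ks A)"
proof (rule finite_subset)
  let ?L = "{c. set c \<subseteq> A \<and> length c \<le> sum_list ks}"
  show "cc_families ks A \<subseteq> {as. set as \<subseteq> ?L \<and> length as = length ks}"
    unfolding cc_families_def by (force intro: member_le_sum_list)
  show "finite {as. set as \<subseteq> ?L \<and> length as = length ks}"
    by (intro finite_lists_length_eq finite_lists_length_le assms)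
qed

lift_definition cc_ind :: "nat list \<Rightarrow> pp_limit" is "\<lambda>ks q. cc_ind_on {1..q} ks"
proof -
  fix ks :: "nat list"
  show "(\<forall>q. cc_ind_on {1..q :: nat} ks \<in> pp_alg_on {1..q}) \<and>
    (\<forall>q r :: nat. q \<le> r \<longrightarrow> pp_theta {1..q} (cc_ind_on {1..r} ks) = cc_ind_on {1..q} ks)"
  proof (cases "0 \<in> set ks")
    case True
    then show ?thesis by (simp add: cc_ind_on_def pp_alg_on_iff_theta)
  next
    case False
    show ?thesis
      unfolding cc_ind_on_def if_not_P[OF False]
      by (rule pp_limit_sumI[where I = "\<lambda>q. cc_families ks {1..q}" and
            g = "\<lambda>as. sum_list (map cycle_pperm as)" and J = "cc_families ks UNIV"])
         (intro finite_cc_families finite_atLeastAtMost, unfold pp_supp_cycles cc_families_def, blast)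
  qed
qed


section \<open>Jucys--Murphy moments\<close>

text \<open>
  The extra symbol \<open>*\<close> is \<^const>\<open>None\<close> in the option type, and \<open>a\<close> is identified with \<open>Some a\<close>.
\<close>

definition jm_perm :: "'a list \<Rightarrow> 'a option \<Rightarrow> 'a option" where
  "jm_perm as = foldr (\<circ>) (map (\<lambda>a. transpose (Some a) None) as) id"

lemma jm_perm_permutes: "jm_perm as permutes (insert None (Some ` set as))"
proof (induction as)
  case Nil
  have "jm_perm ([] :: 'a list) = id" by (simp add: jm_perm_def)
  then show ?case by (simp only: permutes_id)
next
  case (Cons a as)
  have "jm_perm (a # as) = transpose (Some a) None \<circ> jm_perm as"
    by (simp add: jm_perm_def)
  moreover have "transpose (Some a) None permutes insert None (Some ` set (a # as))"
    by (rule permutes_swap_id) auto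
  moreover have "jm_perm as permutes insert None (Some ` set (a # as))"
    by (rule permutes_subset[OF Cons.IH]) auto
  ultimately show ?case
    by (metis permutes_compose)
qed

lemma jm_perm_Some:
  assumes "jm_perm as None = None"
  shows "jm_perm as (Some x) = Some (the (jm_perm as (Some x)))"
proof -
  have "jm_perm as (Some x) \<noteq> None"
    using assms permutes_inj[OF jm_perm_permutes, of as] by (metis injD option.distinct(1))
  then show ?thesis by simp
qed

lemma jm_restrict_permutes:
  assumes N: "jm_perm as None = None"
  shows "(\<lambda>x. the (jm_perm as (Some x))) permutes set as"
proof -
  note S = jm_perm_Some[OF N]
  have "bij (\<lambda>x. the (jm_perm as (Some x)))"
  proof (rule bijI)
    show "inj (\<lambda>x. the (jm_perm as (Some x)))"
      using S permutes_inj[OF jm_perm_permutes, of as] by (metis (lifting) injD injI option.inject)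
    show "surj (\<lambda>x. the (jm_perm as (Some x)))"
    proof (rule surjI)
      fix y
      have "jm_perm as (inv (jm_perm as) (Some y)) = Some y"
        by (rule permutes_inverses(1)[OF jm_perm_permutes])
      moreover from this N obtain z where "inv (jm_perm as) (Some y) = Some z"
        by (metis not_Some_eq)
      ultimately show "the (jm_perm as (Some (the (inv (jm_perm as) (Some y))))) = y"
        by simp
    qed
  qed
  moreover have "the (jm_perm as (Some x)) = x" if "x \<notin> set as" for x
    using permutes_not_in[OF jm_perm_permutes, of "Some x" as] that by (simp add: image_iff)
  ultimately show ?thesis
    by (simp add: permutes_def bij_iff)
qed

text \<open>Only used for \<open>as\<close> such that \<open>jm_perm as\<close> fixes \<^const>\<open>None\<close>.\<close>

lift_definition jm_pperm :: "'a list \<Rightarrow> 'a pperm" is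
  "\<lambda>as. if jm_perm as None = None then (set as, \<lambda>x. the (jm_perm as (Some x))) else ({}, id)"
  by (auto simp: jm_restrict_permutes permutes_id)

definition jm_tuples :: "nat \<Rightarrow> 'a set \<Rightarrow> 'a list set" where
  "jm_tuples k A = {as. length as = k \<and> set as \<subseteq> A \<and> jm_perm as None = None}"

definition jm_moment_on :: "'a set \<Rightarrow> nat \<Rightarrow> 'a pp_alg" where
  "jm_moment_on A k = (\<Sum>as \<in> jm_tuples k A. Poly_Mapping.single (jm_pperm as) 1)"

lemma pp_supp_jm: "jm_perm as None = None \<Longrightarrow> pp_supp (jm_pperm as) = set as"
  by transfer simp

lemma pp_perm_jm: "jm_perm as None = None \<Longrightarrow> Some (pp_perm (jm_pperm as) x) = jm_perm as (Some x)"
  using jm_perm_Some[of as x] by transfer simp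

lemma finite_jm_tuples: "finite A \<Longrightarrow> finite (jm_tuples k A)"
  by (rule finite_subset[OF _ finite_lists_length_eq[of A k]]) (auto simp: jm_tuples_def)

lift_definition jm_moment :: "nat \<Rightarrow> pp_limit" is "\<lambda>k q. jm_moment_on {1..q} k"
  unfolding jm_moment_on_def
  by (rule pp_limit_sumI[where J = "{as. length as = k \<and> jm_perm as None = None}" for k])
     (intro finite_jm_tuples finite_atLeastAtMost, auto simp: jm_tuples_def pp_supp_jm)


subsection \<open>The moments commute\<close>

lemma jm_perm_map:
  assumes "bij w"
  shows "jm_perm (map w as) \<circ> map_option w = map_option w \<circ> jm_perm as"
proof (induction as)
  case Nil
  then show ?case by (simp add: jm_perm_def)
next
  case (Cons a as)
  have *: "transpose (Some (w a)) None (map_option w x) = map_option w (transpose (Some a) None x)"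
    for x
    using bij_is_inj[OF assms] by (cases x) (auto simp: transpose_def dest: injD)
  show ?case
    using Cons.IH by (auto simp: jm_perm_def fun_eq_iff *)
qed

lemma jm_tuples_conj:
  assumes w: "w permutes A" and as: "as \<in> jm_tuples k A"
  shows "map w as \<in> jm_tuples k A"
proof -
  have "jm_perm (map w as) None = None"
    using fun_cong[OF jm_perm_map[OF permutes_bij[OF w], of as], of None] as
    by (simp add: jm_tuples_def)
  then show ?thesis
    using as permutes_in_image[OF w] by (auto simp: jm_tuples_def)
qed

lemma jm_pperm_conj:
  assumes as: "jm_perm as None = None"
  shows "jm_pperm (map (pp_perm p) as) + p = p + jm_pperm as"
proof (rule pp_eqI)
  let ?w = "pp_perm p"
  have bij: "bij ?w" by (rule permutes_bij[OF pp_perm_permutes])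
  note conj = fun_cong[OF jm_perm_map[OF bij, of as]]
  have N: "jm_perm (map ?w as) None = None"
    using conj[of None] as by simp
  have "?w ` set as \<union> pp_supp p = pp_supp p \<union> set as"
  proof -
    have "?w x \<in> pp_supp p \<longleftrightarrow> x \<in> pp_supp p" "x \<notin> pp_supp p \<Longrightarrow> ?w x = x" for x
      using pp_perm_permutes[of p] by (auto simp: permutes_in_image permutes_not_in)
    then show ?thesis by (auto simp: image_iff) metis+
  qed
  then show "pp_supp (jm_pperm (map ?w as) + p) = pp_supp (p + jm_pperm as)"
    by (simp add: pp_supp_jm as N)
  have "pp_perm (jm_pperm (map ?w as)) (?w x) = ?w (pp_perm (jm_pperm as) x)" for x
    using conj[of "Some x"] by (simp flip: pp_perm_jm[OF N] pp_perm_jm[OF as])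
  then show "pp_perm (jm_pperm (map ?w as) + p) = pp_perm (p + jm_pperm as)"
    by auto
qed

lemma jm_moment_on_commute_single:
  assumes p: "pp_supp p \<subseteq> A"
  shows "jm_moment_on A k * Poly_Mapping.single p 1 = Poly_Mapping.single p 1 * jm_moment_on A k"
proof -
  let ?w = "pp_perm p"
  have w: "?w permutes A" by (rule permutes_subset[OF pp_perm_permutes p])
  have bij: "bij_betw (map ?w) (jm_tuples k A) (jm_tuples k A)"
  proof (rule bij_betw_byWitness[where f' = "map (inv ?w)"])
    show "\<forall>as\<in>jm_tuples k A. map (inv ?w) (map ?w as) = as"
      by (simp add: permutes_inverses[OF w] o_def)
    show "\<forall>as\<in>jm_tuples k A. map ?w (map (inv ?w) as) = as"
      by (simp add: permutes_inverses[OF w] o_def)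
  qed (use jm_tuples_conj[OF w] jm_tuples_conj[OF permutes_inv[OF w]] in auto)
  have "jm_moment_on A k * Poly_Mapping.single p 1 =
      (\<Sum>as \<in> jm_tuples k A. Poly_Mapping.single (jm_pperm as + p) 1)"
    by (simp add: jm_moment_on_def sum_distrib_right mult_single)
  also have "\<dots> = (\<Sum>as \<in> jm_tuples k A. Poly_Mapping.single (jm_pperm (map ?w as) + p) 1)"
    by (rule sum.reindex_bij_betw[OF bij, symmetric])
  also have "\<dots> = (\<Sum>as \<in> jm_tuples k A. Poly_Mapping.single (p + jm_pperm as) 1)"
    by (intro sum.cong) (simp_all add: jm_pperm_conj jm_tuples_def)
  also have "\<dots> = Poly_Mapping.single p 1 * jm_moment_on A k"
    by (simp add: jm_moment_on_def sum_distrib_left mult_single)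
  finally show ?thesis .
qed

lemma jm_moment_commute: "jm_moment k * jm_moment l = jm_moment l * jm_moment k"
proof (rule pp_limit_eqI)
  fix q :: nat
  let ?A = "{1..q}"
  have "jm_moment_on ?A k * jm_moment_on ?A l =
      (\<Sum>as \<in> jm_tuples l ?A. jm_moment_on ?A k * Poly_Mapping.single (jm_pperm as) 1)"
    by (simp add: jm_moment_on_def[of _ l] sum_distrib_left)
  also have "\<dots> = (\<Sum>as \<in> jm_tuples l ?A. Poly_Mapping.single (jm_pperm as) 1 * jm_moment_on ?A k)"
    by (intro sum.cong jm_moment_on_commute_single) (auto simp: jm_tuples_def pp_supp_jm)
  also have "\<dots> = jm_moment_on ?A l * jm_moment_on ?A k"
    by (simp add: jm_moment_on_def[of _ l] sum_distrib_right)
  finally show "pp_proj (jm_moment k * jm_moment l) q = pp_proj (jm_moment l * jm_moment k) q"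
    by (simp add: times_pp_limit.rep_eq jm_moment.rep_eq)
qed


section \<open>Free cumulants\<close>

definition noncrossing :: "'a :: linorder set set \<Rightarrow> bool" where
  "noncrossing P \<longleftrightarrow>
     \<not> (\<exists>X\<in>P. \<exists>Y\<in>P. X \<noteq> Y \<and>
          (\<exists>a\<in>X. \<exists>b\<in>Y. \<exists>c\<in>X. \<exists>d\<in>Y. a < b \<and> b < c \<and> c < d))"

definition NC :: "nat \<Rightarrow> nat set set set" where
  "NC n = {P. partition_on {1..n} P \<and> noncrossing P}"

text \<open>
  The order \<open>1 < 1' < 2 < 2' < \<dots> < n < n'\<close> is realised by \<open>i \<mapsto> 2 i\<close> and \<open>i' \<mapsto> 2 i + 1\<close>; the
  complement itself is a partition of \<open>{1..n}\<close>, with the primes dropped.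
\<close>

definition kreweras_admissible :: "nat set set \<Rightarrow> nat set set \<Rightarrow> bool" where
  "kreweras_admissible \<rho> \<sigma> \<longleftrightarrow>
     noncrossing ((\<lambda>b. (\<lambda>i. 2 * i) ` b) ` \<rho> \<union> (\<lambda>b. (\<lambda>i. 2 * i + 1) ` b) ` \<sigma>)"

definition kreweras :: "nat \<Rightarrow> nat set set \<Rightarrow> nat set set" where
  "kreweras n \<rho> =
     (THE \<sigma>. \<sigma> \<in> NC n \<and> kreweras_admissible \<rho> \<sigma> \<and>
        (\<forall>\<tau>\<in>NC n. kreweras_admissible \<rho> \<tau> \<longrightarrow> refines {1..n} \<tau> \<sigma>))"

definition catalan :: "nat \<Rightarrow> complex" where
  "catalan k = fact (2 * k) / (fact (k + 1) * fact k)"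

definition Moeb :: "nat set set \<Rightarrow> complex" where
  "Moeb \<sigma> = (\<Prod>b\<in>\<sigma>. (- 1) ^ (card b - 1) * catalan (card b - 1))"

text \<open>
  The type of the limit algebra is not commutative, so products are taken in a fixed order, here
  by increasing block size.  By the lemma \<open>jm_moment_commute\<close> the order is irrelevant.
\<close>

definition jm_moment_partition :: "nat set set \<Rightarrow> pp_limit" where
  "jm_moment_partition \<rho> =
     prod_list (map jm_moment (sorted_list_of_multiset (image_mset card (mset_set \<rho>))))"

definition free_cumulant :: "nat \<Rightarrow> pp_limit" where
  "free_cumulant n = (\<Sum>\<rho> \<in> NC n. Moeb (kreweras n \<rho>) *\<^sub>C jm_moment_partition \<rho>)"


section \<open>The second-order term and the error term\<close>

text \<open>
  The sequences \<open>m\<^sub>2, m\<^sub>3, \<dots>\<close> with \<open>2 m\<^sub>2 + 3 m\<^sub>3 + \<dots> = N\<close>, as finitely supported functions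
  vanishing at \<open>0\<close> and \<open>1\<close>.
\<close>

definition mult_seqs :: "nat \<Rightarrow> (nat \<Rightarrow> nat) set" where
  "mult_seqs N = {m. finite {s. m s \<noteq> 0} \<and> m 0 = 0 \<and> m 1 = 0 \<and> (\<Sum>s | m s \<noteq> 0. s * m s) = N}"

lemma finite_mult_seqs: "finite (mult_seqs N)"
proof (rule finite_subset)
  show "mult_seqs N \<subseteq> {m. \<forall>s. (s \<in> {..N} \<longrightarrow> m s \<in> {..N}) \<and> (s \<notin> {..N} \<longrightarrow> m s = 0)}"
  proof
    fix m assume m: "m \<in> mult_seqs N"
    have *: "s \<le> N \<and> m s \<le> N" if "m s \<noteq> 0" for s
    proof -
      have "s * m s \<le> N"
        using m that member_le_sum[of s "{s. m s \<noteq> 0}" "\<lambda>s. s * m s"]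
        by (auto simp: mult_seqs_def)
      moreover have "s \<noteq> 0"
        using m that by (intro notI) (simp add: mult_seqs_def)
      then have "s \<le> s * m s" "m s \<le> s * m s"
        using that by simp_all
      ultimately show ?thesis by linarith
    qed
    show "m \<in> {m. \<forall>s. (s \<in> {..N} \<longrightarrow> m s \<in> {..N}) \<and> (s \<notin> {..N} \<longrightarrow> m s = 0)}"
    proof (intro CollectI allI)
      fix s
      show "(s \<in> {..N} \<longrightarrow> m s \<in> {..N}) \<and> (s \<notin> {..N} \<longrightarrow> m s = 0)"
        using *[of s] by (cases "m s = 0") auto
    qed
  qed
  show "finite {m :: nat \<Rightarrow> nat. \<forall>s. (s \<in> {..N} \<longrightarrow> m s \<in> {..N}) \<and> (s \<notin> {..N} \<longrightarrow> m s = 0)}"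
    by (rule finite_set_of_finite_funs) simp_all
qed

definition multinomial_coeff :: "(nat \<Rightarrow> nat) \<Rightarrow> complex" where
  "multinomial_coeff m = fact (\<Sum>s | m s \<noteq> 0. m s) / (\<Prod>s | m s \<noteq> 0. fact (m s))"

text \<open>The product \<open>\<Prod>\<^bsub>s \<ge> 2\<^esub> ((s - 1) R\<^sub>s)\<^bsup>m\<^sub>s\<^esup>\<close>, with the factors by increasing \<open>s\<close>.\<close>

definition cumulant_prod :: "(nat \<Rightarrow> nat) \<Rightarrow> pp_limit" where
  "cumulant_prod m =
     prod_list (map (\<lambda>s. (of_nat (s - 1) *\<^sub>C free_cumulant s) ^ m s)
                    (sorted_list_of_set {s. m s \<noteq> 0}))"

text \<open>
  The linear combinations of products \<open>M\<^bsub>j\<^sub>1\<^esub> \<cdots> M\<^bsub>j\<^sub>r\<^esub>\<close> with \<open>r \<ge> 0\<close>, all \<open>j\<^sub>i \<ge> 2\<close> and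
  \<open>j\<^sub>1 + \<dots> + j\<^sub>r \<le> d\<close>.  The bound is an integer: for negative \<open>d\<close> there is no such product, and
  only \<open>0\<close> remains.
\<close>

definition jm_degree_le :: "int \<Rightarrow> pp_limit set" where
  "jm_degree_le d =
     pp_limit.span {prod_list (map jm_moment js) | js. (\<forall>j\<in>set js. 2 \<le> j) \<and> int (sum_list js) \<le> d}"

end

theory Submission
  imports Defs "HOL-Computational_Algebra.Formal_Power_Series"
begin

unbundle fps_syntax

text \<open>
  Let \<open>H(z) = 1 / G(z)\<close> be the reciprocal of the moment series \<open>G(z) = \<Sum> M\<^sub>k z\<^sup>-\<^sup>k\<^sup>-\<^sup>1\<close>.  The key is the
  exact identity \<open>\<Sigma>\<^sub>k = - 1/k [z\<^sup>-\<^sup>1] H(z) H(z - 1) \<cdots> H(z - k + 1)\<close>, proved inside the semigroup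
  algebra without representation theory.  Decomposing at the first return to the star gives
  \<open>H(z) = z - \<Sum>\<^sub>c (z - J\<^sub>c)\<^sup>-\<^sup>1\<close>, where \<open>J\<^sub>c\<close> is the Jucys--Murphy element of \<open>c\<close> over
  \<open>A - {c}\<close>; the relation \<open>(b c) J\<^sub>c = J\<^sub>b (b c) - 1\<close> shows that adding a point with Jucys--Murphy
  element \<open>x\<close> multiplies \<open>H\<close> by \<open>1 - (z - x)\<^sup>-\<^sup>2\<close>, and that summing \<open>(b c) f(J\<^sub>c)\<close> over \<open>c\<close> gives
  the polynomial part of \<open>f H\<close> at \<open>J\<^sub>b\<close>.  Adding the letters of a cycle one at a time, the sum of
  the cycles through \<open>b\<close> becomes an explicit polynomial in \<open>J\<^sub>b\<close>, because the factors
  \<open>1 - (z - i - x)\<^sup>-\<^sup>2\<close> telescope.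

  After a translation of \<open>z\<close> the shifts are symmetric about \<open>0\<close>, so all terms of odd order cancel:
  the product equals \<open>H\<^sup>k\<close> plus a term of degree lower by two plus terms of degree lower by four.
  Lagrange inversion turns the first two residues into \<open>R\<^sub>n\<close> and the multinomial sum.  For the
  first, \<open>1 + R(u) = M(u / (1 + R(u)))\<close> follows from a recursive decomposition of non-crossing
  partitions together with their Kreweras complements.
\<close>

section \<open>Formal power series and translations\<close>

text \<open>The obstacle is commutativity: inversion and composition of series are carried out over
  commutative rings, while neither the limit algebra nor the algebras over finite sets are
  commutative. Hence \<open>jm_alg\<close> consists of families, one element for each set A,
  generated by the moments, and \<open>box_alg\<close> of families indexed by a set and a further
  point b. One element can then be evaluated both at A and at A with b added, and
  \<open>to_limit\<close> carries the result over at the end.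

  Supports turn the square of a transposition into a central idempotent with support {b, c}; this
  idempotent replaces the 1 in the relation between J_b and J_c.

  Origin of binom(n, 3)/4: with k = n - 1 factors, a pair of shifts a, -a contributes a^2 (H H'' -
  H'^2), and a^2 summed over the pairs is k (k^2 - 1)/24. The residue of H^(k-2) (H H'' - H'^2) is
  -k times that of H^(k-2) H'^2, which cancels the prefactor -1/k. In the coordinate w = 1/H the
  derivative H' is 1/(1 - sum (s-1) R_s w^s), a geometric series whose coefficients are the
  multinomial sums.\<close>

class complex_algebra = comm_ring_1 +
  fixes cscal :: "complex \<Rightarrow> 'a"
  assumes cscal_add: "cscal (a + b) = cscal a + cscal b"
    and cscal_mult: "cscal (a * b) = cscal a * cscal b"
    and cscal_1 [simp]: "cscal 1 = 1"
begin

lemma cscal_0 [simp]: "cscal 0 = 0"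
  using cscal_add[of 0 0] by simp

lemma cscal_minus: "cscal (- a) = - cscal a"
  using cscal_add[of "-a" a] by (simp add: eq_neg_iff_add_eq_0)

lemma cscal_diff: "cscal (a - b) = cscal a - cscal b"
  using cscal_add[of a "-b"] by (simp add: cscal_minus)

lemma cscal_of_nat [simp]: "cscal (of_nat n) = of_nat n"
  by (induction n) (auto simp: cscal_add)

lemma cscal_numeral [simp]: "cscal (numeral w) = numeral w"
  using cscal_of_nat[of "numeral w"] by simp

lemma cscal_power: "cscal (a ^ n) = cscal a ^ n"
  by (induction n) (auto simp: cscal_mult)

lemma cscal_sum: "cscal (sum f A) = (\<Sum>i\<in>A. cscal (f i))"
  by (induction A rule: infinite_finite_induct) (auto simp: cscal_add)

lemma cscal_cancel:
  assumes "cscal c * x = cscal c * y" "c \<noteq> 0"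
  shows "x = y"
proof -
  have "cscal (inverse c * c) * x = cscal (inverse c * c) * y"
    using assms(1) by (simp only: cscal_mult mult.assoc)
  with assms(2) show ?thesis by simp
qed

end

subsection \<open>Substitution in formal power series\<close>

text \<open>\<open>b i\<close> stands in for \<open>X^i\<close> and is divisible by it in both uses,
  so cutting the sum at \<open>n\<close> loses nothing. For translations it comes from (z + a)^(k -
  i), for composition it is \<open>y^i\<close>.\<close>

definition fps_subst :: "(nat \<Rightarrow> 'a::comm_ring_1 fps) \<Rightarrow> 'a fps \<Rightarrow> 'a fps" where
  "fps_subst b f = Abs_fps (\<lambda>n. \<Sum>i\<le>n. f $ i * b i $ n)"

lemma fps_subst_trunc:
  assumes "\<And>i n. n < i \<Longrightarrow> b i $ n = 0" and "n \<le> N"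
  shows "fps_subst b f $ n = (\<Sum>i\<le>N. fps_const (f $ i) * b i) $ n"
proof -
  have "(\<Sum>i\<le>N. f $ i * b i $ n) = (\<Sum>i\<le>n. f $ i * b i $ n)"
    using assms by (intro sum.mono_neutral_right) auto
  then show ?thesis
    by (simp add: fps_subst_def fps_sum_nth)
qed

text \<open>Multiplicativity only requires that products of the substituted series depend on
  \<open>i + j\<close>. The families differ because translation treats the weights \<open>k\<close>,
  \<open>l\<close> and \<open>k + l\<close> differently.\<close>

lemma fps_subst_mult:
  assumes b: "\<And>i n. n < i \<Longrightarrow> b i $ n = 0" and c: "\<And>i n. n < i \<Longrightarrow> c i $ n = 0"
    and bc: "\<And>i j. b i * c j = d (i + j)"
  shows "fps_subst b f * fps_subst c g = fps_subst d (f * g)"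
proof (rule fps_ext)
  fix n
  have d: "d s $ m = 0" if "m < s" for s m
    using bc[of 0 s] that by (metis (no_types, lifting) add_0 c fps_mult_nth le_less_trans
        diff_le_self mult_zero_right sum.neutral)
  have "(fps_subst b f * fps_subst c g) $ n =
      ((\<Sum>i\<le>n. fps_const (f $ i) * b i) * (\<Sum>j\<le>n. fps_const (g $ j) * c j)) $ n"
    unfolding fps_mult_nth
    by (intro sum.cong refl arg_cong2[of _ _ _ _ "(*)"] fps_subst_trunc b c) auto
  also have "\<dots> = (\<Sum>i\<le>n. \<Sum>j\<le>n. f $ i * g $ j * d (i + j) $ n)"
  proof -
    have "fps_const (f $ i) * b i * (fps_const (g $ j) * c j) = fps_const (f $ i * g $ j) * d (i + j)" for i j
      by (simp add: bc[symmetric] fps_const_mult[symmetric] algebra_simps del: fps_const_mult)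
    then show ?thesis by (simp add: sum_product fps_sum_nth)
  qed
  also have "\<dots> = (\<Sum>(i, j)\<in>{(i, j). i + j \<le> n}. f $ i * g $ j * d (i + j) $ n)"
    unfolding sum.cartesian_product
  proof (intro sum.mono_neutral_right ballI)
    fix p assume "p \<in> {..n} \<times> {..n} - {(i, j). i + j \<le> n}"
    then show "(case p of (i, j) \<Rightarrow> f $ i * g $ j * d (i + j) $ n) = 0"
      by (auto simp: d not_le)
  qed auto
  also have "\<dots> = (\<Sum>s\<le>n. \<Sum>i\<le>s. f $ i * g $ (s - i) * d s $ n)"
    by (subst sum.triangle_reindex_eq) (intro sum.cong refl, simp)
  also have "\<dots> = fps_subst d (f * g) $ n"
    by (simp add: fps_subst_def fps_mult_nth sum_distrib_right atLeast0AtMost)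
  finally show "(fps_subst b f * fps_subst c g) $ n = fps_subst d (f * g) $ n" .
qed

lemma fps_unit_cancel:
  fixes f g l :: "'a::comm_ring_1 fps"
  assumes "l * l' = 1" "f * l = g * l" shows "f = g"
proof -
  have "f * (l * l') = g * (l * l')" using assms(2) by (simp only: mult.assoc[symmetric])
  with assms(1) show ?thesis by simp
qed

subsection \<open>Translation of the variable\<close>

text \<open>The binomial series \<open>(1 + a X)^c\<close>.\<close>

definition fps_bin :: "complex \<Rightarrow> complex \<Rightarrow> 'a::complex_algebra fps" where
  "fps_bin a c = Abs_fps (\<lambda>m. cscal (a ^ m * (c gchoose m)))"

lemma fps_bin_mult: "fps_bin a c * fps_bin a d = fps_bin a (c + d)"
proof (rule fps_ext)
  fix n
  have "a ^ i * (c gchoose i) * (a ^ (n - i) * (d gchoose (n - i))) = a ^ n * ((c gchoose i) * (d gchoose (n - i)))"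
    if "i \<le> n" for i
  proof -
    from that have "a ^ n = a ^ i * a ^ (n - i)" by (simp add: power_add[symmetric])
    then show ?thesis by simp
  qed
  then have "(\<Sum>i=0..n. a ^ i * (c gchoose i) * (a ^ (n - i) * (d gchoose (n - i)))) =
      a ^ n * (\<Sum>i=0..n. (c gchoose i) * (d gchoose (n - i)))"
    unfolding sum_distrib_left by (intro sum.cong refl) simp
  then show "(fps_bin a c * fps_bin a d :: 'a fps) $ n = fps_bin a (c + d) $ n"
    by (simp add: fps_bin_def fps_mult_nth cscal_mult[symmetric] cscal_sum[symmetric] gbinomial_Vandermonde)
qed

text \<open>
  A power series \<open>f\<close> of weight \<open>k\<close> stands for the Laurent series \<open>z\<^sup>k f(1/z)\<close>; then
  \<open>fps_shift_var a k f\<close> stands for its value at \<open>z + a\<close>.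
\<close>

definition fps_shift_var :: "complex \<Rightarrow> complex \<Rightarrow> 'a::complex_algebra fps \<Rightarrow> 'a fps" where
  "fps_shift_var a k = fps_subst (\<lambda>j. fps_X ^ j * fps_bin a (k - of_nat j))"

lemma fps_shift_var_nth:
  "fps_shift_var a k f $ n =
     (\<Sum>i\<le>n. f $ i * cscal (a ^ (n - i) * ((k - of_nat i) gchoose (n - i))))"
  by (simp add: fps_shift_var_def fps_subst_def fps_bin_def fps_X_power_mult_nth)

lemma fps_shift_var_mult:
  "fps_shift_var a k f * fps_shift_var a l g = fps_shift_var a (k + l) (f * g)"
  unfolding fps_shift_var_def
proof (rule fps_subst_mult)
  show "fps_X ^ i * fps_bin a (k - of_nat i) * (fps_X ^ j * fps_bin a (l - of_nat j)) =
      fps_X ^ (i + j) * (fps_bin a (k + l - of_nat (i + j)) :: 'a fps)" for i j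
  proof -
    have "k + l - of_nat (i + j) = (k - of_nat i) + (l - of_nat j)" by simp
    then have "fps_bin a (k + l - of_nat (i + j)) = (fps_bin a (k - of_nat i) * fps_bin a (l - of_nat j) :: 'a fps)"
      by (simp only: fps_bin_mult)
    then show ?thesis by (simp add: power_add algebra_simps)
  qed
qed (simp_all add: fps_X_power_mult_nth)

lemma fps_shift_var_0 [simp]: "fps_shift_var 0 k f = f"
proof (rule fps_ext)
  fix n
  have "(\<Sum>i\<le>n. f $ i * cscal (0 ^ (n - i) * ((k - of_nat i) gchoose (n - i)))) = (\<Sum>i\<le>n. if i = n then f $ i else 0)"
    by (intro sum.cong) (auto simp: power_0_left)
  then show "fps_shift_var 0 k f $ n = f $ n"
    by (simp add: fps_shift_var_nth)
qed

text \<open>Trinomial revision takes the factor depending on \<open>n - j\<close> alone out of the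
  inner sum and leaves the binomial theorem for \<open>(a + b)^(n - j)\<close>.\<close>

lemma fps_shift_var_shift_var:
  "fps_shift_var a k (fps_shift_var b k f) = fps_shift_var (a + b) k f"
proof (rule fps_ext)
  fix n
  have *: "(\<Sum>i=j..n. (b ^ (i - j) * ((k - of_nat j) gchoose (i - j))) * (a ^ (n - i) * ((k - of_nat i) gchoose (n - i)))) =
      (a + b) ^ (n - j) * ((k - of_nat j) gchoose (n - j))" if "j \<le> n" for j
  proof -
    let ?K = "k - of_nat j"
    have "(\<Sum>i=j..n. (b ^ (i - j) * (?K gchoose (i - j))) * (a ^ (n - i) * ((k - of_nat i) gchoose (n - i)))) =
        (\<Sum>p=0..n-j. (b ^ p * (?K gchoose p)) * (a ^ (n - j - p) * ((?K - of_nat p) gchoose (n - j - p))))"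
      using that by (intro sum.reindex_bij_witness[of _ "\<lambda>p. p + j" "\<lambda>i. i - j"]) (auto simp: of_nat_diff)
    also have "\<dots> = (\<Sum>p=0..n-j. (?K gchoose (n - j)) * (of_nat ((n - j) choose p) * b ^ p * a ^ (n - j - p)))"
    proof (intro sum.cong refl)
      fix p assume "p \<in> {0..n-j}"
      then have "(?K gchoose p) * ((?K - of_nat p) gchoose (n - j - p)) = (?K gchoose (n - j)) * of_nat ((n - j) choose p)"
        using gbinomial_trinomial_revision[of p "n - j" ?K] by (simp add: binomial_gbinomial)
      then show "(b ^ p * (?K gchoose p)) * (a ^ (n - j - p) * ((?K - of_nat p) gchoose (n - j - p))) =
          (?K gchoose (n - j)) * (of_nat ((n - j) choose p) * b ^ p * a ^ (n - j - p))"
        by (simp add: algebra_simps)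
    qed
    also have "\<dots> = (a + b) ^ (n - j) * (?K gchoose (n - j))"
      by (simp only: sum_distrib_left[symmetric] binomial_ring[of b a] atLeast0AtMost add.commute[of a] mult.commute)
    finally show ?thesis .
  qed
  have "fps_shift_var a k (fps_shift_var b k f) $ n =
      (\<Sum>i\<le>n. \<Sum>j\<le>i. f $ j * cscal ((b ^ (i - j) * ((k - of_nat j) gchoose (i - j))) * (a ^ (n - i) * ((k - of_nat i) gchoose (n - i)))))"
    unfolding fps_shift_var_nth sum_distrib_right cscal_mult by (simp add: mult.assoc)
  also have "\<dots> = (\<Sum>j\<le>n. \<Sum>i=j..n. f $ j * cscal ((b ^ (i - j) * ((k - of_nat j) gchoose (i - j))) * (a ^ (n - i) * ((k - of_nat i) gchoose (n - i)))))"
    by (subst sum.Sigma, simp, simp, subst sum.Sigma, simp, simp, intro sum.reindex_bij_witness[of _ "\<lambda>(j,i). (i,j)" "\<lambda>(i,j). (j,i)"]) auto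
  also have "\<dots> = fps_shift_var (a + b) k f $ n"
    unfolding fps_shift_var_nth sum_distrib_left[symmetric] cscal_sum[symmetric]
    by (intro sum.cong refl arg_cong2[of _ _ _ _ "(*)"] arg_cong[of _ _ cscal] *) simp
  finally show "fps_shift_var a k (fps_shift_var b k f) $ n = fps_shift_var (a + b) k f $ n" .
qed

lemma of_nat_gchoose_eq_0: "m < n \<Longrightarrow> (of_nat m :: complex) gchoose n = 0"
  by (metis binomial_eq_0 binomial_gbinomial of_nat_0)

text \<open>At weight \<open>k\<close> the coefficient \<open>Suc k\<close> belongs to z^-1.
  Non-negative powers of z translate into polynomials, so only the z^-1 term itself
  contributes.\<close>

lemma fps_shift_var_residue: "fps_shift_var a (of_nat k) f $ Suc k = f $ Suc k"
proof -
  have "f $ i * cscal (a ^ (Suc k - i) * ((of_nat k - of_nat i) gchoose (Suc k - i))) = 0" if "i \<le> k" for i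
    using that of_nat_gchoose_eq_0[of "k - i" "Suc k - i"] by (simp add: of_nat_diff)
  then show ?thesis
    by (simp add: fps_shift_var_nth)
qed

text \<open>The coefficient of z^-2: expanding 1/(z + a) adds \<open>- a\<close> times the
  residue.\<close>

lemma fps_shift_var_residue2:
  "fps_shift_var a (of_nat k) f $ Suc (Suc k) = f $ Suc (Suc k) - cscal a * f $ Suc k"
proof -
  have "f $ i * cscal (a ^ (Suc (Suc k) - i) * ((of_nat k - of_nat i) gchoose (Suc (Suc k) - i))) = 0" if "i \<le> k" for i
    using that of_nat_gchoose_eq_0[of "k - i" "Suc (Suc k) - i"] by (simp add: of_nat_diff)
  then show ?thesis
    by (simp add: fps_shift_var_nth cscal_minus)
qed

text \<open>The polynomial part of \<open>z\<^sup>k f(1/z)\<close>, evaluated at \<open>z = y\<close>.\<close>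

definition poly_part :: "nat \<Rightarrow> 'a::comm_ring_1 fps \<Rightarrow> 'a \<Rightarrow> 'a" where
  "poly_part k f y = (\<Sum>j\<le>k. f $ j * y ^ (k - j))"

text \<open>Translation preserves polynomials and also series in negative powers of z, so it
  commutes with taking the polynomial part.\<close>

lemma poly_part_shift_var:
  "poly_part k (fps_shift_var a (of_nat k) f) y = poly_part k f (y + cscal a)"
proof -
  have *: "(\<Sum>i=j..k. cscal (a ^ (i - j) * ((of_nat k - of_nat j) gchoose (i - j))) * y ^ (k - i)) = (y + cscal a) ^ (k - j)"
    if "j \<le> k" for j
  proof -
    have "(\<Sum>i=j..k. cscal (a ^ (i - j) * ((of_nat k - of_nat j) gchoose (i - j))) * y ^ (k - i)) =
        (\<Sum>p\<le>k-j. cscal (a ^ p * ((of_nat k - of_nat j) gchoose p)) * y ^ (k - j - p))"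
      using that by (intro sum.reindex_bij_witness[of _ "\<lambda>p. p + j" "\<lambda>i. i - j"]) auto
    also have "\<dots> = (\<Sum>p\<le>k-j. of_nat ((k - j) choose p) * cscal a ^ p * y ^ (k - j - p))"
      using that by (intro sum.cong) (auto simp: cscal_mult cscal_power binomial_gbinomial of_nat_diff mult_ac
            simp flip: cscal_of_nat)
    also have "\<dots> = (y + cscal a) ^ (k - j)"
      by (simp only: binomial_ring[of "cscal a" y] add.commute[of y])
    finally show ?thesis .
  qed
  have "poly_part k (fps_shift_var a (of_nat k) f) y =
     (\<Sum>i\<le>k. \<Sum>j\<le>i. f $ j * (cscal (a ^ (i - j) * ((of_nat k - of_nat j) gchoose (i - j))) * y ^ (k - i)))"
    unfolding poly_part_def fps_shift_var_nth sum_distrib_right by (simp add: mult.assoc)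
  also have "\<dots> = (\<Sum>j\<le>k. \<Sum>i=j..k. f $ j * (cscal (a ^ (i - j) * ((of_nat k - of_nat j) gchoose (i - j))) * y ^ (k - i)))"
    by (subst sum.Sigma, simp, simp, subst sum.Sigma, simp, simp, intro sum.reindex_bij_witness[of _ "\<lambda>(j,i). (i,j)" "\<lambda>(i,j). (j,i)"]) auto
  also have "\<dots> = poly_part k f (y + cscal a)"
    unfolding poly_part_def sum_distrib_left[symmetric] by (intro sum.cong refl) (simp add: *)
  finally show ?thesis .
qed

text \<open>The series \<open>1 / (1 - y X)\<close>, which with weight -1 stands for 1/(z - y).
  Residues against it evaluate polynomial parts at \<open>y\<close>.\<close>

definition fps_geo :: "'a::comm_ring_1 \<Rightarrow> 'a fps" where
  "fps_geo y = Abs_fps (\<lambda>n. y ^ n)"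

lemma fps_geo_inverse: "fps_geo y * (1 - fps_const y * fps_X) = 1"
proof (rule fps_ext)
  fix n
  have "(fps_geo y * (1 - fps_const y * fps_X)) $ n = fps_geo y $ n - y * (if n = 0 then 0 else fps_geo y $ (n - 1))"
    by (simp add: algebra_simps fps_mult_fps_X_commute[symmetric])
  then show "(fps_geo y * (1 - fps_const y * fps_X)) $ n = 1 $ n"
    by (cases n) (simp_all add: fps_geo_def)
qed

lemma poly_part_eq_nth: "poly_part k f y = (f * fps_geo y) $ k"
  by (simp add: poly_part_def fps_mult_nth fps_geo_def atLeast0AtMost)

text \<open>Partial fractions: 1/(z - y) - 1/(z - y') = (y - y') / ((z - y) (z - y')).\<close>

lemma poly_part_diff:
  "poly_part (Suc k) f y - poly_part (Suc k) f y' = (y - y') * (f * fps_geo y * fps_geo y') $ k"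
proof -
  let ?l = "1 - fps_const y * fps_X" and ?l' = "1 - fps_const y' * fps_X"
  have "fps_geo y - fps_geo y' = fps_geo y * (fps_geo y' * ?l') - fps_geo y' * (fps_geo y * ?l)"
    by (simp only: fps_geo_inverse mult_1_right)
  also have "\<dots> = fps_const (y - y') * fps_X * (fps_geo y * fps_geo y')"
    by (simp add: algebra_simps fps_const_sub[symmetric] del: fps_const_sub)
  finally have *: "fps_geo y - fps_geo y' = fps_const (y - y') * fps_X * (fps_geo y * fps_geo y')" .
  have "f * fps_geo y - f * fps_geo y' = f * (fps_geo y - fps_geo y')"
    by (simp only: right_diff_distrib)
  also have "\<dots> = fps_const (y - y') * (fps_X * (f * fps_geo y * fps_geo y'))"
    unfolding * by (simp only: ac_simps)
  finally have "f * fps_geo y - f * fps_geo y' = fps_const (y - y') * (fps_X * (f * fps_geo y * fps_geo y'))" .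
  then have "(f * fps_geo y - f * fps_geo y') $ Suc k = (y - y') * (f * fps_geo y * fps_geo y') $ k"
    by (simp del: fps_sub_nth)
  then show ?thesis by (simp add: poly_part_eq_nth)
qed

text \<open>The polynomial part of the product is sorted by the coefficients of \<open>F\<close>.
  The sum stops at \<open>k\<close>; the omitted index \<open>Suc k\<close> meets only the constant
  term of \<open>h\<close>, hence the correction.\<close>

lemma poly_part_mult:
  "(\<Sum>j\<le>k. F $ j * poly_part (Suc (k - j)) h y) = poly_part (Suc k) (F * h) y - F $ Suc k * h $ 0"
proof -
  have "poly_part (Suc k) (F * h) y = (F * (h * fps_geo y)) $ Suc k"
    by (simp add: poly_part_eq_nth mult.assoc)
  also have "\<dots> = (\<Sum>j\<le>Suc k. F $ j * (h * fps_geo y) $ (Suc k - j))"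
    by (simp add: fps_mult_nth atLeast0AtMost)
  also have "\<dots> = (\<Sum>j\<le>k. F $ j * poly_part (Suc (k - j)) h y) + F $ Suc k * h $ 0"
    by (simp add: poly_part_eq_nth Suc_diff_le fps_geo_def)
  finally show ?thesis by simp
qed

subsection \<open>The product of translates\<close>

definition shift_prod :: "'a::complex_algebra fps \<Rightarrow> nat \<Rightarrow> 'a fps" where
  "shift_prod h k = (\<Prod>i<k. fps_shift_var (- of_nat i) 1 h)"

lemma shift_var_shift_prod:
  "fps_shift_var a (of_nat k) (shift_prod h k) = (\<Prod>i<k. fps_shift_var (a - of_nat i) 1 h)"
proof (induction k)
  case 0
  have "f = 1 \<Longrightarrow> fps_shift_var a 0 f = (1 :: 'a fps)" for f
  proof (rule fps_ext)
    fix n assume f: "f = 1"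
    have "(\<Sum>i\<le>n. f $ i * cscal (a ^ (n - i) * ((0 - of_nat i) gchoose (n - i)))) =
      (\<Sum>i\<le>n. if i = 0 then cscal (a ^ n * ((0::complex) gchoose n)) else 0)"
      by (intro sum.cong) (auto simp: f)
    then show "fps_shift_var a 0 f $ n = 1 $ n"
      by (cases n) (auto simp add: fps_shift_var_nth)
  qed
  then show ?case by (simp add: shift_prod_def)
next
  case (Suc k)
  have "fps_shift_var a (of_nat (Suc k)) (shift_prod h (Suc k)) =
      fps_shift_var a (of_nat k + 1) (shift_prod h k * fps_shift_var (- of_nat k) 1 h)"
    by (simp add: shift_prod_def add.commute)
  also have "\<dots> = fps_shift_var a (of_nat k) (shift_prod h k) * fps_shift_var (a - of_nat k) 1 h"
    by (simp add: fps_shift_var_mult[symmetric] fps_shift_var_shift_var)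
  finally show ?case by (simp add: Suc.IH)
qed

text \<open>A run of \<open>k\<close> consecutive translates, moved by -1, leaves room for H(z) at
  its upper end; moved by \<open>k\<close>, as in \<open>shift_prod_Suc_right\<close>, it leaves
  room at the lower end.\<close>

lemma shift_prod_Suc_left:
  "shift_prod h (Suc k) = fps_shift_var (- 1) (of_nat k) (shift_prod h k) * h"
proof -
  have "shift_prod h (Suc k) = h * (\<Prod>i<k. fps_shift_var (- 1 - of_nat i) 1 h)"
    by (simp add: shift_prod_def prod.lessThan_Suc_shift del: prod.lessThan_Suc)
  then show ?thesis by (simp add: shift_var_shift_prod)
qed

lemma shift_prod_Suc_right:
  "fps_shift_var (of_nat k) (of_nat k) (shift_prod h k) * h =
   fps_shift_var (of_nat k) (of_nat (Suc k)) (shift_prod h (Suc k))"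
  by (simp add: shift_var_shift_prod del: of_nat_Suc)

subsection \<open>Adding a box\<close>

text \<open>The series \<open>z - x - a\<close>, of weight \<open>1\<close>.\<close>

definition fps_lin :: "'a::complex_algebra \<Rightarrow> complex \<Rightarrow> 'a fps" where
  "fps_lin x a = 1 - fps_const (x + cscal a) * fps_X"

lemma fps_geo_fps_lin: "fps_geo (x + cscal a) * fps_lin x a = 1"
  by (simp only: fps_lin_def fps_geo_inverse)

lemma fps_lin_nth: "fps_lin x a $ n = (if n = 0 then 1 else if n = 1 then - (x + cscal a) else 0)"
  by (cases n) (auto simp: fps_lin_def)

lemma fps_shift_var_fps_lin: "fps_shift_var (- b) 1 (fps_lin x a) = fps_lin x (a + b)"
proof (rule fps_ext)
  fix n
  consider "n = 0" | "n = 1" | m where "n = Suc (Suc m)"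
    by (metis One_nat_def old.nat.exhaust)
  then show "fps_shift_var (- b) 1 (fps_lin x a) $ n = fps_lin x (a + b) $ n"
  proof cases
    case 3
    have "fps_lin x a $ i * cscal ((- b) ^ (n - i) * ((1 - of_nat i) gchoose (n - i))) = 0" for i
      using of_nat_gchoose_eq_0[of 1 n] 3 by (cases "i = 0"; cases "i = 1") (simp_all add: fps_lin_nth)
    then show ?thesis using 3 by (simp add: fps_shift_var_nth fps_lin_nth)
  qed (simp_all add: fps_shift_var_nth fps_lin_nth cscal_minus cscal_add)
qed

lemma fps_shift_var_mult3:
  "fps_shift_var b 1 f * fps_shift_var b 1 g * fps_shift_var b 1 l = fps_shift_var b 3 (f * g * l)"
  by (simp add: fps_shift_var_mult)

text \<open>The assumption \<open>rel\<close> says that \<open>hh\<close> is \<open>h\<close> multiplied by \<open>1 - (z - x)\<^sup>-\<^sup>2\<close>.\<close>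

lemma shift_prod_add_box:
  fixes x :: "'a::complex_algebra"
  assumes rel: "hh * fps_lin x 0 * fps_lin x 0 = h * fps_lin x 1 * fps_lin x (- 1)"
  shows "shift_prod hh (Suc k) * fps_lin x 0 * fps_lin x (of_nat k) =
         shift_prod h (Suc k) * fps_lin x (- 1) * fps_lin x (of_nat k + 1)"
proof (induction k)
  case 0
  show ?case using rel by (simp add: shift_prod_def ac_simps)
next
  case (Suc k)
  define K :: complex where "K = of_nat (Suc k)"
  have K1: "of_nat k = (-1 :: complex) + K" "of_nat k + 1 = K" "of_nat (Suc k) = K" "K + 1 = 1 + K"
    by (simp_all add: K_def)
  define hk hhk P Q where "hk = fps_shift_var (- K) 1 h" and "hhk = fps_shift_var (- K) 1 hh"
    and "P = shift_prod hh (Suc k)" and "Q = shift_prod h (Suc k)"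
  have relk: "hhk * fps_lin x K * fps_lin x K = hk * fps_lin x (1 + K) * fps_lin x (- 1 + K)"
    using arg_cong[OF rel, of "fps_shift_var (- K) 3"]
    unfolding fps_shift_var_mult3[symmetric] fps_shift_var_fps_lin hk_def hhk_def by simp
  have IH: "P * fps_lin x 0 * fps_lin x (- 1 + K) = Q * fps_lin x (- 1) * fps_lin x K"
    using Suc.IH unfolding P_def Q_def by (simp add: K_def add.commute)
  have "(P * hhk * fps_lin x 0 * fps_lin x K) * (fps_lin x (- 1 + K) * fps_lin x K) =
      (P * fps_lin x 0 * fps_lin x (- 1 + K)) * (hhk * fps_lin x K * fps_lin x K)"
    by (simp only: ac_simps)
  also have "\<dots> = (Q * hk * fps_lin x (- 1) * fps_lin x (1 + K)) * (fps_lin x (- 1 + K) * fps_lin x K)"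
    unfolding IH relk by (simp only: ac_simps)
  finally have *: "(P * hhk * fps_lin x 0 * fps_lin x K) * (fps_lin x (- 1 + K) * fps_lin x K) =
    (Q * hk * fps_lin x (- 1) * fps_lin x (1 + K)) * (fps_lin x (- 1 + K) * fps_lin x K)" .
  have "(fps_lin x (- 1 + K) * fps_lin x K) * (fps_geo (x + cscal (- 1 + K)) * fps_geo (x + cscal K)) =
      (fps_geo (x + cscal (- 1 + K)) * fps_lin x (- 1 + K)) * (fps_geo (x + cscal K) * fps_lin x K)"
    by (simp only: ac_simps)
  also have "\<dots> = 1" by (simp only: fps_geo_fps_lin mult_1_right)
  finally have "P * hhk * fps_lin x 0 * fps_lin x K = Q * hk * fps_lin x (- 1) * fps_lin x (1 + K)"
    using fps_unit_cancel * by blast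
  moreover have "shift_prod hh (Suc (Suc k)) = P * hhk" "shift_prod h (Suc (Suc k)) = Q * hk"
    by (simp_all add: shift_prod_def P_def Q_def hk_def hhk_def K_def)
  ultimately show ?case
    by (simp only: K1)
qed

text \<open>Inverting the linear factors replaces the poles x and x + k over the old set by x - 1
  and x + k + 1 over the new one. The distance k + 2 of the latter becomes the factor in
  \<open>shift_prod_add_box_poly_part\<close>.\<close>

lemma shift_prod_add_box_geo:
  fixes x :: "'a::complex_algebra"
  assumes rel: "hh * fps_lin x 0 * fps_lin x 0 = h * fps_lin x 1 * fps_lin x (- 1)"
  shows "shift_prod h (Suc k) * fps_geo x * fps_geo (x + of_nat k) =
         shift_prod hh (Suc k) * fps_geo (x - 1) * fps_geo (x + of_nat (Suc k))"
proof -
  let ?g = "\<lambda>a. fps_geo (x + cscal a)"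
  have "shift_prod h (Suc k) * ?g 0 * ?g (of_nat k) =
     shift_prod h (Suc k) * ?g 0 * ?g (of_nat k) * (?g (-1) * fps_lin x (-1)) * (?g (of_nat k + 1) * fps_lin x (of_nat k + 1))"
    by (simp only: fps_geo_fps_lin mult_1_right)
  also have "\<dots> = (shift_prod h (Suc k) * fps_lin x (- 1) * fps_lin x (of_nat k + 1)) * ?g 0 * ?g (of_nat k) * ?g (-1) * ?g (of_nat k + 1)"
    by (simp only: ac_simps)
  also have "\<dots> = shift_prod hh (Suc k) * ?g (-1) * ?g (of_nat k + 1) * (?g 0 * fps_lin x 0) * (?g (of_nat k) * fps_lin x (of_nat k))"
    unfolding shift_prod_add_box[OF rel, symmetric] by (simp only: ac_simps)
  also have "\<dots> = shift_prod hh (Suc k) * ?g (-1) * ?g (of_nat k + 1)"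
    by (simp only: fps_geo_fps_lin mult_1_right)
  finally show ?thesis by (simp add: cscal_minus cscal_add add_ac)
qed

lemma shift_prod_add_box_poly_part:
  fixes x :: "'a::complex_algebra"
  assumes rel: "hh * fps_lin x 0 * fps_lin x 0 = h * fps_lin x 1 * fps_lin x (- 1)"
  shows "of_nat (Suc (Suc k)) * (shift_prod h (Suc k) * fps_geo x * fps_geo (x + of_nat k)) $ k =
    poly_part (Suc k) (shift_prod hh (Suc k)) (x + of_nat (Suc k)) -
    poly_part (Suc k) (shift_prod hh (Suc k)) (x - 1)"
  unfolding shift_prod_add_box_geo[OF rel]
  by (subst poly_part_diff) (simp add: ac_simps)

text \<open>The coefficient of \<open>shift_prod_add_box_poly_part\<close>, now over the old set,
  where the two poles differ by \<open>k\<close>. Passing from one expression to the other is one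
  step of the induction on the length of a cycle.\<close>

lemma shift_prod_geo_poly_part:
  "of_nat k * (shift_prod h (Suc k) * fps_geo x * fps_geo (x + of_nat k)) $ k =
    poly_part (Suc k) (shift_prod h (Suc k)) (x + of_nat k) -
    poly_part (Suc k) (shift_prod h (Suc k)) x"
  by (subst poly_part_diff) (simp add: ac_simps)

text \<open>
  The two error terms of \<open>poly_part_mult\<close> cancel, because the residue is invariant under
  translations.
\<close>

lemma shift_prod_step:
  fixes h :: "'a::complex_algebra fps" and k :: nat
  defines "P \<equiv> shift_prod h k"
  defines "Fp \<equiv> fps_shift_var (of_nat k) (of_nat k) P" and "Fm \<equiv> fps_shift_var (- 1) (of_nat k) P"
  shows "(\<Sum>j\<le>k. Fp $ j * poly_part (Suc (k - j)) h x) - (\<Sum>j\<le>k. Fm $ j * poly_part (Suc (k - j)) h x) =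
    poly_part (Suc k) (shift_prod h (Suc k)) (x + of_nat k) -
    poly_part (Suc k) (shift_prod h (Suc k)) x"
proof -
  have "Fp $ Suc k = P $ Suc k" "Fm $ Suc k = P $ Suc k"
    by (simp_all only: Fp_def Fm_def fps_shift_var_residue)
  moreover have "Fm * h = shift_prod h (Suc k)"
    by (simp only: Fm_def P_def shift_prod_Suc_left)
  moreover have "poly_part (Suc k) (Fp * h) x = poly_part (Suc k) (shift_prod h (Suc k)) (x + of_nat k)"
    unfolding Fp_def P_def shift_prod_Suc_right poly_part_shift_var by simp
  ultimately show ?thesis
    by (simp add: poly_part_mult)
qed

text \<open>Both products with \<open>h\<close> have the same coefficient at \<open>k + 2\<close>, a
  residue. The sums leave out j = k + 1, where \<open>h $ 1 = 0\<close>, and j = k + 2, so they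
  differ by the coefficients of \<open>Fm\<close> and \<open>Fp\<close> at \<open>k + 2\<close>. By
  \<open>fps_shift_var_residue2\<close> the translations by -1 and \<open>k\<close> account for the
  factor \<open>k + 1\<close>.\<close>

lemma shift_prod_residue:
  fixes h :: "'a::complex_algebra fps" and k :: nat
  defines "P \<equiv> shift_prod h k"
  defines "Fp \<equiv> fps_shift_var (of_nat k) (of_nat k) P" and "Fm \<equiv> fps_shift_var (- 1) (of_nat k) P"
  assumes h: "h $ 0 = 1" "h $ 1 = 0"
  shows "(\<Sum>j\<le>k. Fp $ j * h $ (k - j + 2)) - (\<Sum>j\<le>k. Fm $ j * h $ (k - j + 2)) =
    of_nat (Suc k) * P $ Suc k"
proof -
  have *: "(F * h) $ Suc (Suc k) = (\<Sum>j\<le>k. F $ j * h $ (k - j + 2)) + F $ Suc (Suc k)" for F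
  proof -
    have "(F * h) $ Suc (Suc k) = (\<Sum>j\<le>k. F $ j * h $ (Suc (Suc k) - j)) + F $ Suc (Suc k)"
      using h by (simp add: fps_mult_nth atLeast0AtMost)
    also have "(\<Sum>j\<le>k. F $ j * h $ (Suc (Suc k) - j)) = (\<Sum>j\<le>k. F $ j * h $ (k - j + 2))"
      by (intro sum.cong refl) (simp add: Suc_diff_le)
    finally show ?thesis .
  qed
  have "(Fp * h) $ Suc (Suc k) = shift_prod h (Suc k) $ Suc (Suc k)"
    unfolding Fp_def P_def shift_prod_Suc_right by (rule fps_shift_var_residue)
  moreover have "(Fm * h) $ Suc (Suc k) = shift_prod h (Suc k) $ Suc (Suc k)"
    by (simp only: Fm_def P_def shift_prod_Suc_left)
  moreover have "Fp $ Suc (Suc k) = P $ Suc (Suc k) - of_nat k * P $ Suc k"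
    "Fm $ Suc (Suc k) = P $ Suc (Suc k) + P $ Suc k"
    by (simp_all only: Fp_def Fm_def fps_shift_var_residue2) (simp_all add: cscal_minus)
  ultimately have "(\<Sum>j\<le>k. Fp $ j * h $ (k - j + 2)) =
      shift_prod h (Suc k) $ Suc (Suc k) - (P $ Suc (Suc k) - of_nat k * P $ Suc k)"
    "(\<Sum>j\<le>k. Fm $ j * h $ (k - j + 2)) = shift_prod h (Suc k) $ Suc (Suc k) - (P $ Suc (Suc k) + P $ Suc k)"
    by (simp_all only: * eq_diff_eq)
  then show ?thesis
    by (simp only:) (simp add: algebra_simps)
qed

subsection \<open>Lagrange inversion\<close>

lemma fps_mult_nth_cong:
  assumes "\<And>m. m \<le> n \<Longrightarrow> f $ m = g $ m"
  shows "(f * e) $ n = (g * e) $ n"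
  using assms by (simp add: fps_mult_nth)

lemma fps_power_nth_eq_0:
  fixes y :: "'a::comm_ring_1 fps"
  assumes "y $ 0 = 0" "n < i" shows "(y ^ i) $ n = 0"
proof -
  have "y = fps_X * fps_shift 1 y"
    using assms(1) by (auto simp: fps_eq_iff)
  then have "y ^ i = fps_X ^ i * fps_shift 1 y ^ i"
    by (metis power_mult_distrib)
  with assms(2) show ?thesis by (simp add: fps_X_power_mult_nth)
qed

section \<open>Composition with a power series without constant term\<close>

abbreviation fps_comp :: "'a::comm_ring_1 fps \<Rightarrow> 'a fps \<Rightarrow> 'a fps" where
  "fps_comp y \<equiv> fps_subst (\<lambda>i. y ^ i)"

lemma fps_comp_mult:
  assumes "y $ 0 = 0" shows "fps_comp y (f * g) = fps_comp y f * fps_comp y g"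
  by (rule fps_subst_mult[symmetric]) (simp_all add: assms fps_power_nth_eq_0 power_add)

lemma fps_subst_diff: "fps_subst b (f - g) = fps_subst b f - fps_subst b g"
  by (simp add: fps_eq_iff fps_subst_def algebra_simps sum_subtractf)

lemma fps_comp_1: "fps_comp y 1 = 1"
proof (rule fps_ext)
  fix n
  have "(\<Sum>i\<le>n. 1 $ i * (y ^ i) $ n) = (\<Sum>i\<le>n. if i = 0 then 1 $ n else 0)"
    by (intro sum.cong) auto
  then show "fps_comp y 1 $ n = 1 $ n"
    by (simp add: fps_subst_def)
qed

lemma fps_comp_power:
  assumes "y $ 0 = 0" shows "fps_comp y (f ^ n) = fps_comp y f ^ n"
  by (induction n) (simp_all add: fps_comp_mult[OF assms] fps_comp_1)

lemma fps_comp_X: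
  assumes "y $ 0 = 0" shows "fps_comp y fps_X = y"
proof (rule fps_ext)
  fix n
  have "(\<Sum>i\<le>n. fps_X $ i * (y ^ i) $ n) = (\<Sum>i\<le>n. if i = 1 then y $ n else 0)"
    by (intro sum.cong) auto
  then show "fps_comp y fps_X $ n = y $ n"
    using assms by (cases n) (simp_all add: fps_subst_def)
qed

lemma fps_deriv_power_Suc:
  fixes f :: "'a::comm_ring_1 fps"
  shows "fps_deriv (f ^ Suc n) = of_nat (Suc n) * (f ^ n * fps_deriv f)"
  by (induction n) (simp_all add: algebra_simps)

lemma fps_comp_deriv:
  assumes "y $ 0 = 0" shows "fps_deriv (fps_comp y f) = fps_comp y (fps_deriv f) * fps_deriv y"
proof (rule fps_ext)
  fix n
  have "fps_deriv (fps_comp y f) $ n = (\<Sum>i\<le>Suc n. f $ i * fps_deriv (y ^ i) $ n)"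
    by (simp add: fps_subst_def sum_distrib_left algebra_simps)
  also have "\<dots> = (\<Sum>i\<le>n. f $ Suc i * fps_deriv (y ^ Suc i) $ n)"
    by (subst sum.atMost_Suc_shift) simp
  also have "\<dots> = (\<Sum>i\<le>n. (fps_const (fps_deriv f $ i) * y ^ i * fps_deriv y) $ n)"
    unfolding fps_deriv_power_Suc
  proof (intro sum.cong refl)
    fix i
    have "(fps_const (fps_deriv f $ i) * y ^ i * fps_deriv y) $ n = of_nat (Suc i) * f $ Suc i * (y ^ i * fps_deriv y) $ n"
      by (simp add: mult.assoc)
    then show "f $ Suc i * (of_nat (Suc i) * (y ^ i * fps_deriv y)) $ n = (fps_const (fps_deriv f $ i) * y ^ i * fps_deriv y) $ n"
      by (simp only: fps_mult_of_nat_nth) (simp only: ac_simps)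
  qed
  also have "\<dots> = ((\<Sum>i\<le>n. fps_const (fps_deriv f $ i) * y ^ i) * fps_deriv y) $ n"
    by (simp only: sum_distrib_right fps_sum_nth)
  also have "\<dots> = (fps_comp y (fps_deriv f) * fps_deriv y) $ n"
    by (intro fps_mult_nth_cong) (simp add: fps_subst_trunc[of _ _ n] fps_power_nth_eq_0 assms)
  finally show "fps_deriv (fps_comp y f) $ n = (fps_comp y (fps_deriv f) * fps_deriv y) $ n" .
qed

lemma nth_X_deriv: "(fps_X * fps_deriv f) $ n = of_nat n * f $ n"
  by (cases n) simp_all

lemma of_nat_cancel:
  fixes x y :: "'a::complex_algebra"
  shows "of_nat (Suc n) * x = of_nat (Suc n) * y \<Longrightarrow> x = y"
  using cscal_cancel[of "of_nat (Suc n)" x y] by (simp del: of_nat_Suc)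

text \<open>The variable X is w = G(z), and y = 1/z. Then H(z) = h(y)/y = 1/w, and z = r(w)/w is the
  inverse function of G, so \<open>r\<close> collects the free cumulants and \<open>v\<close> is its
  reciprocal.\<close>

locale lagrange =
  fixes v r h :: "'a::complex_algebra fps"
  assumes vr: "v * r = 1" and comp_h: "fps_comp (fps_X * v) h = v"
begin

abbreviation "y \<equiv> fps_X * v"

lemma y_0: "y $ 0 = 0" by simp

lemma v_power_r_power: "v ^ m * r ^ (m + d) = r ^ d"
proof -
  have "v ^ m * r ^ (m + d) = (v * r) ^ m * r ^ d"
    by (simp only: power_add power_mult_distrib mult.assoc)
  then show ?thesis by (simp add: vr)
qed

lemma deriv_v: "fps_deriv v = - (v * v * fps_deriv r)"
proof -
  have "fps_deriv (v * r) = 0" by (simp add: vr)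
  then have "fps_deriv v * r = - (v * fps_deriv r)"
    by (simp add: eq_neg_iff_add_eq_0 add.commute mult.commute)
  then have "fps_deriv v * r * v = - (v * fps_deriv r) * v" by simp
  moreover have "fps_deriv v * r * v = fps_deriv v"
    using vr by (metis mult.assoc mult.commute mult_1_right)
  ultimately show ?thesis by (simp add: mult_ac)
qed

lemma deriv_y: "fps_deriv y = v + fps_X * fps_deriv v"
  by simp

text \<open>The residue of \<open>dy / y^(d + 1)\<close>, because \<open>1 / y = r / w\<close>. For
  positive \<open>d\<close> this form is exact: \<open>r^d\<close> and \<open>w r^(d-1) r'\<close>
  agree at the coefficient \<open>d\<close>. For \<open>d = 0\<close> it is a logarithmic
  derivative.\<close>

lemma residue_monomial:
  "(r ^ Suc d * fps_deriv y) $ d = (if d = 0 then 1 else 0)"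
proof (cases d)
  case 0
  have "r $ 0 * v $ 0 = 1" using vr by (metis fps_mult_nth_0 fps_one_nth mult.commute)
  with 0 show ?thesis by (simp add: deriv_y)
next
  case (Suc e)
  have "r ^ Suc d * fps_deriv y = r ^ d * (v * r) - fps_X * (r ^ e * fps_deriv r * ((v * r) * (v * r)))"
    unfolding deriv_y deriv_v Suc by (simp add: algebra_simps)
  also have "\<dots> = r ^ d - fps_X * (r ^ e * fps_deriv r)"
    by (simp add: vr)
  finally have 1: "r ^ Suc d * fps_deriv y = r ^ d - fps_X * (r ^ e * fps_deriv r)" .
  have "fps_X * fps_deriv (r ^ d) = of_nat (Suc e) * (fps_X * (r ^ e * fps_deriv r))"
    unfolding Suc fps_deriv_power_Suc by (simp only: ac_simps)
  then have "of_nat d * r ^ d $ d = of_nat (Suc e) * (fps_X * (r ^ e * fps_deriv r)) $ d"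
    by (metis nth_X_deriv fps_mult_of_nat_nth(1))
  then have "(fps_X * (r ^ e * fps_deriv r)) $ d = r ^ d $ d"
    using of_nat_cancel Suc by metis
  then show ?thesis unfolding 1 using Suc by simp
qed

text \<open>Invariance of the residue under the change of variables \<open>y = w v(w)\<close>.\<close>

lemma residue_comp: "(fps_comp y g * (r ^ Suc n * fps_deriv y)) $ n = g $ n"
proof -
  have "(fps_comp y g * (r ^ Suc n * fps_deriv y)) $ n =
      ((\<Sum>m\<le>n. fps_const (g $ m) * y ^ m) * (r ^ Suc n * fps_deriv y)) $ n"
    by (intro fps_mult_nth_cong) (simp add: fps_subst_trunc[of _ _ n] fps_power_nth_eq_0)
  also have "\<dots> = (\<Sum>m\<le>n. g $ m * (y ^ m * (r ^ Suc n * fps_deriv y)) $ n)"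
    by (simp add: sum_distrib_right fps_sum_nth mult.assoc)
  also have "\<dots> = (\<Sum>m\<le>n. if m = n then g $ m else 0)"
  proof (intro sum.cong refl)
    fix m assume "m \<in> {..n}"
    then obtain d where d: "n = m + d" by (auto simp: le_iff_add)
    have "y ^ m * (r ^ Suc n * fps_deriv y) = fps_X ^ m * ((v ^ m * r ^ (m + Suc d)) * fps_deriv y)"
      unfolding d by (simp only: power_mult_distrib ac_simps add_Suc_right)
    then have "(y ^ m * (r ^ Suc n * fps_deriv y)) $ n = (r ^ Suc d * fps_deriv y) $ d"
      by (simp only: v_power_r_power) (simp add: fps_X_power_mult_nth d)
    then show "g $ m * (y ^ m * (r ^ Suc n * fps_deriv y)) $ n = (if m = n then g $ m else 0)"
      by (simp only: residue_monomial) (simp add: d)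
  qed
  finally show ?thesis by simp
qed

text \<open>The derivative H'(z) = h(y) - y h'(y) in the coordinate w. Differentiating H = 1/w along
  z = r/w gives \<open>1 / (r - w r')\<close>, which is \<open>P_inverse\<close>.\<close>

definition "P = fps_comp y (h - fps_X * fps_deriv h)"

lemma P_deriv_y: "P * fps_deriv y = v * v"
proof -
  have "fps_comp y (fps_deriv h) * fps_deriv y = fps_deriv v"
    using fps_comp_deriv[OF y_0, of h] by (simp add: comp_h)
  moreover have "P * fps_deriv y = v * fps_deriv y - y * (fps_comp y (fps_deriv h) * fps_deriv y)"
    unfolding P_def fps_subst_diff fps_comp_mult[OF y_0] comp_h fps_comp_X[OF y_0]
    by (simp only: left_diff_distrib mult.assoc)
  ultimately have "P * fps_deriv y = v * fps_deriv y - y * fps_deriv v" by (simp only:)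
  then show ?thesis by (simp add: deriv_y algebra_simps)
qed

lemma P_inverse: "P * (r - fps_X * fps_deriv r) = 1"
proof -
  have "fps_deriv y = v * (v * r) - fps_X * (v * v * fps_deriv r)"
    unfolding deriv_y deriv_v by (simp add: vr)
  then have "fps_deriv y = (v * v) * (r - fps_X * fps_deriv r)"
    by (simp only: algebra_simps)
  then have "P * (r - fps_X * fps_deriv r) * (v * v) = 1 * (v * v)"
    using P_deriv_y by (simp add: ac_simps)
  moreover have "v * v * (r * r) = 1"
    using vr by (metis (no_types, lifting) mult.assoc mult.commute mult_1_right)
  ultimately show ?thesis by (rule fps_unit_cancel[rotated])
qed

lemma r_nth: "of_nat (Suc k) * r $ (k + 2) = - (h ^ Suc k) $ (k + 2)"
proof -
  \<comment> \<open>Chosen for \<open>P_deriv_y\<close>: composition turns it into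
    \<open>v^k P\<close>, and together with the derivative of \<open>y\<close> the powers of
    \<open>v\<close> use up all but one of the \<open>k + 3\<close> factors
    \<open>r\<close>.\<close>
  let ?g = "h ^ k * (h - fps_X * fps_deriv h)"
  have "fps_comp y ?g * (r ^ Suc (k + 2) * fps_deriv y) = v ^ k * r ^ Suc (k + 2) * (P * fps_deriv y)"
    by (simp only: fps_comp_mult[OF y_0] fps_comp_power[OF y_0] comp_h P_def[symmetric] ac_simps)
  also have "\<dots> = v ^ (k + 2) * r ^ (k + 2 + 1)"
    unfolding P_deriv_y by (simp add: power2_eq_square)
  also have "\<dots> = r" by (simp only: v_power_r_power power_one_right)
  finally have "r $ (k + 2) = ?g $ (k + 2)"
    using residue_comp[of ?g "k + 2"] by simp
  moreover have "of_nat (Suc k) * ?g = of_nat (Suc k) * h ^ Suc k - fps_X * fps_deriv (h ^ Suc k)"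
    unfolding fps_deriv_power_Suc by (simp add: algebra_simps)
  then have "of_nat (Suc k) * ?g $ (k + 2) = of_nat (Suc k) * (h ^ Suc k) $ (k + 2) - (fps_X * fps_deriv (h ^ Suc k)) $ (k + 2)"
    by (metis fps_mult_of_nat_nth(1) fps_sub_nth)
  ultimately have "of_nat (Suc k) * r $ (k + 2) =
      of_nat (Suc k) * (h ^ Suc k) $ (k + 2) - of_nat (k + 2) * (h ^ Suc k) $ (k + 2)"
    by (simp only: nth_X_deriv)
  also have "\<dots> = (of_nat (Suc k) - of_nat (k + 2)) * (h ^ Suc k) $ (k + 2)"
    by (simp only: left_diff_distrib)
  finally show ?thesis by simp
qed

text \<open>One factor \<open>h - X h'\<close> is absorbed by \<open>P_deriv_y\<close> as in
  \<open>r_nth\<close>; the second one survives as \<open>P\<close>.\<close>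

lemma P_nth: "P $ Suc k = (h ^ k * (h - fps_X * fps_deriv h)\<^sup>2) $ Suc k"
proof -
  let ?g = "h ^ k * (h - fps_X * fps_deriv h)\<^sup>2"
  have "fps_comp y ?g * (r ^ Suc (Suc k) * fps_deriv y) = v ^ k * r ^ Suc (Suc k) * (P * fps_deriv y) * P"
    by (simp only: fps_comp_mult[OF y_0] fps_comp_power[OF y_0] comp_h P_def[symmetric] power2_eq_square ac_simps)
  also have "\<dots> = v ^ (k + 2) * r ^ (k + 2 + 0) * P"
    unfolding P_deriv_y by (simp add: power2_eq_square)
  also have "\<dots> = P" by (simp only: v_power_r_power) simp
  finally show ?thesis
    using residue_comp[of ?g "Suc k"] by simp
qed

end

text \<open>Integration by parts: \<open>X^2 h h''\<close> stands for H H'' and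
  \<open>h - X h'\<close> for H', and the derivative of H^(k+1) H' has no residue.\<close>

lemma residue_second_order:
  fixes h :: "'a::complex_algebra fps"
  shows "(h ^ k * (fps_X\<^sup>2 * h * fps_deriv (fps_deriv h) - (h - fps_X * fps_deriv h)\<^sup>2)) $ Suc k =
     - of_nat (k + 2) * (h ^ k * (h - fps_X * fps_deriv h)\<^sup>2) $ Suc k"
proof -
  define d where "d = h - fps_X * fps_deriv h"
  have dd: "fps_deriv d = - (fps_X * fps_deriv (fps_deriv h))"
    by (simp add: d_def)
  define g where "g = h ^ Suc k * d"
  have "fps_X * fps_deriv g = of_nat (Suc k) * (h ^ k * (fps_X * fps_deriv h) * d) -
      h ^ k * (fps_X\<^sup>2 * h * fps_deriv (fps_deriv h))"
    unfolding g_def fps_deriv_mult fps_deriv_power_Suc dd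
    by (simp add: algebra_simps power2_eq_square)
  also have "\<dots> = of_nat (Suc k) * g - of_nat (Suc k) * (h ^ k * d\<^sup>2) - h ^ k * (fps_X\<^sup>2 * h * fps_deriv (fps_deriv h))"
  proof -
    have "fps_X * fps_deriv h = h - d" by (simp add: d_def)
    then show ?thesis
      by (simp only: g_def) (simp add: algebra_simps power2_eq_square)
  qed
  finally have "fps_X * fps_deriv g = of_nat (Suc k) * g - of_nat (Suc k) * (h ^ k * d\<^sup>2) - h ^ k * (fps_X\<^sup>2 * h * fps_deriv (fps_deriv h))" .
  then have g: "(fps_X * fps_deriv g) $ Suc k = (of_nat (Suc k) * g) $ Suc k - (of_nat (Suc k) * (h ^ k * d\<^sup>2)) $ Suc k
     - (h ^ k * (fps_X\<^sup>2 * h * fps_deriv (fps_deriv h))) $ Suc k"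
    by (simp only: fps_sub_nth)
  have "(h ^ k * (fps_X\<^sup>2 * h * fps_deriv (fps_deriv h))) $ Suc k = - (of_nat (Suc k) * (h ^ k * d\<^sup>2) $ Suc k)"
  proof -
    have "D = - C" if "B = B - C - D" for B C D :: 'a
    proof -
      have "D = (B - C) - (B - C - D)" by simp
      also have "\<dots> = (B - C) - B" by (simp only: that[symmetric])
      also have "\<dots> = - C" by simp
      finally show ?thesis .
    qed
    then show ?thesis using g unfolding nth_X_deriv fps_mult_of_nat_nth .
  qed
  then have "(h ^ k * (fps_X\<^sup>2 * h * fps_deriv (fps_deriv h) - d\<^sup>2)) $ Suc k =
      - (of_nat (Suc k) * (h ^ k * d\<^sup>2) $ Suc k) - (h ^ k * d\<^sup>2) $ Suc k"
    by (simp only: right_diff_distrib fps_sub_nth)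
  also have "\<dots> = - of_nat (k + 2) * (h ^ k * d\<^sup>2) $ Suc k"
    by (simp add: algebra_simps)
  finally show ?thesis unfolding d_def .
qed

section \<open>Non-crossing partitions\<close>

lemma noncrossingD:
  assumes "noncrossing P" "X \<in> P" "Y \<in> P" "i \<in> X" "j \<in> Y" "k \<in> X" "l \<in> Y" "i < j" "j < k" "k < l"
  shows "X = Y"
proof (rule ccontr)
  assume "X \<noteq> Y"
  with assms(2-) have "\<exists>X\<in>P. \<exists>Y\<in>P. X \<noteq> Y \<and>
      (\<exists>a\<in>X. \<exists>b\<in>Y. \<exists>c\<in>X. \<exists>d\<in>Y. a < b \<and> b < c \<and> c < d)"
    by (intro bexI[of _ X] bexI[of _ Y] bexI[of _ i] bexI[of _ j] bexI[of _ k] bexI[of _ l] conjI)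
  with assms(1) show False by (simp only: noncrossing_def not_True_eq_False)
qed

lemma noncrossingI:
  assumes "\<And>X Y i j k l. X \<in> P \<Longrightarrow> Y \<in> P \<Longrightarrow> X \<noteq> Y \<Longrightarrow> i \<in> X \<Longrightarrow> j \<in> Y \<Longrightarrow> k \<in> X \<Longrightarrow> l \<in> Y \<Longrightarrow>
    i < j \<Longrightarrow> j < k \<Longrightarrow> k < l \<Longrightarrow> False"
  shows "noncrossing P"
  unfolding noncrossing_def by (intro notI, elim bexE conjE) (rule assms)

subsection \<open>The Kreweras complement\<close>

text \<open>
  \<open>i'\<close> and \<open>j'\<close> (\<open>i < j\<close>) lie in one block of the complement iff \<open>{i + 1..j}\<close> is a union of
  blocks; written symmetrically in \<open>i\<close> and \<open>j\<close>, this is visibly an equivalence relation.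
\<close>

definition krel :: "nat set set \<Rightarrow> nat \<Rightarrow> nat \<Rightarrow> bool" where
  "krel \<rho> i j \<longleftrightarrow> (\<forall>B\<in>\<rho>. \<forall>x\<in>B. \<forall>y\<in>B. ((x \<le> i) = (x \<le> j)) = ((y \<le> i) = (y \<le> j)))"

definition kclass :: "nat set set \<Rightarrow> nat set \<Rightarrow> nat \<Rightarrow> nat set" where
  "kclass \<rho> S i = {j \<in> S. krel \<rho> i j}"

definition kpart :: "nat set set \<Rightarrow> nat set \<Rightarrow> nat set set" where
  "kpart \<rho> S = kclass \<rho> S ` S"

lemma krel_refl [simp]: "krel \<rho> i i"
  by (simp add: krel_def)

lemma krel_sym: "krel \<rho> i j \<Longrightarrow> krel \<rho> j i"
  unfolding krel_def by metis

lemma krel_trans: "krel \<rho> i j \<Longrightarrow> krel \<rho> j k \<Longrightarrow> krel \<rho> i k"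
  unfolding krel_def by meson

lemma kclass_eq: "krel \<rho> i j \<Longrightarrow> kclass \<rho> S i = kclass \<rho> S j"
  unfolding kclass_def using krel_sym krel_trans by blast

lemma partition_onI':
  assumes "\<Union> P = A" "{} \<notin> P" "\<And>B C x. B \<in> P \<Longrightarrow> C \<in> P \<Longrightarrow> x \<in> B \<Longrightarrow> x \<in> C \<Longrightarrow> B = C"
  shows "partition_on A P"
  using assms by (auto simp: partition_on_def disjoint_def)

lemma partition_on_eq:
  assumes "partition_on A P" "B \<in> P" "C \<in> P" "x \<in> B" "x \<in> C" shows "B = C"
proof (rule ccontr)
  assume "B \<noteq> C"
  then have "B \<inter> C = {}" using assms(1-3) by (auto simp: partition_on_def disjoint_def)
  with assms show False by blast
qed

lemma kpart_memD:
  assumes "C \<in> kpart \<rho> S" "i \<in> C" shows "C = kclass \<rho> S i"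
proof -
  obtain j where j: "C = kclass \<rho> S j" using assms by (auto simp: kpart_def)
  with assms have "krel \<rho> j i" by (simp add: kclass_def)
  then show ?thesis unfolding j by (rule kclass_eq)
qed

lemma partition_on_kpart: "partition_on S (kpart \<rho> S)"
proof (rule partition_onI')
  show "B = C" if "B \<in> kpart \<rho> S" "C \<in> kpart \<rho> S" "x \<in> B" "x \<in> C" for B C x
    using kpart_memD that by metis
qed (auto simp: kpart_def kclass_def)

lemma noncrossing_kpart: "noncrossing (kpart \<rho> S)"
proof (rule noncrossingI)
  fix X Y i j k l
  assume XY: "X \<in> kpart \<rho> S" "Y \<in> kpart \<rho> S" "X \<noteq> Y" and el: "i \<in> X" "j \<in> Y" "k \<in> X" "l \<in> Y"
    and lt: "i < j" "j < k" "k < l"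
  have X: "X = kclass \<rho> S i" "X = kclass \<rho> S k" and Y: "Y = kclass \<rho> S j"
    using XY el kpart_memD by blast+
  have ik: "krel \<rho> i k" and jl: "krel \<rho> j l"
    using el X Y by (auto simp: kclass_def)
  have "krel \<rho> j k"
    unfolding krel_def
  proof (intro ballI)
    fix B x y assume B: "B \<in> \<rho>" "x \<in> B" "y \<in> B"
    have 1: "((x \<le> i) = (x \<le> k)) = ((y \<le> i) = (y \<le> k))" "((x \<le> j) = (x \<le> l)) = ((y \<le> j) = (y \<le> l))"
      using ik jl B unfolding krel_def by blast+
    \<comment> \<open>The half-open intervals from i to k and from j to l are unions of blocks,
      hence so is their intersection, the interval from j to k.\<close>
    have "((z \<le> j) = (z \<le> k)) \<longleftrightarrow> ((z \<le> i) = (z \<le> k)) \<or> ((z \<le> j) = (z \<le> l))" for z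
      using lt by (cases "z \<le> i"; cases "z \<le> j"; cases "z \<le> k"; cases "z \<le> l") auto
    then show "((x \<le> j) = (x \<le> k)) = ((y \<le> j) = (y \<le> k))"
      using 1 by blast
  qed
  then have "X = Y" using kclass_eq X Y by metis
  with XY show False by simp
qed

lemma kreweras_admissible_kpart:
  assumes "noncrossing \<rho>" shows "kreweras_admissible \<rho> (kpart \<rho> S)"
  unfolding kreweras_admissible_def
proof (rule noncrossingI)
  let ?E = "(\<lambda>b. (\<lambda>i. 2 * i) ` b) ` \<rho>" and ?O = "(\<lambda>b. (\<lambda>i. 2 * i + 1) ` b) ` kpart \<rho> S"
  fix X Y :: "nat set" and i j k l :: nat
  assume XY: "X \<in> ?E \<union> ?O" "Y \<in> ?E \<union> ?O" "X \<noteq> Y" and el: "i \<in> X" "j \<in> Y" "k \<in> X" "l \<in> Y"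
    and lt: "i < j" "j < k" "k < l"
  from XY(1,2) consider
    (EE) B C where "B \<in> \<rho>" "C \<in> \<rho>" "X = (\<lambda>i. 2 * i) ` B" "Y = (\<lambda>i. 2 * i) ` C"
  | (EO) B C where "B \<in> \<rho>" "C \<in> kpart \<rho> S" "X = (\<lambda>i. 2 * i) ` B" "Y = (\<lambda>i. 2 * i + 1) ` C"
  | (OE) B C where "B \<in> kpart \<rho> S" "C \<in> \<rho>" "X = (\<lambda>i. 2 * i + 1) ` B" "Y = (\<lambda>i. 2 * i) ` C"
  | (OO) B C where "B \<in> kpart \<rho> S" "C \<in> kpart \<rho> S" "X = (\<lambda>i. 2 * i + 1) ` B" "Y = (\<lambda>i. 2 * i + 1) ` C"
    by blast
  then show False
  proof cases
    case EE
    obtain i' j' k' l' where "i = 2 * i'" "j = 2 * j'" "k = 2 * k'" "l = 2 * l'" "i' \<in> B" "j' \<in> C" "k' \<in> B" "l' \<in> C"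
      using el EE by auto
    moreover from this lt have "i' < j'" "j' < k'" "k' < l'" by auto
    ultimately have "B = C" using noncrossingD[OF assms EE(1,2)] by blast
    with EE XY show False by simp
  next
    case OO
    obtain i' j' k' l' where "i = 2 * i' + 1" "j = 2 * j' + 1" "k = 2 * k' + 1" "l = 2 * l' + 1" "i' \<in> B" "j' \<in> C" "k' \<in> B" "l' \<in> C"
      using el OO by auto
    moreover from this lt have "i' < j'" "j' < k'" "k' < l'" by auto
    ultimately have "B = C" using noncrossingD[OF noncrossing_kpart OO(1,2)] by blast
    with OO XY show False by simp
  next
    \<comment> \<open>The interval \<open>{j' + 1..l'}\<close> is a union of blocks, yet it contains
      \<open>k'\<close> and misses \<open>i'\<close> from the same block. The case \<open>OE\<close>
      is its mirror image.\<close>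
    case EO
    obtain i' j' k' l' where e: "i = 2 * i'" "j = 2 * j' + 1" "k = 2 * k'" "l = 2 * l' + 1" "i' \<in> B" "j' \<in> C" "k' \<in> B" "l' \<in> C"
      using el EO by auto
    then have "krel \<rho> j' l'" using kpart_memD[OF EO(2)] by (auto simp: kclass_def)
    then have "((i' \<le> j') = (i' \<le> l')) = ((k' \<le> j') = (k' \<le> l'))"
      using e EO(1) unfolding krel_def by blast
    moreover have "i' \<le> j'" "j' < k'" "k' \<le> l'" using e lt by auto
    ultimately show False by auto
  next
    case OE
    obtain i' j' k' l' where e: "i = 2 * i' + 1" "j = 2 * j'" "k = 2 * k' + 1" "l = 2 * l'" "i' \<in> B" "j' \<in> C" "k' \<in> B" "l' \<in> C"
      using el OE by auto
    then have "krel \<rho> i' k'" using kpart_memD[OF OE(1)] by (auto simp: kclass_def)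
    then have "((j' \<le> i') = (j' \<le> k')) = ((l' \<le> i') = (l' \<le> k'))"
      using e OE(2) unfolding krel_def by blast
    moreover have "i' < j'" "j' \<le> k'" "k' < l'" using e lt by auto
    ultimately show False by auto
  qed
qed

text \<open>A block with points both inside and outside \<open>{i + 1..j}\<close> would cross the
  block through the primed points of \<open>i\<close> and \<open>j\<close>. This makes
  \<open>kpart\<close> the coarsest admissible partition.\<close>

lemma krel_if_admissible:
  assumes adm: "kreweras_admissible \<rho> \<tau>" and T: "T \<in> \<tau>" "i \<in> T" "j \<in> T" and ij: "i < j"
  shows "krel \<rho> i j"
  unfolding krel_def
proof (intro ballI)
  let ?P = "(\<lambda>b. (\<lambda>i. 2 * i) ` b) ` \<rho> \<union> (\<lambda>b. (\<lambda>i. 2 * i + 1) ` b) ` \<tau>"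
  have nc: "noncrossing ?P" using adm by (simp add: kreweras_admissible_def)
  have main: "y > i \<and> y \<le> j" if B: "B \<in> \<rho>" "x \<in> B" "y \<in> B" and x: "i < x" "x \<le> j" for B x y
  proof (rule ccontr)
    let ?X = "(\<lambda>i. 2 * i) ` B" and ?Y = "(\<lambda>i. 2 * i + 1) ` T"
    assume "\<not> (y > i \<and> y \<le> j)"
    then consider "y \<le> i" | "j < y" by linarith
    then have "?X = ?Y"
    proof cases
      case 1
      show ?thesis
        by (rule noncrossingD[OF nc, of _ _ "2 * y" "2 * i + 1" "2 * x" "2 * j + 1"]) (use 1 B T x ij in auto)
    next
      case 2
      show ?thesis
        by (rule noncrossingD[OF nc, of _ _ "2 * i + 1" "2 * x" "2 * j + 1" "2 * y", symmetric]) (use 2 B T x ij in auto)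
    qed
    then have "2 * x \<in> ?Y" using B by auto
    then show False by (auto simp: image_iff) presburger
  qed
  fix B x y assume B: "B \<in> \<rho>" "x \<in> B" "y \<in> B"
  have "((z \<le> i) = (z \<le> j)) \<longleftrightarrow> \<not> (i < z \<and> z \<le> j)" for z
    using ij by auto
  then show "((x \<le> i) = (x \<le> j)) = ((y \<le> i) = (y \<le> j))"
    using main[OF B] main[OF B(1,3,2)] by blast
qed

theorem kreweras_eq_kpart:
  assumes \<rho>: "\<rho> \<in> NC n"
  shows "kreweras n \<rho> = kpart \<rho> {1..n}"
  unfolding kreweras_def
proof (rule the_equality)
  let ?K = "kpart \<rho> {1..n}"
  have nc: "?K \<in> NC n" by (simp add: NC_def partition_on_kpart noncrossing_kpart)
  have ad: "kreweras_admissible \<rho> ?K"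
    using \<rho> by (intro kreweras_admissible_kpart) (simp add: NC_def)
  have max: "refines {1..n} \<tau> ?K" if \<tau>: "\<tau> \<in> NC n" "kreweras_admissible \<rho> \<tau>" for \<tau>
    unfolding refines_def
  proof (intro conjI ballI)
    show p: "partition_on {1..n} \<tau>" "partition_on {1..n} ?K"
      using \<tau> by (simp_all add: NC_def partition_on_kpart)
    fix X assume X: "X \<in> \<tau>"
    then have "X \<noteq> {}" using p(1) by (auto simp: partition_on_def)
    then obtain i where i: "i \<in> X" by blast
    have "krel \<rho> i j" if "j \<in> X" for j
      using krel_if_admissible[OF \<tau>(2) X] i that krel_sym by (cases i j rule: linorder_cases) auto
    moreover have "X \<subseteq> {1..n}" using X p(1) by (auto simp: partition_on_def)
    ultimately have "X \<subseteq> kclass \<rho> {1..n} i" "i \<in> {1..n}"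
      using i by (auto simp: kclass_def)
    then show "\<exists>Y\<in>?K. X \<subseteq> Y" by (auto simp: kpart_def)
  qed
  show "?K \<in> NC n \<and> kreweras_admissible \<rho> ?K \<and> (\<forall>\<tau>\<in>NC n. kreweras_admissible \<rho> \<tau> \<longrightarrow> refines {1..n} \<tau> ?K)"
    using nc ad max by blast
  fix \<sigma> assume "\<sigma> \<in> NC n \<and> kreweras_admissible \<rho> \<sigma> \<and> (\<forall>\<tau>\<in>NC n. kreweras_admissible \<rho> \<tau> \<longrightarrow> refines {1..n} \<tau> \<sigma>)"
  then show "\<sigma> = ?K"
    using nc ad max refines_asym by blast
qed

subsection \<open>First-block decomposition\<close>

text \<open>Serves two purposes: putting a first point in front of the block of its successor, and
  putting a new primed point into a class of the complement.\<close>

definition add_elem :: "nat \<Rightarrow> nat \<Rightarrow> nat set set \<Rightarrow> nat set set" where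
  "add_elem a e P = (\<lambda>B. if e \<in> B then insert a B else B) ` P"

lemma partition_on_add_elem:
  assumes P: "partition_on S P" and e: "e \<in> S" and a: "a \<notin> S"
  shows "partition_on (insert a S) (add_elem a e P)"
proof (rule partition_onI')
  have U: "\<Union> P = S" using P by (simp add: partition_on_def)
  show "\<Union> (add_elem a e P) = insert a S"
    using e unfolding U[symmetric] add_elem_def by auto
  show "{} \<notin> add_elem a e P"
    using P by (auto simp: add_elem_def partition_on_def)
  show "p = p'" if pp: "p \<in> add_elem a e P" "p' \<in> add_elem a e P" "x \<in> p" "x \<in> p'" for p p' x
  proof -
    obtain B B' where B: "B \<in> P" "B' \<in> P" "p = (if e \<in> B then insert a B else B)" "p' = (if e \<in> B' then insert a B' else B')"
      using pp unfolding add_elem_def by blast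
    have "a \<notin> B" "a \<notin> B'" using B a U by auto
    then obtain y where "y \<in> B" "y \<in> B'"
      using B(3,4) pp(3,4) by (cases "x = a") (auto split: if_splits)
    then have "B = B'" using P B(1,2) by (auto simp: partition_on_def disjoint_def)
    then show ?thesis using B by simp
  qed
qed

lemma prod_add_elem:
  assumes "\<And>B. B \<in> P \<Longrightarrow> a \<notin> B"
  shows "(\<Prod>B\<in>add_elem a e P. g B) = (\<Prod>B\<in>P. g (if e \<in> B then insert a B else B))"
proof -
  have "inj_on (\<lambda>B. if e \<in> B then insert a B else B) P"
    by (rule inj_on_inverseI[where g = "\<lambda>B. B - {a}"]) (use assms in auto)
  then show ?thesis unfolding add_elem_def by (simp add: prod.reindex del: if_image_distrib)
qed

definition nc_on :: "nat set \<Rightarrow> nat set set set" where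
  "nc_on A = {P. partition_on A P \<and> noncrossing P}"

lemma finite_nc_on: "finite A \<Longrightarrow> finite (nc_on A)"
  by (rule finite_subset[of _ "Pow (Pow A)"]) (auto simp: nc_on_def partition_on_def)

lemma nc_onD:
  assumes "P \<in> nc_on A"
  shows "\<Union> P = A" "{} \<notin> P" "noncrossing P" "\<And>B C x. B \<in> P \<Longrightarrow> C \<in> P \<Longrightarrow> x \<in> B \<Longrightarrow> x \<in> C \<Longrightarrow> B = C"
  using assms by (auto simp: nc_on_def partition_on_def disjoint_def)

lemma nc_onI:
  assumes "\<Union> P = A" "{} \<notin> P" "noncrossing P" "\<And>B C x. B \<in> P \<Longrightarrow> C \<in> P \<Longrightarrow> x \<in> B \<Longrightarrow> x \<in> C \<Longrightarrow> B = C"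
  shows "P \<in> nc_on A"
  using assms by (auto simp: nc_on_def partition_on_def disjoint_def)

definition next_in :: "nat \<Rightarrow> nat \<Rightarrow> nat set set \<Rightarrow> bool" where
  "next_in a j P \<longleftrightarrow> (\<exists>B\<in>P. a \<in> B \<and> j \<in> B \<and> (\<forall>k\<in>B. a < k \<longrightarrow> j \<le> k))"

lemma nc_on_insert_singleton:
  assumes "P \<in> nc_on A" "a \<notin> A"
  shows "insert {a} P \<in> nc_on (insert a A)"
proof (rule nc_onI)
  show "noncrossing (insert {a} P)"
  proof (rule noncrossingI)
    fix X Y i j k l
    assume XY: "X \<in> insert {a} P" "Y \<in> insert {a} P" "X \<noteq> Y" and el: "i \<in> X" "j \<in> Y" "k \<in> X" "l \<in> Y"
      and lt: "i < j" "j < k" "k < l"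
    then have "X \<in> P" "Y \<in> P" by auto
    then show False using noncrossingD[OF nc_onD(3)[OF assms(1)]] XY(3) el lt by blast
  qed
qed (use nc_onD[OF assms(1)] assms(2) in auto)

lemma nc_on_remove_singleton:
  assumes "P \<in> nc_on (insert a A)" "a \<notin> A" "{a} \<in> P"
  shows "P - {{a}} \<in> nc_on A"
proof (rule nc_onI)
  note D = nc_onD[OF assms(1)]
  show "noncrossing (P - {{a}})"
    by (rule noncrossingI) (use noncrossingD[OF D(3)] in blast)
  show "\<Union> (P - {{a}}) = A"
  proof
    show "\<Union> (P - {{a}}) \<subseteq> A"
    proof
      fix x assume "x \<in> \<Union> (P - {{a}})"
      then obtain X where X: "X \<in> P" "X \<noteq> {a}" "x \<in> X" by blast
      then have "x \<noteq> a" using D(4)[OF _ assms(3)] by blast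
      then show "x \<in> A" using X D(1) by blast
    qed
    show "A \<subseteq> \<Union> (P - {{a}})"
    proof
      fix x assume x: "x \<in> A"
      then obtain X where "X \<in> P" "x \<in> X" using D(1) by blast
      moreover have "x \<noteq> a" using x assms(2) by blast
      ultimately show "x \<in> \<Union> (P - {{a}})" by blast
    qed
  qed
qed (use nc_onD[OF assms(1)] in auto)

context
  fixes a j b :: nat
  assumes aj: "a < j" and jb: "j \<le> b"
begin

text \<open>With \<open>j\<close> the successor of \<open>a\<close> in its block, the points
  strictly between them carry a partition of their own, and in the partition of the points from
  \<open>j\<close> on, \<open>j\<close> represents the block of \<open>a\<close>.\<close>

lemma nc_on_join:
  assumes P: "P \<in> nc_on {Suc a..j - 1}" and Q: "Q \<in> nc_on {j..b}"
  shows "P \<union> add_elem a j Q \<in> nc_on {a..b}" "next_in a j (P \<union> add_elem a j Q)"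
proof -
  note DP = nc_onD[OF P] and DQ = nc_onD[OF Q]
  have Pm: "a < x \<and> x < j" if "B \<in> P" "x \<in> B" for B x
  proof -
    have "x \<in> {Suc a..j - 1}" using that DP(1) by blast
    then show ?thesis using aj by auto
  qed
  have Qm: "j \<le> x \<and> x \<le> b" if "B \<in> Q" "x \<in> B" for B x
  proof -
    have "x \<in> {j..b}" using that DQ(1) by blast
    then show ?thesis by auto
  qed
  have Am: "(x = a \<and> j \<in> C) \<or> (j \<le> x \<and> x \<le> b \<and> x \<in> C)" if "C \<in> Q" "x \<in> (if j \<in> C then insert a C else C)" for x C
    using Qm that by (auto split: if_splits)
  have part: "partition_on {a..b} (P \<union> add_elem a j Q)"
  proof -
    have "partition_on (insert a {j..b}) (add_elem a j Q)"
      using Q aj jb by (intro partition_on_add_elem) (auto simp: nc_on_def)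
    note dis = partition_on_eq[OF this]
    have U: "\<Union> (add_elem a j Q) = insert a {j..b}" "{} \<notin> add_elem a j Q"
      using \<open>partition_on (insert a {j..b}) (add_elem a j Q)\<close> by (simp_all add: partition_on_def)
    have mixed: False if "B \<in> P" "C \<in> add_elem a j Q" "x \<in> B" "x \<in> C" for B C x
    proof -
      have "x \<in> insert a {j..b}" using U(1) that by blast
      then show False using Pm[OF that(1,3)] by auto
    qed
    show ?thesis
    proof (rule partition_onI')
      have "{Suc a..j - 1} \<union> insert a {j..b} = {a..b}" using aj jb by auto
      then show "\<Union> (P \<union> add_elem a j Q) = {a..b}"
        by (simp only: Union_Un_distrib U(1) DP(1))
      show "{} \<notin> P \<union> add_elem a j Q" using U(2) DP(2) by blast
      show "B = C" if "B \<in> P \<union> add_elem a j Q" "C \<in> P \<union> add_elem a j Q" "x \<in> B" "x \<in> C" for B C x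
        using that DP(4) dis mixed by blast
    qed
  qed
  have "noncrossing (P \<union> add_elem a j Q)"
  proof (rule noncrossingI)
    fix X Y i m k l
    assume XY: "X \<in> P \<union> add_elem a j Q" "Y \<in> P \<union> add_elem a j Q" "X \<noteq> Y" and el: "i \<in> X" "m \<in> Y" "k \<in> X" "l \<in> Y"
      and lt: "i < m" "m < k" "k < l"
    from XY(1,2) consider "X \<in> P" "Y \<in> P"
      | C where "X \<in> P" "C \<in> Q" "Y = (if j \<in> C then insert a C else C)"
      | C where "Y \<in> P" "C \<in> Q" "X = (if j \<in> C then insert a C else C)"
      | C D where "C \<in> Q" "X = (if j \<in> C then insert a C else C)" "D \<in> Q" "Y = (if j \<in> D then insert a D else D)"
      unfolding add_elem_def by blast
    then show False
    proof cases
      case 1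
      then show False using noncrossingD[OF DP(3)] XY(3) el lt by blast
    next
      case 2
      then have "a < i" "k < j" using Pm el by blast+
      moreover have "m = a \<or> j \<le> m" using Am[OF 2(2)] el 2(3) by blast
      ultimately show False using lt by auto
    next
      case 3
      then have "a < m" "l < j" using Pm el by blast+
      moreover have "k = a \<or> j \<le> k" using Am[OF 3(2)] el 3(3) by blast
      ultimately show False using lt by auto
    next
      case 4
      have CD: "C \<noteq> D" using XY 4 by auto
      have i: "(i = a \<and> j \<in> C) \<or> (j \<le> i \<and> i \<in> C)" using Am[OF 4(1)] el 4(2) by blast
      have k: "(k = a \<and> j \<in> C) \<or> (j \<le> k \<and> k \<in> C)" using Am[OF 4(1)] el 4(2) by blast
      have m: "(m = a \<and> j \<in> D) \<or> (j \<le> m \<and> m \<in> D)" using Am[OF 4(3)] el 4(4) by blast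
      have l: "(l = a \<and> j \<in> D) \<or> (j \<le> l \<and> l \<in> D)" using Am[OF 4(3)] el 4(4) by blast
      have "a \<le> i" using i aj by auto
      then have k': "k \<in> C" and m': "m \<in> D" "j \<le> m" and l': "l \<in> D" using k m l lt by auto
      \<comment> \<open>Inside its block \<open>a\<close> can be replaced by \<open>j\<close>, so a
        crossing that starts at \<open>a\<close> yields one within \<open>Q\<close>.\<close>
      define i' where "i' = (if i = a then j else i)"
      have i': "i' \<in> C" using i aj by (auto simp: i'_def)
      moreover have "i' < m"
      proof (cases "i = a")
        case True
        then have "j \<noteq> m" using DQ(4)[OF 4(1,3), of j] CD m' i' by (auto simp: i'_def)
        with m' True show ?thesis by (simp add: i'_def)
      qed (use lt in \<open>simp add: i'_def\<close>)
      ultimately show False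
        using noncrossingD[OF DQ(3) 4(1,3), of i' m k l] k' m' l' lt CD by blast
    qed
  qed
  with part show "P \<union> add_elem a j Q \<in> nc_on {a..b}" by (simp add: nc_on_def)
  have "j \<in> \<Union> Q" using DQ(1) jb by auto
  then obtain C where C: "C \<in> Q" "j \<in> C" by blast
  then have "insert a C \<in> add_elem a j Q" by (force simp: add_elem_def)
  moreover have "\<forall>k\<in>insert a C. a < k \<longrightarrow> j \<le> k" using Qm[OF C(1)] by auto
  ultimately show "next_in a j (P \<union> add_elem a j Q)"
    unfolding next_in_def using C by blast
qed

lemma nc_on_join_inverse:
  assumes P: "P \<in> nc_on {Suc a..j - 1}" and Q: "Q \<in> nc_on {j..b}"
  defines "R \<equiv> P \<union> add_elem a j Q"
  shows "{B \<in> R. B \<subseteq> {Suc a..j - 1}} = P" "(\<lambda>B. B - {a}) ` {B \<in> R. \<not> B \<subseteq> {Suc a..j - 1}} = Q"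
proof -
  note DP = nc_onD[OF P] and DQ = nc_onD[OF Q]
  have Pm: "B \<subseteq> {Suc a..j - 1}" if "B \<in> P" for B using that DP(1) by blast
  have Qm: "C \<subseteq> {j..b}" "C \<noteq> {}" if "C \<in> Q" for C using that DQ(1,2) by blast+
  have A: "\<not> (if j \<in> C then insert a C else C) \<subseteq> {Suc a..j - 1}" if C: "C \<in> Q" for C
  proof
    assume *: "(if j \<in> C then insert a C else C) \<subseteq> {Suc a..j - 1}"
    obtain x where x: "x \<in> C" using Qm(2)[OF C] by blast
    then have "x \<in> {Suc a..j - 1}" "x \<in> {j..b}" using * Qm(1)[OF C] by (auto split: if_splits)
    then show False by auto
  qed
  have R: "{B \<in> R. \<not> B \<subseteq> {Suc a..j - 1}} = add_elem a j Q"
    unfolding R_def add_elem_def using Pm A by blast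
  show "{B \<in> R. B \<subseteq> {Suc a..j - 1}} = P"
    unfolding R_def add_elem_def using Pm A by blast
  have "(if j \<in> C then insert a C else C) - {a} = C" if "C \<in> Q" for C
    using Qm[OF that] aj by auto
  then have "(\<lambda>C. (if j \<in> C then insert a C else C) - {a}) ` Q = (\<lambda>C. C) ` Q"
    by (intro image_cong refl)
  then show "(\<lambda>B. B - {a}) ` {B \<in> R. \<not> B \<subseteq> {Suc a..j - 1}} = Q"
    unfolding R add_elem_def image_image by simp
qed

lemma nc_on_split:
  assumes R: "R \<in> nc_on {a..b}" and next_in: "next_in a j R"
  defines "P \<equiv> {B \<in> R. B \<subseteq> {Suc a..j - 1}}" and "Q \<equiv> (\<lambda>B. B - {a}) ` {B \<in> R. \<not> B \<subseteq> {Suc a..j - 1}}"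
  shows "P \<in> nc_on {Suc a..j - 1}" "Q \<in> nc_on {j..b}" "P \<union> add_elem a j Q = R"
proof -
  note D = nc_onD[OF R]
  obtain B0 where B0: "B0 \<in> R" "a \<in> B0" "j \<in> B0" "\<And>k. k \<in> B0 \<Longrightarrow> a < k \<Longrightarrow> j \<le> k"
    using next_in by (auto simp: next_in_def)
  have Rm: "B \<subseteq> {a..b}" if "B \<in> R" for B using that D(1) by blast
  \<comment> \<open>\<open>B0\<close> holds both \<open>a\<close> and \<open>j\<close>, so another
    block with points on both sides of \<open>j\<close> would cross it.\<close>
  have cases: "B \<subseteq> {Suc a..j - 1} \<or> B \<subseteq> {Suc j..b}" if B: "B \<in> R" "B \<noteq> B0" for B
  proof (rule ccontr)
    assume n: "\<not> ?thesis"
    have na: "a \<notin> B" "j \<notin> B" using D(4) B B0 by blast+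
    have B1: "a < x \<and> x \<le> b \<and> x \<noteq> j" if "x \<in> B" for x
    proof -
      have "x \<in> {a..b}" using that Rm B by blast
      then show ?thesis using na that by (cases "x = a") auto
    qed
    from n obtain x y where "x \<in> B" "\<not> x < j" "y \<in> B" "\<not> j < y"
      using B1 by (auto simp: subset_iff) (metis Suc_leI Suc_pred' aj le_simps(3) less_Suc_eq_le not_less_eq not_less_zero zero_less_iff_neq_zero)+
    moreover from this B1 have "j < x" "y < j" "a < y" by (metis linorder_neqE_nat)+
    ultimately have "B0 = B" using noncrossingD[OF D(3) B0(1) B(1) B0(2) _ B0(3)] by blast
    with B show False by simp
  qed
  have B0n: "\<not> B0 \<subseteq> {Suc a..j - 1}" using B0 by auto
  have Qe: "B - {a} \<subseteq> {j..b}" if "B \<in> R" "\<not> B \<subseteq> {Suc a..j - 1}" for B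
  proof (cases "B = B0")
    case True
    show ?thesis
    proof
      fix k assume k: "k \<in> B - {a}"
      then have "k \<in> {a..b}" using Rm[OF that(1)] by blast
      with k B0(4)[of k] True show "k \<in> {j..b}" by auto
    qed
  next
    case False
    then show ?thesis using cases[OF that(1)] that by auto
  qed
  show "P \<in> nc_on {Suc a..j - 1}"
  proof (rule nc_onI)
    show "\<Union> P = {Suc a..j - 1}"
    proof
      show "{Suc a..j - 1} \<subseteq> \<Union> P"
      proof
        fix x assume x: "x \<in> {Suc a..j - 1}"
        then have "x \<in> \<Union> R" using D(1) jb by auto
        then obtain B where B: "B \<in> R" "x \<in> B" by blast
        have "B \<noteq> B0" using B0(4)[of x] x B aj by auto
        then have "B \<subseteq> {Suc a..j - 1}" using cases[OF B(1)] x B aj by force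
        with B show "x \<in> \<Union> P" by (auto simp: P_def)
      qed
    qed (auto simp: P_def)
    show "noncrossing P"
      by (rule noncrossingI) (use noncrossingD[OF D(3)] in \<open>auto simp: P_def\<close>)
  qed (use D in \<open>auto simp: P_def\<close>)
  have Qne: "B - {a} \<noteq> {}" if "B \<in> R" "\<not> B \<subseteq> {Suc a..j - 1}" for B
  proof (cases "B = B0")
    case True
    then show ?thesis using B0 aj by auto
  next
    case False
    then have "a \<notin> B" using D(4) B0 that by blast
    with that D(2) show ?thesis by auto
  qed
  show "Q \<in> nc_on {j..b}"
  proof (rule nc_onI)
    show "\<Union> Q = {j..b}"
    proof
      show "{j..b} \<subseteq> \<Union> Q"
      proof
        fix x assume x: "x \<in> {j..b}"
        then have "x \<in> \<Union> R" using D(1) aj by auto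
        then obtain B where B: "B \<in> R" "x \<in> B" by blast
        have "\<not> B \<subseteq> {Suc a..j - 1}" using B x aj by auto
        moreover have "x \<in> B - {a}" using B x aj by auto
        ultimately show "x \<in> \<Union> Q" using B by (auto simp: Q_def)
      qed
      show "\<Union> Q \<subseteq> {j..b}" using Qe by (auto simp: Q_def)
    qed
    show "{} \<notin> Q" using Qne by (auto simp: Q_def)
    show "B = C" if BC: "B \<in> Q" "C \<in> Q" "x \<in> B" "x \<in> C" for B C x
    proof -
      obtain B' C' where "B' \<in> R" "C' \<in> R" "B = B' - {a}" "C = C' - {a}" using BC by (auto simp: Q_def)
      with D(4)[of B' C' x] BC show ?thesis by auto
    qed
    show "noncrossing Q"
    proof (rule noncrossingI)
      fix X Y i m k l
      assume XY: "X \<in> Q" "Y \<in> Q" "X \<noteq> Y" and el: "i \<in> X" "m \<in> Y" "k \<in> X" "l \<in> Y"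
        and lt: "i < m" "m < k" "k < l"
      obtain B' C' where BC: "B' \<in> R" "C' \<in> R" "X = B' - {a}" "Y = C' - {a}" using XY by (auto simp: Q_def)
      then have "B' = C'" using noncrossingD[OF D(3) BC(1,2), of i m k l] el lt by auto
      with BC XY show False by simp
    qed
  qed
  have "(if j \<in> B - {a} then insert a (B - {a}) else B - {a}) = B" if "B \<in> R" "\<not> B \<subseteq> {Suc a..j - 1}" for B
  proof (cases "B = B0")
    case True
    then show ?thesis using B0 aj by auto
  next
    case False
    then have "a \<notin> B" "j \<notin> B" using D(4) B0 that by blast+
    then show ?thesis by auto
  qed
  then have "(\<lambda>B. if j \<in> B - {a} then insert a (B - {a}) else B - {a}) ` {B \<in> R. \<not> B \<subseteq> {Suc a..j - 1}} =
      (\<lambda>B. B) ` {B \<in> R. \<not> B \<subseteq> {Suc a..j - 1}}"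
    by (intro image_cong refl) blast
  then have "add_elem a j Q = {B \<in> R. \<not> B \<subseteq> {Suc a..j - 1}}"
    unfolding add_elem_def Q_def image_image by (simp only: image_ident)
  then show "P \<union> add_elem a j Q = R" by (auto simp: P_def)
qed

end

text \<open>The first sum collects the partitions in which \<open>a\<close> is alone; the second
  sorts the others by the successor \<open>j\<close> of \<open>a\<close> in its block.\<close>

lemma sum_nc_on:
  fixes f :: "nat set set \<Rightarrow> 'a::comm_monoid_add"
  assumes ab: "a \<le> b"
  shows "(\<Sum>R\<in>nc_on {a..b}. f R) = (\<Sum>P\<in>nc_on {Suc a..b}. f (insert {a} P)) +
    (\<Sum>j=Suc a..b. \<Sum>P\<in>nc_on {Suc a..j - 1}. \<Sum>Q\<in>nc_on {j..b}. f (P \<union> add_elem a j Q))"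
proof -
  let ?N = "nc_on {a..b}"
  have fin: "finite ?N" by (simp add: finite_nc_on)
  have ins: "insert a {Suc a..b} = {a..b}" using ab by auto
  have cov: "?N = {R \<in> ?N. {a} \<in> R} \<union> (\<Union>j\<in>{Suc a..b}. {R \<in> ?N. next_in a j R})"
  proof (intro equalityI subsetI)
    fix R assume R: "R \<in> ?N"
    note D = nc_onD[OF R]
    obtain B where B: "B \<in> R" "a \<in> B" using D(1) ab by (metis Union_iff atLeastAtMost_iff order_refl)
    show "R \<in> {R \<in> ?N. {a} \<in> R} \<union> (\<Union>j\<in>{Suc a..b}. {R \<in> ?N. next_in a j R})"
    proof (cases "B = {a}")
      case True
      then show ?thesis using B R by auto
    next
      case False
      have Bm: "B \<subseteq> {a..b}" using B D(1) by auto
      define j where "j = (LEAST k. k \<in> B \<and> a < k)"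
      obtain k where "k \<in> B" "k \<noteq> a" using False B by blast
      with Bm have ex: "k \<in> B \<and> a < k" by fastforce
      have j: "j \<in> B \<and> a < j" unfolding j_def using ex by (rule LeastI)
      have "j \<le> k" if "k \<in> B" "a < k" for k unfolding j_def using that by (simp add: Least_le)
      with j B have "next_in a j R" by (auto simp: next_in_def)
      moreover have "j \<in> {Suc a..b}" using j Bm by auto
      ultimately show ?thesis using R by auto
    qed
  qed auto
  have uniq: "j = j'" if "R \<in> ?N" "next_in a j R" "next_in a j' R" "a < j" "a < j'" for R j j'
    using that nc_onD(4)[OF that(1)] unfolding next_in_def by (metis order_antisym)
  have disj: "\<not> next_in a j R" if "R \<in> ?N" "{a} \<in> R" "a < j" for R j
    using that nc_onD(4)[OF that(1)] unfolding next_in_def by (metis nat_neq_iff singletonD singletonI)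
  have "(\<Sum>R\<in>?N. f R) = (\<Sum>R | R \<in> ?N \<and> {a} \<in> R. f R) + (\<Sum>R\<in>(\<Union>j\<in>{Suc a..b}. {R \<in> ?N. next_in a j R}). f R)"
    using fin disj by (subst cov, subst sum.union_disjoint) (auto simp: Suc_le_eq)
  also have "(\<Sum>R\<in>(\<Union>j\<in>{Suc a..b}. {R \<in> ?N. next_in a j R}). f R) = (\<Sum>j=Suc a..b. \<Sum>R | R \<in> ?N \<and> next_in a j R. f R)"
    using fin uniq by (subst sum.UNION_disjoint) (auto simp: Suc_le_eq)
  also have "(\<Sum>R | R \<in> ?N \<and> {a} \<in> R. f R) = (\<Sum>P\<in>nc_on {Suc a..b}. f (insert {a} P))"
  proof (rule sum.reindex_bij_witness[of _ "insert {a}" "\<lambda>R. R - {{a}}"])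
    fix R assume R: "R \<in> {R \<in> ?N. {a} \<in> R}"
    then show "R - {{a}} \<in> nc_on {Suc a..b}"
      by (intro nc_on_remove_singleton) (auto simp: ins)
  next
    fix P assume P: "P \<in> nc_on {Suc a..b}"
    have "a \<notin> \<Union> P" by (simp add: nc_onD(1)[OF P])
    then have "{a} \<notin> P" by blast
    then show "insert {a} P - {{a}} = P" by simp
    show "insert {a} P \<in> {R \<in> ?N. {a} \<in> R}"
      using nc_on_insert_singleton[OF P, of a] by (simp add: ins)
  qed (auto simp: insert_absorb)
  also have "(\<Sum>j=Suc a..b. \<Sum>R | R \<in> ?N \<and> next_in a j R. f R) =
     (\<Sum>j=Suc a..b. \<Sum>P\<in>nc_on {Suc a..j - 1}. \<Sum>Q\<in>nc_on {j..b}. f (P \<union> add_elem a j Q))"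
  proof (rule sum.cong[OF refl])
    fix j assume "j \<in> {Suc a..b}"
    then have j: "a < j" "j \<le> b" by auto
    show "(\<Sum>R | R \<in> ?N \<and> next_in a j R. f R) = (\<Sum>P\<in>nc_on {Suc a..j - 1}. \<Sum>Q\<in>nc_on {j..b}. f (P \<union> add_elem a j Q))"
      unfolding sum.cartesian_product
    proof (rule sum.reindex_bij_witness[of _ "\<lambda>(P, Q). P \<union> add_elem a j Q"
            "\<lambda>R. ({B \<in> R. B \<subseteq> {Suc a..j - 1}}, (\<lambda>B. B - {a}) ` {B \<in> R. \<not> B \<subseteq> {Suc a..j - 1}})"], goal_cases)
      case (1 R)
      then show ?case using nc_on_split(3)[OF j, of R] by (simp only: prod.case mem_Collect_eq)
    next
      case (2 R)
      then show ?case using nc_on_split(1,2)[OF j, of R] by (simp only: mem_Sigma_iff mem_Collect_eq)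
    next
      case (3 PQ)
      then show ?case by (cases PQ) (simp only: prod.case mem_Sigma_iff nc_on_join_inverse[OF j])
    next
      case (4 PQ)
      then show ?case by (cases PQ) (simp only: prod.case mem_Sigma_iff mem_Collect_eq nc_on_join[OF j])
    next
      case (5 R)
      then show ?case using nc_on_split(3)[OF j, of R] by (simp only: prod.case mem_Collect_eq)
    qed
  qed
  finally show ?thesis .
qed

section \<open>The Kreweras complement along the first-block decomposition\<close>

lemma kpart_cong:
  assumes "\<And>i j. i \<in> S \<Longrightarrow> j \<in> S \<Longrightarrow> krel \<rho> i j = krel \<rho>' i j"
  shows "kpart \<rho> S = kpart \<rho>' S"
  unfolding kpart_def kclass_def using assms by (intro image_cong refl) auto

lemma kpart_union:
  assumes "\<And>i j. i \<in> S \<Longrightarrow> j \<in> T \<Longrightarrow> \<not> krel \<rho> i j"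
  shows "kpart \<rho> (S \<union> T) = kpart \<rho> S \<union> kpart \<rho> T"
proof -
  have "kclass \<rho> (S \<union> T) i = kclass \<rho> S i" if "i \<in> S" for i
    using assms that by (auto simp: kclass_def)
  moreover have "kclass \<rho> (S \<union> T) i = kclass \<rho> T i" if "i \<in> T" for i
    using assms that by (auto simp: kclass_def dest: krel_sym)
  ultimately show ?thesis
    unfolding kpart_def image_Un by (intro arg_cong2[of _ _ _ _ "(\<union>)"] image_cong refl)
qed

lemma kpart_insert:
  assumes e: "e \<in> S" and ae: "krel \<rho> a e"
  shows "kpart \<rho> (insert a S) = add_elem a e (kpart \<rho> S)"
proof -
  have *: "kclass \<rho> (insert a S) i = (if e \<in> kclass \<rho> S i then insert a (kclass \<rho> S i) else kclass \<rho> S i)" for i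
    using e ae by (auto simp: kclass_def intro: krel_trans krel_sym)
  have "kclass \<rho> (insert a S) a = kclass \<rho> (insert a S) e"
    by (rule kclass_eq[OF ae])
  then have "kpart \<rho> (insert a S) = kclass \<rho> (insert a S) ` S"
    using e by (auto simp: kpart_def)
  also have "\<dots> = add_elem a e (kpart \<rho> S)"
    unfolding add_elem_def kpart_def image_image by (intro image_cong refl *)
  finally show ?thesis .
qed

lemma kpart_singleton: "kpart \<rho> {a} = {{a}}"
  by (auto simp: kpart_def kclass_def)

lemma kpart_mem_subset: "C \<in> kpart \<rho> S \<Longrightarrow> C \<subseteq> S"
  by (auto simp: kpart_def kclass_def)

text \<open>When \<open>a\<close> is alone, \<open>{a + 1..b}\<close> is a union of blocks, so the
  primed point of \<open>a\<close> joins the class of the last one; for \<open>a = b\<close> the two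
  coincide.\<close>

lemma kpart_insert_singleton:
  assumes P: "P \<in> nc_on {Suc a..b}" and ab: "a \<le> b"
  shows "kpart (insert {a} P) {a..b} = (if a = b then {{a}} else add_elem a b (kpart P {Suc a..b}))"
proof -
  have "krel (insert {a} P) i j = krel P i j" for i j
    by (simp add: krel_def)
  then have *: "kpart (insert {a} P) S = kpart P S" for S
    by (intro kpart_cong)
  show ?thesis
  proof (cases "a = b")
    case False
    have "krel P a b"
      unfolding krel_def
    proof (intro ballI)
      fix B x y assume "B \<in> P" "x \<in> B" "y \<in> B"
      then have "x \<in> {Suc a..b}" "y \<in> {Suc a..b}" using nc_onD(1)[OF P] by blast+
      then show "((x \<le> a) = (x \<le> b)) = ((y \<le> a) = (y \<le> b))" by auto
    qed
    moreover have "{a..b} = insert a {Suc a..b}" using ab by auto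
    ultimately show ?thesis
      using False ab by (simp add: * kpart_insert)
  qed (simp add: kpart_singleton)
qed

text \<open>The block through \<open>a\<close> and \<open>j\<close> separates the primed points
  before \<open>j\<close> from the others. On the left \<open>{a + 1..j - 1}\<close> is a union of
  blocks, so the primed point of \<open>a\<close> joins the class of \<open>j - 1\<close>, which is
  \<open>a\<close> itself if \<open>j = Suc a\<close>.\<close>

lemma kpart_join:
  assumes aj: "a < j" and jb: "j \<le> b" and P: "P \<in> nc_on {Suc a..j - 1}" and Q: "Q \<in> nc_on {j..b}"
  shows "kpart (P \<union> add_elem a j Q) {a..b} =
    (if j = Suc a then {{a}} else add_elem a (j - 1) (kpart P {Suc a..j - 1})) \<union> kpart Q {j..b}"
proof -
  let ?R = "P \<union> add_elem a j Q"
  have Pm: "a < x \<and> x < j" if "B \<in> P" "x \<in> B" for B x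
  proof -
    have "x \<in> {Suc a..j - 1}" using that nc_onD(1)[OF P] by blast
    then show ?thesis using aj by auto
  qed
  have Qm: "j \<le> x \<and> x \<le> b" if "B \<in> Q" "x \<in> B" for B x
  proof -
    have "x \<in> {j..b}" using that nc_onD(1)[OF Q] by blast
    then show ?thesis by auto
  qed
  have R: "krel ?R i k \<longleftrightarrow> krel P i k \<and> krel (add_elem a j Q) i k" for i k
    by (auto simp: krel_def)
  have left: "krel ?R i k = krel P i k" if "i \<in> {a..j - 1}" "k \<in> {a..j - 1}" for i k
  proof -
    have "(x \<le> i) = (x \<le> k)" if "B \<in> add_elem a j Q" "x \<in> B" for B x
    proof -
      have "x = a \<or> j \<le> x" using that Qm by (auto simp: add_elem_def split: if_splits)
      then show ?thesis using \<open>i \<in> _\<close> \<open>k \<in> _\<close> aj by auto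
    qed
    then have "krel (add_elem a j Q) i k" unfolding krel_def by blast
    then show ?thesis by (simp add: R)
  qed
  have right: "krel ?R i k = krel Q i k" if "i \<in> {j..b}" "k \<in> {j..b}" for i k
  proof -
    have "(x \<le> i) = (x \<le> k)" if "B \<in> P" "x \<in> B" for B x
      using Pm[OF that] \<open>i \<in> _\<close> \<open>k \<in> _\<close> by auto
    then have 1: "krel P i k" unfolding krel_def by blast
    have a: "(a \<le> i) = (a \<le> k)" "(j \<le> i) = (j \<le> k)" using that aj by auto
    have "krel (add_elem a j Q) i k \<longleftrightarrow> (\<forall>B\<in>Q. \<forall>x\<in>(if j \<in> B then insert a B else B). \<forall>y\<in>(if j \<in> B then insert a B else B).
        ((x \<le> i) = (x \<le> k)) = ((y \<le> i) = (y \<le> k)))"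
      by (simp add: krel_def add_elem_def del: if_image_distrib)
    also have "\<dots> \<longleftrightarrow> krel Q i k"
      unfolding krel_def
    proof (rule ball_cong[OF refl])
      fix B assume "B \<in> Q"
      show "(\<forall>x\<in>(if j \<in> B then insert a B else B). \<forall>y\<in>(if j \<in> B then insert a B else B). ((x \<le> i) = (x \<le> k)) = ((y \<le> i) = (y \<le> k))) \<longleftrightarrow>
        (\<forall>x\<in>B. \<forall>y\<in>B. ((x \<le> i) = (x \<le> k)) = ((y \<le> i) = (y \<le> k)))"
      proof (cases "j \<in> B")
        case True
        then show ?thesis using a by (auto; metis)
      qed simp
    qed
    finally show ?thesis by (simp add: R 1)
  qed
  have cross: "\<not> krel ?R i k" if "i \<in> {a..j - 1}" "k \<in> {j..b}" for i k
  proof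
    assume k: "krel ?R i k"
    have "j \<in> \<Union> Q" using nc_onD(1)[OF Q] jb by auto
    then obtain C where "C \<in> Q" "j \<in> C" by blast
    then have C: "insert a C \<in> ?R" by (force simp: add_elem_def)
    have "a \<in> insert a C" "j \<in> insert a C" using \<open>j \<in> C\<close> by auto
    then have "((a \<le> i) = (a \<le> k)) = ((j \<le> i) = (j \<le> k))"
      by (rule bspec[OF bspec[OF bspec[OF k[unfolded krel_def] C]]])
    then show False using that aj by auto
  qed
  have "{a..b} = {a..j - 1} \<union> {j..b}" using aj jb by auto
  then have "kpart ?R {a..b} = kpart ?R {a..j - 1} \<union> kpart ?R {j..b}"
    using kpart_union[of "{a..j - 1}" "{j..b}" ?R] cross by simp
  also have "kpart ?R {j..b} = kpart Q {j..b}"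
    by (rule kpart_cong) (rule right)
  also have "kpart ?R {a..j - 1} = kpart P {a..j - 1}"
    by (rule kpart_cong) (rule left)
  also have "kpart P {a..j - 1} = (if j = Suc a then {{a}} else add_elem a (j - 1) (kpart P {Suc a..j - 1}))"
  proof (cases "j = Suc a")
    case True
    then show ?thesis by (simp add: kpart_singleton)
  next
    case False
    have "krel P a (j - 1)"
      unfolding krel_def
    proof (intro ballI)
      fix B x y assume B: "B \<in> P" "x \<in> B" "y \<in> B"
      show "((x \<le> a) = (x \<le> j - 1)) = ((y \<le> a) = (y \<le> j - 1))"
        using Pm[OF B(1,2)] Pm[OF B(1,3)] by auto
    qed
    moreover have "{a..j - 1} = insert a {Suc a..j - 1}" using aj by auto
    ultimately show ?thesis
      using False aj by (simp add: kpart_insert)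
  qed
  finally show ?thesis .
qed

subsection \<open>Weighted sums over non-crossing partitions\<close>

text \<open>
  The block of the first element counts as if it had \<open>s\<close> further elements, and the block of the
  complement that contains the last element as if it had \<open>t\<close> further elements.
\<close>

context
  fixes M :: "nat \<Rightarrow> 'a::complex_algebra" and \<mu> :: "nat \<Rightarrow> complex"
begin

definition block_wt :: "nat \<Rightarrow> nat \<Rightarrow> nat set set \<Rightarrow> 'a" where
  "block_wt a s P = (\<Prod>B\<in>P. M (card B + (if a \<in> B then s else 0)))"

definition kblock_wt :: "nat \<Rightarrow> nat \<Rightarrow> nat set set \<Rightarrow> complex" where
  "kblock_wt b t K = (\<Prod>C\<in>K. \<mu> (card C + (if b \<in> C then t else 0)))"

definition nc_sum :: "nat \<Rightarrow> nat \<Rightarrow> nat \<Rightarrow> nat \<Rightarrow> 'a" where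
  "nc_sum a b s t = (\<Sum>P\<in>nc_on {a..b}. block_wt a s P * cscal (kblock_wt b t (kpart P {a..b})))"

text \<open>On an empty interval the class of the last point is left with its \<open>t\<close>
  virtual elements alone, hence the value \<open>\<mu> t\<close>.\<close>

definition nc_sum0 :: "nat \<Rightarrow> nat \<Rightarrow> nat \<Rightarrow> 'a" where
  "nc_sum0 a b t = (if a \<le> b then nc_sum a b 0 t else cscal (\<mu> t))"

lemma kblock_wt_add_elem:
  assumes K: "\<And>C. C \<in> K \<Longrightarrow> finite C \<and> a \<notin> C" and "a \<noteq> e"
  shows "kblock_wt e t (add_elem a e K) = kblock_wt e (Suc t) K"
  unfolding kblock_wt_def
  by (subst prod_add_elem) (use assms in \<open>auto intro!: prod.cong\<close>)

lemma finite_blocks: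
  assumes "P \<in> nc_on {a..b}" shows "finite P" "\<And>B. B \<in> P \<Longrightarrow> finite B"
proof -
  have "P \<subseteq> Pow {a..b}" using nc_onD(1)[OF assms] by auto
  then show "finite P" "\<And>B. B \<in> P \<Longrightarrow> finite B"
    by (auto intro: finite_subset)
qed

lemma nc_on_empty: "nc_on {} = {{}}"
  by (auto simp: nc_on_def partition_on_def noncrossing_def)

lemma sum_insert_singleton:
  assumes ab: "a \<le> b"
  shows "(\<Sum>P\<in>nc_on {Suc a..b}. block_wt a s (insert {a} P) * cscal (kblock_wt b t (kpart (insert {a} P) {a..b}))) =
    M (Suc s) * nc_sum0 (Suc a) b (Suc t)"
proof -
  have 1: "block_wt a s (insert {a} P) = M (Suc s) * block_wt (Suc a) 0 P" if P: "P \<in> nc_on {Suc a..b}" for P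
  proof -
    have "a \<notin> \<Union> P" by (simp add: nc_onD(1)[OF P])
    then have n: "a \<notin> B" if "B \<in> P" for B using that by blast
    then have "{a} \<notin> P" by blast
    then have "block_wt a s (insert {a} P) = M (Suc s) * (\<Prod>B\<in>P. M (card B + (if a \<in> B then s else 0)))"
      using finite_blocks[OF P] by (simp add: block_wt_def)
    also have "(\<Prod>B\<in>P. M (card B + (if a \<in> B then s else 0))) = block_wt (Suc a) 0 P"
      unfolding block_wt_def using n by (intro prod.cong) auto
    finally show ?thesis .
  qed
  show ?thesis
  proof (cases "a = b")
    case True
    then show ?thesis
      using 1 by (simp add: nc_on_empty nc_sum0_def kpart_singleton block_wt_def kblock_wt_def)
  next
    case False
    have "kblock_wt b t (kpart (insert {a} P) {a..b}) = kblock_wt b (Suc t) (kpart P {Suc a..b})"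
      if P: "P \<in> nc_on {Suc a..b}" for P
    proof -
      have "finite C \<and> a \<notin> C" if "C \<in> kpart P {Suc a..b}" for C
        using kpart_mem_subset[OF that] by (auto intro: finite_subset)
      then show ?thesis
        using False kpart_insert_singleton[OF P ab] by (simp add: kblock_wt_add_elem)
    qed
    then show ?thesis
      using False ab by (simp add: 1 nc_sum0_def nc_sum_def sum_distrib_left mult.assoc)
  qed
qed

text \<open>The block of \<open>a\<close> continues at \<open>j\<close> with one more virtual
  element, hence \<open>Suc s\<close>. The primed point of \<open>a\<close> acts as the one virtual
  element in the class of \<open>j - 1\<close>, hence \<open>1\<close>. The class of
  \<open>b\<close> lies on the right and keeps \<open>t\<close>.\<close>

lemma sum_join:
  assumes aj: "a < j" and jb: "j \<le> b"
  shows "(\<Sum>P\<in>nc_on {Suc a..j - 1}. \<Sum>Q\<in>nc_on {j..b}.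
      block_wt a s (P \<union> add_elem a j Q) * cscal (kblock_wt b t (kpart (P \<union> add_elem a j Q) {a..b}))) =
    nc_sum0 (Suc a) (j - 1) 1 * nc_sum j b (Suc s) t"
proof -
  have 1: "block_wt a s (P \<union> add_elem a j Q) = block_wt (Suc a) 0 P * block_wt j (Suc s) Q"
    if P: "P \<in> nc_on {Suc a..j - 1}" and Q: "Q \<in> nc_on {j..b}" for P Q
  proof -
    have aP: "a \<notin> B" if "B \<in> P" for B
    proof -
      have "a \<notin> \<Union> P" by (simp add: nc_onD(1)[OF P])
      then show ?thesis using that by blast
    qed
    have aQ: "a \<notin> B" if "B \<in> Q" for B
    proof -
      have "a \<notin> \<Union> Q" using aj by (simp add: nc_onD(1)[OF Q])
      then show ?thesis using that by blast
    qed
    have "B \<notin> add_elem a j Q" if B: "B \<in> P" for B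
    proof
      assume "B \<in> add_elem a j Q"
      then obtain C where C: "C \<in> Q" "B = (if j \<in> C then insert a C else C)" by (auto simp: add_elem_def split: if_splits)
      then have "B = C" using aP[OF B] by (auto split: if_splits)
      then have "B \<subseteq> {Suc a..j - 1}" "B \<subseteq> {j..b}" using B C nc_onD(1)[OF P] nc_onD(1)[OF Q] by blast+
      moreover have "{Suc a..j - 1} \<inter> {j..b} = {}" by auto
      moreover have "B \<noteq> {}" using nc_onD(2)[OF P] B by blast
      ultimately show False by blast
    qed
    then have "P \<inter> add_elem a j Q = {}" by blast
    moreover have "finite (add_elem a j Q)" using finite_blocks[OF Q] by (simp add: add_elem_def)
    ultimately have "block_wt a s (P \<union> add_elem a j Q) = block_wt a s P * block_wt a s (add_elem a j Q)"
      unfolding block_wt_def using finite_blocks[OF P] by (intro prod.union_disjoint) auto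
    also have "block_wt a s P = block_wt (Suc a) 0 P"
      unfolding block_wt_def using aP by (intro prod.cong) auto
    also have "block_wt a s (add_elem a j Q) = block_wt j (Suc s) Q"
      unfolding block_wt_def
      by (subst prod_add_elem) (use aQ finite_blocks[OF Q] in \<open>auto intro!: prod.cong\<close>)
    finally show ?thesis .
  qed
  define Z where "Z P = (if j = Suc a then \<mu> 1 else kblock_wt (j - 1) 1 (kpart P {Suc a..j - 1}))" for P
  have 2: "kblock_wt b t (kpart (P \<union> add_elem a j Q) {a..b}) = Z P * kblock_wt b t (kpart Q {j..b})"
    if P: "P \<in> nc_on {Suc a..j - 1}" and Q: "Q \<in> nc_on {j..b}" for P Q
  proof -
    define K where "K = (if j = Suc a then {{a}} else add_elem a (j - 1) (kpart P {Suc a..j - 1}))"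
    have K: "kpart (P \<union> add_elem a j Q) {a..b} = K \<union> kpart Q {j..b}"
      unfolding K_def by (rule kpart_join[OF aj jb P Q])
    have KPm: "finite C \<and> a \<notin> C" if "C \<in> kpart P {Suc a..j - 1}" for C
      using kpart_mem_subset[OF that] by (auto intro: finite_subset)
    have Km: "C \<subseteq> {a..j - 1}" if "C \<in> K" for C
      using that kpart_mem_subset[of _ P "{Suc a..j - 1}"] aj
      by (fastforce simp: K_def add_elem_def split: if_splits)
    have fin: "finite K"
      by (simp add: K_def add_elem_def kpart_def)
    have disj: "K \<inter> kpart Q {j..b} = {}"
    proof -
      have False if "C \<in> K" "C \<in> kpart Q {j..b}" for C
      proof -
        have "C \<noteq> {}" using that(2) by (auto simp: kpart_def kclass_def)
        moreover have "C \<subseteq> {a..j - 1} \<inter> {j..b}" using Km[OF that(1)] kpart_mem_subset[OF that(2)] by blast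
        moreover have "{a..j - 1} \<inter> {j..b} = {}" using aj by auto
        ultimately show False by blast
      qed
      then show ?thesis by blast
    qed
    have "kblock_wt b t (kpart (P \<union> add_elem a j Q) {a..b}) = kblock_wt b t K * kblock_wt b t (kpart Q {j..b})"
      unfolding K kblock_wt_def using fin disj by (intro prod.union_disjoint) (auto simp: kpart_def)
    also have "kblock_wt b t K = kblock_wt (j - 1) 0 K"
    proof -
      have "b \<notin> C" if "C \<in> K" for C
      proof -
        have "b \<notin> {a..j - 1}" using jb aj by auto
        then show ?thesis using Km[OF that] by blast
      qed
      then show ?thesis unfolding kblock_wt_def by (intro prod.cong) auto
    qed
    also have "\<dots> = Z P"
      using KPm aj by (auto simp: K_def Z_def kblock_wt_add_elem) (simp add: kblock_wt_def)
    finally show ?thesis .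
  qed
  have "(\<Sum>P\<in>nc_on {Suc a..j - 1}. block_wt (Suc a) 0 P * cscal (Z P)) = nc_sum0 (Suc a) (j - 1) 1"
  proof (cases "j = Suc a")
    case True
    then show ?thesis by (simp add: Z_def nc_sum0_def nc_on_empty block_wt_def)
  next
    case False
    then have "Suc a \<le> j - 1" using aj by simp
    then show ?thesis using False by (simp add: Z_def nc_sum0_def nc_sum_def)
  qed
  moreover have "(\<Sum>P\<in>nc_on {Suc a..j - 1}. \<Sum>Q\<in>nc_on {j..b}.
      block_wt a s (P \<union> add_elem a j Q) * cscal (kblock_wt b t (kpart (P \<union> add_elem a j Q) {a..b}))) =
    (\<Sum>P\<in>nc_on {Suc a..j - 1}. block_wt (Suc a) 0 P * cscal (Z P)) * nc_sum j b (Suc s) t"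
    by (simp add: 1 2 cscal_mult nc_sum_def sum_product mult_ac)
  ultimately show ?thesis by simp
qed

lemma nc_sum_rec:
  assumes "a \<le> b"
  shows "nc_sum a b s t = M (Suc s) * nc_sum0 (Suc a) b (Suc t) +
    (\<Sum>j=Suc a..b. nc_sum0 (Suc a) (j - 1) 1 * nc_sum j b (Suc s) t)"
  unfolding nc_sum_def[of a b] sum_nc_on[OF assms] sum_insert_singleton[OF assms]
proof -
  have "(\<Sum>j=Suc a..b. \<Sum>P\<in>nc_on {Suc a..j - 1}. \<Sum>Q\<in>nc_on {j..b}.
      block_wt a s (P \<union> add_elem a j Q) * cscal (kblock_wt b t (kpart (P \<union> add_elem a j Q) {a..b}))) =
    (\<Sum>j=Suc a..b. nc_sum0 (Suc a) (j - 1) 1 * nc_sum j b (Suc s) t)"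
    by (rule sum.cong[OF refl], rule sum_join) auto
  then show "M (Suc s) * nc_sum0 (Suc a) b (Suc t) +
    (\<Sum>j=Suc a..b. \<Sum>P\<in>nc_on {Suc a..j - 1}. \<Sum>Q\<in>nc_on {j..b}.
      block_wt a s (P \<union> add_elem a j Q) * cscal (kblock_wt b t (kpart (P \<union> add_elem a j Q) {a..b}))) =
    M (Suc s) * nc_sum0 (Suc a) b (Suc t) + (\<Sum>j=Suc a..b. nc_sum0 (Suc a) (j - 1) 1 * nc_sum j b (Suc s) t)"
    by simp
qed

text \<open>The recursion sees only the lengths of intervals, so induction on the length replaces a
  transport of partitions along a shift.\<close>

lemma nc_sum_translate: "nc_sum a (a + n) s t = nc_sum 1 (1 + n) s t"
proof (induction n arbitrary: a s t rule: less_induct)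
  case (less n)
  have Z: "nc_sum0 (Suc c) (c + m) t = nc_sum0 2 (1 + m) t" if "m \<le> n" for c m t
  proof (cases m)
    case (Suc m')
    with that have "m' < n" by simp
    from less.IH[OF this, of "Suc c" 0 t] less.IH[OF this, of 2 0 t] show ?thesis
      by (simp add: nc_sum0_def Suc)
  qed (simp add: nc_sum0_def)
  have "nc_sum c (c + n) s t = M (Suc s) * nc_sum0 2 (1 + n) (Suc t) +
    (\<Sum>i<n. nc_sum0 2 (1 + i) 1 * nc_sum 1 (n - i) (Suc s) t)" for c
  proof -
    have "(\<Sum>j=Suc c..c + n. nc_sum0 (Suc c) (j - 1) 1 * nc_sum j (c + n) (Suc s) t) =
        (\<Sum>i<n. nc_sum0 (Suc c) (c + i) 1 * nc_sum (Suc (c + i)) (c + n) (Suc s) t)"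
      by (intro sum.reindex_bij_witness[of _ "\<lambda>i. Suc (c + i)" "\<lambda>j. j - Suc c"]) auto
    also have "\<dots> = (\<Sum>i<n. nc_sum0 2 (1 + i) 1 * nc_sum 1 (n - i) (Suc s) t)"
    proof (intro sum.cong refl arg_cong2[of _ _ _ _ "(*)"] Z)
      fix i assume i: "i \<in> {..<n}"
      then show "nc_sum (Suc (c + i)) (c + n) (Suc s) t = nc_sum 1 (n - i) (Suc s) t"
        using less.IH[of "n - 1 - i" "Suc (c + i)" "Suc s" t] by (simp add: Suc_diff_Suc)
    qed auto
    finally show ?thesis by (simp add: nc_sum_rec Z)
  qed
  from this[of a] this[of 1] show ?case by simp
qed

text \<open>Coefficient 0 is cleared because a first element is required for \<open>s\<close> to
  refer to its block; the empty interval is counted by \<open>nc_fps0\<close>.\<close>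

definition nc_fps :: "nat \<Rightarrow> nat \<Rightarrow> 'a fps" where
  "nc_fps s t = Abs_fps (\<lambda>n. if n = 0 then 0 else nc_sum 1 n s t)"

definition nc_fps0 :: "nat \<Rightarrow> 'a fps" where
  "nc_fps0 t = Abs_fps (\<lambda>n. nc_sum0 1 n t)"

lemma nc_fps0_eq: "nc_fps0 t = fps_const (cscal (\<mu> t)) + nc_fps 0 t"
  by (auto simp: fps_eq_iff nc_fps0_def nc_fps_def nc_sum0_def)

lemma nc_sum0_2: "nc_sum0 2 (Suc n) t = nc_sum0 1 n t"
proof (cases n)
  case (Suc m)
  then show ?thesis using nc_sum_translate[of 2 m 0 t] by (simp add: nc_sum0_def)
qed (simp add: nc_sum0_def)

lemma nc_fps_rec:
  "nc_fps s t = fps_X * nc_fps0 (Suc t) * fps_const (M (Suc s)) + fps_X * nc_fps0 1 * nc_fps (Suc s) t"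
proof (rule fps_ext)
  fix n
  show "nc_fps s t $ n = (fps_X * nc_fps0 (Suc t) * fps_const (M (Suc s)) + fps_X * nc_fps0 1 * nc_fps (Suc s) t) $ n"
  proof (cases n)
    case 0
    then show ?thesis by (simp add: nc_fps_def mult.assoc)
  next
    case (Suc m)
    have "(\<Sum>j=2..Suc m. nc_sum0 2 (j - 1) 1 * nc_sum j (Suc m) (Suc s) t) =
        (\<Sum>i<m. nc_sum0 2 (Suc i) 1 * nc_sum (i + 2) (Suc m) (Suc s) t)"
      by (intro sum.reindex_bij_witness[of _ "\<lambda>i. i + 2" "\<lambda>j. j - 2"]) (auto simp: numeral_2_eq_2 Suc_diff_Suc)
    also have "\<dots> = (\<Sum>i<m. nc_fps0 1 $ i * nc_fps (Suc s) t $ (m - i))"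
    proof (intro sum.cong refl)
      fix i assume "i \<in> {..<m}"
      then show "nc_sum0 2 (Suc i) 1 * nc_sum (i + 2) (Suc m) (Suc s) t = nc_fps0 1 $ i * nc_fps (Suc s) t $ (m - i)"
        using nc_sum_translate[of "i + 2" "m - 1 - i" "Suc s" t]
        by (simp add: nc_sum0_2 nc_fps0_def nc_fps_def Suc_diff_Suc)
    qed
    also have "\<dots> = (nc_fps0 1 * nc_fps (Suc s) t) $ m"
      by (simp add: fps_mult_nth atLeast0AtMost lessThan_Suc_atMost[symmetric] nc_fps_def)
    finally show ?thesis
      using nc_sum_rec[of 1 "Suc m" s t]
      by (simp add: Suc nc_fps_def mult.assoc nc_sum0_2 numeral_2_eq_2[symmetric])
        (simp add: nc_fps0_def mult.commute)
  qed
qed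

end

text \<open>As \<open>y\<close> has no constant term, coefficient \<open>n\<close> of
  \<open>F s\<close> involves only lower coefficients of \<open>F (Suc s)\<close>: the recursion
  climbs in \<open>s\<close> but descends in \<open>n\<close>.\<close>

lemma fps_recursion_unique:
  fixes F F' :: "nat \<Rightarrow> 'a::comm_ring_1 fps"
  assumes y: "y $ 0 = 0" and F: "\<And>s. F s = G s + y * F (Suc s)" and F': "\<And>s. F' s = G s + y * F' (Suc s)"
  shows "F s = F' s"
proof -
  have "F s $ n = F' s $ n" for n
  proof (induction n arbitrary: s rule: less_induct)
    case (less n)
    have "(y * F (Suc s)) $ n = (y * F' (Suc s)) $ n"
      unfolding fps_mult_nth
    proof (intro sum.cong refl)
      fix i assume "i \<in> {0..n}"
      then show "y $ i * F (Suc s) $ (n - i) = y $ i * F' (Suc s) $ (n - i)"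
        using y less[of "n - i" "Suc s"] by (cases "i = 0") auto
    qed
    then show ?case by (subst F, subst F') simp
  qed
  then show ?thesis by (rule fps_ext)
qed

lemma fps_subst_add: "fps_subst b (f + g) = fps_subst b f + fps_subst b g"
  by (simp add: fps_eq_iff fps_subst_def distrib_right sum.distrib)

lemma fps_comp_rec:
  fixes y :: "'a::comm_ring_1 fps"
  assumes y: "y $ 0 = 0"
  shows "fps_comp y (Abs_fps f) = fps_const (f 0) + y * fps_comp y (Abs_fps (\<lambda>i. f (Suc i)))"
proof -
  have const: "fps_comp y (fps_const c) = fps_const c" for c
  proof (rule fps_ext)
    fix n
    have "(\<Sum>i\<le>n. fps_const c $ i * (y ^ i) $ n) = (\<Sum>i\<le>n. if i = 0 then c * 1 $ n else 0)"
      by (intro sum.cong) auto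
    then show "fps_comp y (fps_const c) $ n = fps_const c $ n"
      by (simp add: fps_subst_def)
  qed
  have "Abs_fps f = fps_const (f 0) + fps_X * Abs_fps (\<lambda>i. f (Suc i))"
    by (simp add: fps_eq_iff)
  then show ?thesis
    by (simp only: fps_subst_add const fps_comp_mult[OF y] fps_comp_X[OF y])
qed

subsection \<open>The Catalan series\<close>

text \<open>The Catalan generating function at \<open>- X\<close>, that is
  \<open>(sqrt (1 + 4 X) - 1) / (2 X)\<close>.\<close>

definition catalan_fps :: "'a::complex_algebra fps" where
  "catalan_fps = Abs_fps (\<lambda>i. cscal ((- 1) ^ i * catalan i))"

lemma catalan_Suc: "of_nat (k + 2) * catalan (Suc k) = of_nat (2 * (2 * k + 1)) * catalan k"
proof -
  have "fact (2 * Suc k) = (of_nat (2 * k + 2) * of_nat (2 * k + 1) * fact (2 * k) :: complex)"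
    by (simp add: algebra_simps)
  moreover have "fact (Suc k + 1) = (of_nat (k + 2) * fact (k + 1) :: complex)"
    by (simp add: algebra_simps)
  moreover have "fact (Suc k) = (of_nat (k + 1) * fact k :: complex)"
    by simp
  moreover have "of_nat (2 * k + 2) = (2 * of_nat (k + 1) :: complex)" by simp
  moreover have nz: "of_nat (k + 2) \<noteq> (0::complex)" "of_nat (k + 1) \<noteq> (0::complex)" "fact (k + 1) \<noteq> (0::complex)" "fact k \<noteq> (0::complex)"
    using of_nat_eq_0_iff[of "k + 2"] of_nat_eq_0_iff[of "k + 1"] by (simp_all del: of_nat_add of_nat_Suc of_nat_eq_0_iff)
  ultimately show ?thesis
    unfolding catalan_def
    by (simp add: divide_simps del: of_nat_Suc fact_Suc of_nat_add) (simp add: algebra_simps)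
qed

text \<open>These are the coefficients of \<open>sqrt (1 + 4 X)\<close>; both sides change by the
  same ratio from \<open>n\<close> to \<open>n + 1\<close>, by \<open>catalan_Suc\<close> on the
  right.\<close>

lemma gchoose_half: "4 ^ Suc n * ((1 / 2 :: complex) gchoose Suc n) = 2 * ((- 1) ^ n * catalan n)"
proof (induction n)
  case 0
  show ?case by (simp add: catalan_def)
next
  case (Suc n)
  have "of_nat (n + 2) * (4 ^ Suc (Suc n) * ((1 / 2 :: complex) gchoose Suc (Suc n))) =
      4 ^ Suc (Suc n) * (of_nat (Suc (Suc n)) * ((1 / 2) gchoose Suc (Suc n)))"
    by (simp only: mult.left_commute) simp
  also have "of_nat (Suc (Suc n)) * ((1 / 2 :: complex) gchoose Suc (Suc n)) = (1 / 2 - of_nat (Suc n)) * ((1 / 2) gchoose Suc n)"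
    unfolding left_diff_distrib gbinomial_mult_1 by simp
  also have "4 ^ Suc (Suc n) * ((1 / 2 - of_nat (Suc n)) * ((1 / 2 :: complex) gchoose Suc n)) =
      4 * (1 / 2 - of_nat (Suc n)) * (4 ^ Suc n * ((1 / 2) gchoose Suc n))"
    by simp
  also have "\<dots> = 2 * ((- 1) ^ Suc n * (of_nat (2 * (2 * n + 1)) * catalan n))"
    unfolding Suc.IH by (simp add: algebra_simps)
  also have "\<dots> = of_nat (n + 2) * (2 * ((- 1) ^ Suc n * catalan (Suc n)))"
    unfolding catalan_Suc[symmetric] by (simp only: mult.left_commute)
  finally have "of_nat (n + 2) * (4 ^ Suc (Suc n) * ((1 / 2 :: complex) gchoose Suc (Suc n))) =
      of_nat (n + 2) * (2 * ((- 1) ^ Suc n * catalan (Suc n)))" .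
  moreover have "of_nat (n + 2) \<noteq> (0 :: complex)"
    unfolding of_nat_eq_0_iff by simp
  ultimately show ?case by (rule mult_left_cancel[THEN iffD1, rotated])
qed

text \<open>The square of \<open>fps_bin 4 (1 / 2)\<close>, which is
  \<open>1 + 2 X catalan_fps\<close>, equals \<open>1 + 4 X\<close>; division by \<open>4 X\<close>
  leaves the quadratic equation.\<close>

lemma catalan_fps_eq: "catalan_fps + fps_X * catalan_fps\<^sup>2 = (1 :: 'a::complex_algebra fps)"
proof -
  let ?N = "catalan_fps :: 'a fps"
  have b: "fps_bin 4 (1 / 2) = 1 + 2 * (fps_X * ?N)"
  proof (rule fps_ext)
    fix n
    show "fps_bin 4 (1 / 2) $ n = (1 + 2 * (fps_X * ?N)) $ n"
      using gchoose_half[of "n - 1"]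
      by (cases n) (simp_all add: fps_bin_def catalan_fps_def cscal_mult[of 2] fps_mult_of_nat_nth fps_numeral_nth
          numeral_fps_const del: power_Suc)
  qed
  have "fps_bin 4 (1 / 2) * fps_bin 4 (1 / 2) = (fps_bin 4 1 :: 'a fps)"
    by (simp add: fps_bin_mult)
  moreover have "fps_bin 4 1 = (1 + 4 * fps_X :: 'a fps)"
  proof (rule fps_ext)
    fix n
    consider "n = 0" | "n = 1" | m where "n = Suc (Suc m)"
      by (metis One_nat_def old.nat.exhaust)
    then show "fps_bin 4 1 $ n = (1 + 4 * fps_X :: 'a fps) $ n"
      using of_nat_gchoose_eq_0[of 1 n] by cases (auto simp: fps_bin_def numeral_fps_const)
  qed
  ultimately have "(1 + 2 * (fps_X * ?N)) * (1 + 2 * (fps_X * ?N)) = 1 + 4 * fps_X"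
    by (simp add: b)
  then have "4 * (fps_X * (?N + fps_X * ?N\<^sup>2)) = 4 * (fps_X * 1)"
    by (simp add: algebra_simps power2_eq_square)
  then have *: "(4 * (fps_X * (?N + fps_X * ?N\<^sup>2))) $ Suc n = (4 * (fps_X * 1)) $ Suc n" for n
    by simp
  show ?thesis
  proof (rule fps_ext)
    fix n
    have "cscal 4 * (?N + fps_X * ?N\<^sup>2) $ n = cscal 4 * 1 $ n"
      using *[of n] by (simp add: numeral_fps_const)
    then show "(?N + fps_X * ?N\<^sup>2) $ n = 1 $ n" by (rule cscal_cancel) simp
  qed
qed

subsection \<open>The functional equation of the free cumulants\<close>

text \<open>The value 0 at 0 suppresses the empty interval for \<open>t = 0\<close>: the series
  \<open>r\<close> below gets constant term 1, and the recursion in \<open>t\<close> starts without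
  a constant.\<close>

definition moebius_wt :: "nat \<Rightarrow> complex" where
  "moebius_wt k = (if k = 0 then 0 else (- 1) ^ (k - 1) * catalan (k - 1))"

text \<open>Unrolling the recursion in \<open>s\<close> sums the moments against powers of
  \<open>X V\<close>; unrolling in \<open>t\<close> sums the signed Catalan numbers against powers
  of a series \<open>A\<close>. The quadratic equation of the Catalan series then becomes
  \<open>V r = 1\<close>.\<close>

theorem free_cumulant_functional_equation:
  fixes M :: "nat \<Rightarrow> 'a::complex_algebra"
  assumes M0: "M 0 = 1"
  defines "V \<equiv> nc_fps0 M moebius_wt 1"
  defines "r \<equiv> 1 + nc_fps0 M moebius_wt 0"
  shows "V * r = 1" and "fps_comp (fps_X * V) (Abs_fps M) = r"
proof -
  let ?Z = "nc_fps0 M moebius_wt" and ?W = "nc_fps M moebius_wt"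
  define y where "y = fps_X * V"
  have y0: "y $ 0 = 0" by (simp add: y_def)
  define G where "G s = fps_comp y (Abs_fps (\<lambda>i. M (s + i)))" for s
  have G: "G s = fps_const (M s) + y * G (Suc s)" for s
    unfolding G_def by (subst fps_comp_rec[OF y0]) simp
  have W: "?W s t = fps_X * ?Z (Suc t) * G (Suc s)" for s t
  proof -
    have 1: "?W s t = fps_X * ?Z (Suc t) * fps_const (M (Suc s)) + y * ?W (Suc s) t" for s
      unfolding y_def V_def by (rule nc_fps_rec)
    have 2: "fps_X * ?Z (Suc t) * G (Suc s) = fps_X * ?Z (Suc t) * fps_const (M (Suc s)) + y * (fps_X * ?Z (Suc t) * G (Suc (Suc s)))" for s
      by (subst G[of "Suc s"]) (simp add: algebra_simps)
    show ?thesis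
      by (rule fps_recursion_unique[where F = "\<lambda>s. ?W s t" and F' = "\<lambda>s. fps_X * ?Z (Suc t) * G (Suc s)"
            and G = "\<lambda>s. fps_X * ?Z (Suc t) * fps_const (M (Suc s))", OF y0 1 2])
  qed
  \<comment> \<open>With this choice \<open>A * V\<close> is the moment series in \<open>X V\<close>
    without its constant term.\<close>
  define A where "A = fps_X * G 1"
  have A0: "A $ 0 = 0" by (simp add: A_def)
  have Z: "?Z t = fps_const (cscal (moebius_wt t)) + A * ?Z (Suc t)" for t
    unfolding nc_fps0_eq[of M moebius_wt t] W A_def by (simp add: algebra_simps)
  have AV: "A * V = y * G 1" by (simp add: A_def y_def algebra_simps)
  have "fps_comp y (Abs_fps M) = G 0" by (simp add: G_def)
  also have "\<dots> = 1 + A * V" by (subst G) (simp add: M0 AV)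
  also have "\<dots> = r" unfolding r_def V_def by (subst (2) Z) (simp add: moebius_wt_def)
  finally show "fps_comp (fps_X * V) (Abs_fps M) = r" by (simp add: y_def)
  define N where "N s = fps_comp A (Abs_fps (\<lambda>i. cscal (moebius_wt (s + i))))" for s
  have N: "N s = fps_const (cscal (moebius_wt s)) + A * N (Suc s)" for s
    unfolding N_def by (subst fps_comp_rec[OF A0]) simp
  have "V = N 1" unfolding V_def 
    by (rule fps_recursion_unique[where F = ?Z and F' = N and G = "\<lambda>s. fps_const (cscal (moebius_wt s))", OF A0 Z N])
  then have V: "V = fps_comp A catalan_fps"
    by (simp add: N_def catalan_fps_def moebius_wt_def)
  have "V + A * V\<^sup>2 = fps_comp A (catalan_fps + fps_X * catalan_fps\<^sup>2)"
    by (simp only: V fps_subst_add fps_comp_mult[OF A0] fps_comp_X[OF A0] fps_comp_power[OF A0])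
  also have "\<dots> = 1" by (simp only: catalan_fps_eq fps_comp_1)
  finally have "V * (1 + A * V) = 1" by (simp add: algebra_simps power2_eq_square)
  moreover have "1 + A * V = r" unfolding r_def V_def by (subst (2) Z) (simp add: moebius_wt_def)
  ultimately show "V * r = 1" by simp
qed

section \<open>Expansion to second order\<close>

text \<open>If \<open>f\<close> stands for H, this stands with weight 1 for the m-th derivative of H
  divided by m!, the coefficient of a^m in H(z + a).\<close>

definition taylor_term :: "nat \<Rightarrow> 'a::complex_algebra fps \<Rightarrow> 'a fps" where
  "taylor_term m f = Abs_fps (\<lambda>n. if n < m then 0 else f $ (n - m) * cscal ((1 - of_nat (n - m)) gchoose m))"

lemma fps_shift_var_taylor:
  assumes "n \<le> N"
  shows "fps_shift_var a 1 f $ n = (\<Sum>m\<le>N. cscal a ^ m * taylor_term m f $ n)"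
proof -
  have "fps_shift_var a 1 f $ n = (\<Sum>m\<le>n. cscal a ^ m * taylor_term m f $ n)"
    unfolding fps_shift_var_nth
    by (intro sum.reindex_bij_witness[of _ "\<lambda>m. n - m" "\<lambda>m. n - m"])
       (auto simp: taylor_term_def cscal_mult cscal_power mult_ac)
  also have "\<dots> = (\<Sum>m\<le>N. cscal a ^ m * taylor_term m f $ n)"
    using assms by (intro sum.mono_neutral_left) (auto simp: taylor_term_def)
  finally show ?thesis .
qed

lemma taylor_term_0: "taylor_term 0 f = f"
  by (simp add: taylor_term_def fps_eq_iff)

lemma taylor_term_1: "taylor_term 1 f = fps_X * (f - fps_X * fps_deriv f)"
proof (rule fps_ext)
  fix n
  show "taylor_term 1 f $ n = (fps_X * (f - fps_X * fps_deriv f)) $ n"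
    by (cases n) (simp_all add: taylor_term_def nth_X_deriv cscal_diff algebra_simps)
qed

lemma taylor_term_2: "2 * taylor_term 2 f = fps_X ^ 4 * fps_deriv (fps_deriv f)"
proof (rule fps_ext)
  fix n
  consider "n = 0" | "n = 1" | m where "n = Suc (Suc m)"
    by (metis One_nat_def old.nat.exhaust)
  then show "(2 * taylor_term 2 f) $ n = (fps_X ^ 4 * fps_deriv (fps_deriv f)) $ n"
  proof cases
    case (3 m)
    have "2 * ((1 - of_nat m :: complex) gchoose 2) = of_nat m * (of_nat m - 1)"
      by (simp add: gbinomial_prod_rev numeral_2_eq_2 field_simps)
    then have c: "2 * cscal ((1 - of_nat m) gchoose 2) = (of_nat m * (of_nat m - 1) :: 'a)"
      by (metis cscal_1 cscal_diff cscal_mult cscal_numeral cscal_of_nat)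
    have "(2 * taylor_term 2 f) $ n = 2 * (f $ m * cscal ((1 - of_nat m) gchoose 2))"
      by (simp add: 3 taylor_term_def numeral_fps_const numeral_2_eq_2)
    also have "\<dots> = of_nat m * (of_nat m - 1) * f $ m"
      by (simp add: c[symmetric] mult_ac)
    also have "\<dots> = (fps_X ^ 2 * fps_deriv (fps_deriv f)) $ m"
    proof -
      consider "m = 0" | "m = 1" | l where "m = Suc (Suc l)"
        by (metis One_nat_def old.nat.exhaust)
      then show ?thesis
        unfolding fps_X_power_mult_nth by cases (auto simp: algebra_simps)
    qed
    also have "\<dots> = (fps_X ^ 2 * (fps_X ^ 2 * fps_deriv (fps_deriv f))) $ n"
      using fps_X_power_mult_nth[of 2 "fps_X ^ 2 * fps_deriv (fps_deriv f)" n] 3 by simp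
    also have "fps_X ^ 2 * (fps_X ^ 2 * fps_deriv (fps_deriv f)) = fps_X ^ 4 * fps_deriv (fps_deriv f)"
      by (simp add: mult.assoc[symmetric] power_add[symmetric])
    finally show ?thesis .
  qed (simp_all add: taylor_term_def fps_X_power_mult_nth numeral_fps_const)
qed

text \<open>With weight 2 this stands for H H'' - H'^2, the coefficient of a^2 in H(z + a) H(z -
  a).\<close>

definition second_order :: "'a::complex_algebra fps \<Rightarrow> 'a fps" where
  "second_order h = 2 * h * taylor_term 2 h - (taylor_term 1 h)\<^sup>2"

lemma second_order_eq:
  "second_order h = fps_X\<^sup>2 * (fps_X\<^sup>2 * h * fps_deriv (fps_deriv h) - (h - fps_X * fps_deriv h)\<^sup>2)"
proof -
  have "second_order h = h * (2 * taylor_term 2 h) - (taylor_term 1 h)\<^sup>2"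
    by (simp add: second_order_def mult_ac)
  also have "\<dots> = fps_X\<^sup>2 * (fps_X\<^sup>2 * h * fps_deriv (fps_deriv h) - (h - fps_X * fps_deriv h)\<^sup>2)"
    unfolding taylor_term_2 taylor_term_1
    by (simp add: algebra_simps power2_eq_square power4_eq_xxxx)
  finally show ?thesis .
qed

text \<open>The third-order term is split off so that, being odd in \<open>a\<close>, it can cancel
  explicitly; what remains lies four degrees lower.\<close>

definition taylor_rest :: "'a::complex_algebra fps \<Rightarrow> complex \<Rightarrow> 'a fps" where
  "taylor_rest h a = fps_shift_var a 1 h - (h + fps_const (cscal a) * taylor_term 1 h +
     fps_const (cscal a) ^ 2 * taylor_term 2 h + fps_const (cscal a) ^ 3 * taylor_term 3 h)"

definition sym_prod :: "'a::complex_algebra fps \<Rightarrow> nat \<Rightarrow> 'a fps" where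
  "sym_prod h k = (\<Prod>i<k. fps_shift_var ((of_nat k - 1) / 2 - of_nat i) 1 h)"

lemma sym_prod_Suc_Suc:
  "sym_prod h (Suc (Suc k)) = sym_prod h k *
     (fps_shift_var (of_nat (Suc k) / 2) 1 h * fps_shift_var (- (of_nat (Suc k) / 2)) 1 h)"
proof -
  let ?f = "\<lambda>i. fps_shift_var ((of_nat (Suc (Suc k)) - 1) / 2 - of_nat i) 1 h"
  have e: "(of_nat (Suc (Suc k)) - 1) / 2 = (of_nat (Suc k) / 2 :: complex)" by simp
  have "sym_prod h (Suc (Suc k)) = (\<Prod>i<Suc k. ?f i) * ?f (Suc k)"
    unfolding sym_prod_def by (rule prod.lessThan_Suc)
  also have "(\<Prod>i<Suc k. ?f i) = ?f 0 * (\<Prod>i<k. ?f (Suc i))"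
    by (rule prod.lessThan_Suc_shift)
  also have "(\<Prod>i<k. ?f (Suc i)) = sym_prod h k"
    unfolding sym_prod_def by (intro prod.cong refl arg_cong[of _ _ "\<lambda>c. fps_shift_var c 1 h"]) (simp add: field_simps)
  also have "?f 0 = fps_shift_var (of_nat (Suc k) / 2) 1 h" by simp
  also have "?f (Suc k) = fps_shift_var (- (of_nat (Suc k) / 2)) 1 h"
    by (intro arg_cong[of _ _ "\<lambda>c. fps_shift_var c 1 h"]) (simp add: field_simps)
  finally show ?thesis by (simp only: ac_simps)
qed

text \<open>\<open>a^2\<close> summed over the pairs of opposite shifts in \<open>sym_prod\<close>,
  which is half the sum of the squares of \<open>(k - 1) / 2 - i\<close>.\<close>

definition sum_sq :: "nat \<Rightarrow> complex" where
  "sum_sq k = of_nat k * (of_nat k ^ 2 - 1) / 24"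

locale degree_filtration =
  fixes Deg :: "int \<Rightarrow> 'a::complex_algebra set"
  assumes deg_0: "0 \<in> Deg d"
    and deg_add: "x \<in> Deg d \<Longrightarrow> y \<in> Deg d \<Longrightarrow> x + y \<in> Deg d"
    and deg_mult: "x \<in> Deg d \<Longrightarrow> y \<in> Deg d' \<Longrightarrow> x * y \<in> Deg (d + d')"
    and deg_cscal: "cscal c \<in> Deg 0"
    and deg_mono: "d \<le> d' \<Longrightarrow> x \<in> Deg d \<Longrightarrow> x \<in> Deg d'"
begin

lemma deg_sum: "(\<And>i. i \<in> I \<Longrightarrow> f i \<in> Deg d) \<Longrightarrow> sum f I \<in> Deg d"
  by (induction I rule: infinite_finite_induct) (auto intro: deg_0 deg_add)

lemma deg_scale: "x \<in> Deg d \<Longrightarrow> cscal c * x \<in> Deg d"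
  using deg_mult[OF deg_cscal, of x d c] by simp

lemma deg_uminus: "x \<in> Deg d \<Longrightarrow> - x \<in> Deg d"
  using deg_scale[of x d "-1"] by (simp add: cscal_minus)

text \<open>With \<open>z\<close> of degree \<open>1\<close>, \<open>fil e f\<close> says that \<open>z\<^sup>k f(1/z)\<close> has degree at most \<open>k - e\<close>.\<close>

definition fil :: "int \<Rightarrow> 'a fps \<Rightarrow> bool" where
  "fil e f \<longleftrightarrow> (\<forall>j. f $ j \<in> Deg (int j - e))"

lemma fil_add: "fil e f \<Longrightarrow> fil e g \<Longrightarrow> fil e (f + g)"
  by (simp add: fil_def deg_add)

lemma fil_uminus: "fil e f \<Longrightarrow> fil e (- f)"
  by (simp add: fil_def deg_uminus)

lemma fil_diff: "fil e f \<Longrightarrow> fil e g \<Longrightarrow> fil e (f - g)"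
  using fil_add[of e f "- g"] fil_uminus[of e g] by simp

lemma fil_mult: "fil e f \<Longrightarrow> fil e' g \<Longrightarrow> fil (e + e') (f * g)"
  unfolding fil_def fps_mult_nth
proof (intro allI deg_sum)
  fix j i :: nat assume "\<forall>j. f $ j \<in> Deg (int j - e)" "\<forall>j. g $ j \<in> Deg (int j - e')" "i \<in> {0..j}"
  then show "f $ i * g $ (j - i) \<in> Deg (int j - (e + e'))"
  proof -
    have "(int i - e) + (int (j - i) - e') = int j - (e + e')"
      using \<open>i \<in> {0..j}\<close> by (simp add: of_nat_diff)
    moreover have "f $ i * g $ (j - i) \<in> Deg ((int i - e) + (int (j - i) - e'))"
      by (rule deg_mult) (use \<open>\<forall>j. f $ j \<in> _\<close> \<open>\<forall>j. g $ j \<in> _\<close> in blast)+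
    ultimately show ?thesis by (simp only:)
  qed
qed

lemma fil_mono: "e' \<le> e \<Longrightarrow> fil e f \<Longrightarrow> fil e' f"
  unfolding fil_def by (intro allI deg_mono[of "int j - e" "int j - e'" for j]) auto

lemma fil_const: "fil 0 (fps_const (cscal c))"
proof -
  have "(if j = 0 then cscal c else 0) \<in> Deg (int j)" for j
    using deg_cscal[of c] by (auto intro: deg_0)
  then show ?thesis by (simp add: fil_def fps_nth_fps_const)
qed

lemma fil_1: "fil 0 1"
  using fil_const[of 1] by simp

lemma fil_mult_left: "fil 0 f \<Longrightarrow> fil e g \<Longrightarrow> fil e (f * g)"
  using fil_mult[of 0 f e g] by simp

lemma fil_power: "fil 0 f \<Longrightarrow> fil 0 (f ^ n)"
  by (induction n) (auto intro: fil_1 fil_mult_left)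

lemma fil_taylor_term: "fil 0 f \<Longrightarrow> fil (int m) (taylor_term m f)"
  unfolding fil_def
proof
  fix j assume "\<forall>j. f $ j \<in> Deg (int j - 0)"
  then have f: "f $ (j - m) \<in> Deg (int (j - m) - 0)" by blast
  show "taylor_term m f $ j \<in> Deg (int j - int m)"
  proof (cases "j < m")
    case False
    then have "int (j - m) - 0 = int j - int m" by simp
    with f have "f $ (j - m) \<in> Deg (int j - int m)" by (simp only:)
    from deg_scale[OF this, of "(1 - of_nat (j - m)) gchoose m"] False show ?thesis
      by (simp add: taylor_term_def mult.commute)
  qed (simp add: taylor_term_def deg_0)
qed

context
  fixes h :: "'a fps" assumes h: "fil 0 h"
begin

lemma fil_taylor_rest: "fil 4 (taylor_rest h a)"
  unfolding fil_def
proof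
  fix n
  \<comment> \<open>Terms with \<open>m > n\<close> vanish; the bound \<open>n + 4\<close> allows
    the orders 0 to 3 to be split off for every \<open>n\<close>.\<close>
  have "fps_shift_var a 1 h $ n = (\<Sum>m\<le>n + 4. cscal a ^ m * taylor_term m h $ n)"
    by (rule fps_shift_var_taylor) simp
  also have "\<dots> = (\<Sum>m<4. cscal a ^ m * taylor_term m h $ n) + (\<Sum>m=4..n+4. cscal a ^ m * taylor_term m h $ n)"
  proof -
    have "{..n + 4} = {..<4} \<union> {4..n+4}" by auto
    then show ?thesis by (simp only:) (rule sum.union_disjoint, auto)
  qed
  also have "(\<Sum>m<4. cscal a ^ m * taylor_term m h $ n) = (h + fps_const (cscal a) * taylor_term 1 h +
     fps_const (cscal a) ^ 2 * taylor_term 2 h + fps_const (cscal a) ^ 3 * taylor_term 3 h) $ n"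
    by (simp add: eval_nat_numeral taylor_term_0 mult.assoc)
  finally have "taylor_rest h a $ n = (\<Sum>m=4..n+4. cscal a ^ m * taylor_term m h $ n)"
    by (simp add: taylor_rest_def)
  also have "\<dots> \<in> Deg (int n - 4)"
  proof (rule deg_sum)
    fix m assume m: "m \<in> {4..n+4}"
    have "taylor_term m h $ n \<in> Deg (int n - int m)"
      using fil_taylor_term[OF h, of m] by (simp add: fil_def)
    then have "taylor_term m h $ n \<in> Deg (int n - 4)"
      by (rule deg_mono[rotated]) (use m in auto)
    then show "cscal a ^ m * taylor_term m h $ n \<in> Deg (int n - 4)"
      unfolding cscal_power[symmetric] by (rule deg_scale)
  qed
  finally show "taylor_rest h a $ n \<in> Deg (int n - 4)" .
qed

lemma fil_second_order: "fil 2 (second_order h)"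
proof -
  have "fil 2 (h * taylor_term 2 h)" using fil_mult_left[OF h fil_taylor_term[OF h, of 2]] by simp
  moreover have "fil 2 (taylor_term 1 h * taylor_term 1 h)"
    using fil_mult[OF fil_taylor_term[OF h, of 1] fil_taylor_term[OF h, of 1]] by simp
  ultimately have "fil 2 (h * taylor_term 2 h + h * taylor_term 2 h - taylor_term 1 h * taylor_term 1 h)"
    by (intro fil_diff fil_add)
  moreover have "second_order h = h * taylor_term 2 h + h * taylor_term 2 h - taylor_term 1 h * taylor_term 1 h"
    by (simp add: second_order_def power2_eq_square mult.assoc)
  ultimately show ?thesis by (simp only:)
qed

text \<open>Odd powers of \<open>a\<close> cancel, and every other term beyond \<open>a^2\<close>
  contains derivatives of total order at least four or a \<open>taylor_rest\<close>.\<close>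

lemma fil_shift_pair:
  "fil 4 (fps_shift_var a 1 h * fps_shift_var (- a) 1 h - (h\<^sup>2 + fps_const (cscal (a\<^sup>2)) * second_order h))"
proof -
  define c T1 T2 T3 R R' :: "'a fps" where "c = fps_const (cscal a)"
    and "T1 = taylor_term 1 h" and "T2 = taylor_term 2 h" and "T3 = taylor_term 3 h"
    and "R = taylor_rest h a" and "R' = taylor_rest h (- a)"
  have S: "fps_shift_var a 1 h = h + c * T1 + c ^ 2 * T2 + c ^ 3 * T3 + R"
    unfolding R_def taylor_rest_def by (simp add: c_def T1_def T2_def T3_def)
  have mc: "fps_const (cscal (- a)) = - c"
    by (simp add: c_def cscal_minus)
  have S': "fps_shift_var (- a) 1 h = h - c * T1 + c ^ 2 * T2 - c ^ 3 * T3 + R'"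
    unfolding R'_def taylor_rest_def mc by (simp add: T1_def T2_def T3_def)
  have c2: "fps_const (cscal (a\<^sup>2)) = c ^ 2"
    by (simp add: c_def cscal_power fps_const_power)
  have T: "fil 1 T1" "fil 2 T2" "fil 3 T3" "fil 4 R" "fil 4 R'"
    using fil_taylor_term[OF h, of 1] fil_taylor_term[OF h, of 2] fil_taylor_term[OF h, of 3] fil_taylor_rest
    by (simp_all add: T1_def T2_def T3_def R_def R'_def)
  have c: "fil 0 (c ^ m)" for m
    unfolding c_def by (intro fil_power fil_const)
  have T0: "fil 0 T1" "fil 0 T2" "fil 0 T3" "fil 0 R'"
    using T by (auto intro: fil_mono[rotated])
  have "fps_shift_var a 1 h * fps_shift_var (- a) 1 h - (h\<^sup>2 + c ^ 2 * (2 * h * T2 - T1\<^sup>2)) =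
     c ^ 4 * (T2 * T2) - c ^ 4 * (T1 * T3) - c ^ 4 * (T1 * T3) - c ^ 6 * (T3 * T3)
     + (h - c ^ 1 * T1 + c ^ 2 * T2 - c ^ 3 * T3 + R') * R + (h + c ^ 1 * T1 + c ^ 2 * T2 + c ^ 3 * T3) * R'"
    unfolding S S' by (simp add: algebra_simps power2_eq_square power3_eq_cube power4_eq_xxxx power_add[symmetric] eval_nat_numeral)
  also have "fil 4 \<dots>"
  proof -
    have "fil 4 (T2 * T2)" using fil_mult[OF T(2,2)] by simp
    moreover have "fil 4 (T1 * T3)" using fil_mult[OF T(1,3)] by simp
    moreover have "fil 4 (T3 * T3)" using fil_mult[OF T(3,3)] by (auto intro: fil_mono[rotated])
    moreover have "fil 0 (h - c ^ 1 * T1 + c ^ 2 * T2 - c ^ 3 * T3 + R')"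
      by (intro fil_add fil_diff h fil_mult_left[OF c] T0)
    moreover have "fil 0 (h + c ^ 1 * T1 + c ^ 2 * T2 + c ^ 3 * T3)"
      by (intro fil_add fil_diff h fil_mult_left[OF c] T0)
    ultimately show ?thesis
      by (intro fil_add fil_diff fil_mult_left[OF c] fil_mult_left[OF _ T(4)] fil_mult_left[OF _ T(5)] h T0)
  qed
  finally show ?thesis
    unfolding c2 by (simp add: second_order_def T1_def T2_def)
qed

lemma fil_sym_prod:
  "fil 4 (sym_prod h k - (h ^ k + fps_const (cscal (sum_sq k)) * (h ^ (k - 2) * second_order h)))"
proof (induction k rule: induct_nat_012)
  case 0
  show ?case using fil_mono[of 4 0] by (simp add: sym_prod_def sum_sq_def fil_def deg_0)
next
  case 1
  show ?case by (simp add: sym_prod_def sum_sq_def fil_def deg_0)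
next
  case (ge2 k)
  let ?a = "of_nat (Suc k) / 2 :: complex"
  define Q where "Q = second_order h"
  define c s s' :: "'a fps" where "c = fps_const (cscal (?a\<^sup>2))" and "s = fps_const (cscal (sum_sq k))"
    and "s' = fps_const (cscal (sum_sq (Suc (Suc k))))"
  define E where "E = sym_prod h k - (h ^ k + s * (h ^ (k - 2) * Q))"
  define D where "D = fps_shift_var ?a 1 h * fps_shift_var (- ?a) 1 h - (h\<^sup>2 + c * Q)"
  have fE: "fil 4 E" using ge2(1) by (simp add: E_def s_def Q_def)
  have fD: "fil 4 D" unfolding D_def c_def Q_def by (rule fil_shift_pair)
  have fQ: "fil 2 Q" unfolding Q_def by (rule fil_second_order)
  have fQ0: "fil 0 Q" using fQ by (rule fil_mono[rotated]) simp
  have fc: "fil 0 c" "fil 0 s" by (simp_all add: c_def s_def fil_const)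
  have "sum_sq (Suc (Suc k)) = ?a\<^sup>2 + sum_sq k"
    by (simp add: sum_sq_def field_simps power2_eq_square power3_eq_cube)
  then have s': "s' = c + s" by (simp add: s'_def c_def s_def cscal_add fps_const_add)
  \<comment> \<open>For \<open>k < 2\<close> the exponent \<open>k - 2\<close> is truncated, but
    then \<open>sum_sq k\<close> vanishes.\<close>
  have sh: "s * (h ^ (k - 2) * h\<^sup>2) = s * h ^ k"
  proof (cases "2 \<le> k")
    case True
    then show ?thesis by (simp only: power_add[symmetric] le_add_diff_inverse2)
  next
    case False
    then have "k = 0 \<or> k = 1" by linarith
    then have "sum_sq k = 0" by (auto simp: sum_sq_def)
    then show ?thesis by (simp add: s_def)
  qed
  have "sym_prod h (Suc (Suc k)) = (h ^ k + s * (h ^ (k - 2) * Q) + E) * (h\<^sup>2 + c * Q + D)"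
    by (simp add: sym_prod_Suc_Suc E_def D_def)
  also have "\<dots> = h ^ k * h\<^sup>2 + c * (h ^ k * Q) + s * (h ^ (k - 2) * h\<^sup>2) * Q +
      (s * (h ^ (k - 2) * (c * (Q * Q))) + (h ^ k + s * (h ^ (k - 2) * Q) + E) * D + (h\<^sup>2 + c * Q) * E)"
    by (simp add: algebra_simps)
  also have "\<dots> = h ^ Suc (Suc k) + s' * (h ^ (Suc (Suc k) - 2) * Q) +
      (s * (h ^ (k - 2) * (c * (Q * Q))) + (h ^ k + s * (h ^ (k - 2) * Q) + E) * D + (h\<^sup>2 + c * Q) * E)"
    unfolding sh s' by (simp add: algebra_simps power2_eq_square)
  finally have *: "sym_prod h (Suc (Suc k)) - (h ^ Suc (Suc k) + s' * (h ^ (Suc (Suc k) - 2) * Q)) =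
      s * (h ^ (k - 2) * (c * (Q * Q))) + (h ^ k + s * (h ^ (k - 2) * Q) + E) * D + (h\<^sup>2 + c * Q) * E"
    by simp
  have "fil 4 (Q * Q)" using fil_mult[OF fQ fQ] by simp
  moreover have "fil 0 E" using fE by (rule fil_mono[rotated]) simp
  ultimately have "fil 4 (s * (h ^ (k - 2) * (c * (Q * Q))) + (h ^ k + s * (h ^ (k - 2) * Q) + E) * D + (h\<^sup>2 + c * Q) * E)"
    by (intro fil_add fil_mult_left[OF _ fD] fil_mult_left[OF _ fE] fil_mult_left[OF fc(1)] fil_mult_left[OF fc(2)]
        fil_mult_left[OF fil_power[OF h]] fil_power h fQ0)
  then have "fil 4 (sym_prod h (Suc (Suc k)) - (h ^ Suc (Suc k) + s' * (h ^ (Suc (Suc k) - 2) * Q)))"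
    by (simp only: *)
  then show ?case by (simp only: s'_def Q_def)
qed

text \<open>Translation by \<open>(k - 1) / 2\<close> takes \<open>shift_prod\<close> to
  \<open>sym_prod\<close> without changing the residue. The bound \<open>k - 3\<close> is the degree
  \<open>k + 1\<close> of that coefficient lowered by four.\<close>

lemma shift_prod_residue_expansion:
  "\<exists>E\<in>Deg (int k - 3). shift_prod h k $ Suc k =
     (h ^ k) $ Suc k + cscal (sum_sq k) * (h ^ (k - 2) * second_order h) $ Suc k + E"
proof -
  have "shift_prod h k $ Suc k = fps_shift_var ((of_nat k - 1) / 2) (of_nat k) (shift_prod h k) $ Suc k"
    by (rule fps_shift_var_residue[symmetric])
  also have "\<dots> = sym_prod h k $ Suc k"
    by (simp add: shift_var_shift_prod sym_prod_def)
  finally have "shift_prod h k $ Suc k = (h ^ k) $ Suc k + cscal (sum_sq k) * (h ^ (k - 2) * second_order h) $ Suc k +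
     (sym_prod h k - (h ^ k + fps_const (cscal (sum_sq k)) * (h ^ (k - 2) * second_order h))) $ Suc k"
    by simp
  moreover have "(sym_prod h k - (h ^ k + fps_const (cscal (sum_sq k)) * (h ^ (k - 2) * second_order h))) $ Suc k \<in> Deg (int k - 3)"
  proof -
    have "int (Suc k) - 4 = int k - 3" by simp
    then show ?thesis using fil_sym_prod[of k] unfolding fil_def by metis
  qed
  ultimately show ?thesis by blast
qed

end

end

section \<open>Sums over multiplicity sequences\<close>

lemma support_atMost:
  fixes m :: "nat \<Rightarrow> nat"
  assumes "\<forall>s>B. m s = 0" shows "{s. m s \<noteq> 0} \<subseteq> {..B}"
proof
  fix s assume "s \<in> {s. m s \<noteq> 0}"
  then show "s \<in> {..B}" using assms by (cases "s \<le> B") auto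
qed

text \<open>The common range up to \<open>B\<close> replaces the support of \<open>m\<close>, so
  that members of \<open>mult_seqs\<close> for different arguments can be compared.\<close>

lemma mult_seqs_iff:
  assumes "N \<le> B"
  shows "m \<in> mult_seqs N \<longleftrightarrow> m 0 = 0 \<and> m 1 = 0 \<and> (\<forall>s>B. m s = 0) \<and> (\<Sum>s\<le>B. s * m s) = N"
proof
  assume m: "m \<in> mult_seqs N"
  have le: "s \<le> N" if "m s \<noteq> 0" for s
  proof -
    have "s * m s \<le> (\<Sum>s | m s \<noteq> 0. s * m s)"
      using m that by (intro member_le_sum) (auto simp: mult_seqs_def)
    then show ?thesis using m that by (cases "m s") (auto simp: mult_seqs_def)
  qed
  then have z: "\<forall>s>B. m s = 0" using assms by (metis leD le_trans)
  have "(\<Sum>s | m s \<noteq> 0. s * m s) = (\<Sum>s\<le>B. s * m s)"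
    using support_atMost[OF z] by (intro sum.mono_neutral_left) auto
  with m z show "m 0 = 0 \<and> m 1 = 0 \<and> (\<forall>s>B. m s = 0) \<and> (\<Sum>s\<le>B. s * m s) = N"
    by (auto simp: mult_seqs_def)
next
  assume m: "m 0 = 0 \<and> m 1 = 0 \<and> (\<forall>s>B. m s = 0) \<and> (\<Sum>s\<le>B. s * m s) = N"
  then have sub: "{s. m s \<noteq> 0} \<subseteq> {..B}" by (intro support_atMost) simp
  moreover have "(\<Sum>s | m s \<noteq> 0. s * m s) = (\<Sum>s\<le>B. s * m s)"
    using sub by (intro sum.mono_neutral_left) auto
  ultimately show "m \<in> mult_seqs N"
    using m by (auto simp: mult_seqs_def intro: finite_subset)
qed

definition seq_wt :: "(nat \<Rightarrow> 'a::complex_algebra) \<Rightarrow> (nat \<Rightarrow> nat) \<Rightarrow> 'a" where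
  "seq_wt x m = cscal (multinomial_coeff m) * (\<Prod>s | m s \<noteq> 0. x s ^ m s)"

lemma seq_wt_eq:
  assumes "{s. m s \<noteq> 0} \<subseteq> {..B}"
  shows "seq_wt x m = cscal (fact (\<Sum>s\<le>B. m s) / (\<Prod>s\<le>B. fact (m s))) * (\<Prod>s\<le>B. x s ^ m s)"
proof -
  have "(\<Sum>s | m s \<noteq> 0. m s) = (\<Sum>s\<le>B. m s)" "(\<Prod>s | m s \<noteq> 0. fact (m s)) = (\<Prod>s\<le>B. fact (m s) :: complex)"
    "(\<Prod>s | m s \<noteq> 0. x s ^ m s) = (\<Prod>s\<le>B. x s ^ m s)"
    using assms by (intro sum.mono_neutral_left prod.mono_neutral_left; auto)+
  then show ?thesis by (simp add: seq_wt_def multinomial_coeff_def)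
qed

text \<open>Pascal's rule for multinomial coefficients: words with \<open>m s\<close> letters
  \<open>s\<close> are sorted by their first letter.\<close>

lemma seq_wt_rec:
  assumes m: "{s. m s \<noteq> 0} \<subseteq> {..B}" and ne: "m s0 \<noteq> 0"
  shows "seq_wt x m = (\<Sum>s\<in>{s. s \<le> B \<and> m s \<noteq> 0}. x s * seq_wt x (m(s := m s - 1)))"
proof -
  let ?T = "\<Sum>s\<le>B. m s" and ?F = "\<Prod>s\<le>B. fact (m s) :: complex" and ?X = "\<Prod>s\<le>B. x s ^ m s"
  have "s0 \<le> B" using m ne by auto
  then have "m s0 \<le> ?T" by (intro member_le_sum) auto
  then obtain T where T: "?T = Suc T" using ne by (cases ?T) auto
  have F0: "?F \<noteq> 0" by simp
  have "x s * seq_wt x (m(s := m s - 1)) = cscal (of_nat (m s) * fact T / ?F) * ?X" if s: "s \<le> B" "m s \<noteq> 0" for s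
  proof -
    obtain k where k: "m s = Suc k" using s by (cases "m s") auto
    let ?m = "m(s := m s - 1)"
    have sub: "{s. ?m s \<noteq> 0} \<subseteq> {..B}" using m s by auto
    have rem: "finite {..B}" "s \<in> {..B}" using s by auto
    have "(\<Sum>s\<le>B. ?m s) = k + (\<Sum>i\<in>{..B} - {s}. m i)"
      by (subst sum.remove[OF rem]) (simp add: k)
    moreover have "?T = Suc k + (\<Sum>i\<in>{..B} - {s}. m i)"
      by (subst sum.remove[OF rem]) (simp add: k)
    ultimately have 1: "(\<Sum>s\<le>B. ?m s) = T" using T by simp
    have "(\<Prod>s\<le>B. fact (?m s) :: complex) = fact k * (\<Prod>i\<in>{..B} - {s}. fact (m i))"
      by (subst prod.remove[OF rem]) (simp add: k)
    moreover have "?F = of_nat (Suc k) * fact k * (\<Prod>i\<in>{..B} - {s}. fact (m i))"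
      by (subst prod.remove[OF rem]) (simp add: k)
    ultimately have 2: "?F = of_nat (m s) * (\<Prod>s\<le>B. fact (?m s))" by (simp add: k)
    have "(\<Prod>s\<le>B. x s ^ ?m s) = x s ^ k * (\<Prod>i\<in>{..B} - {s}. x i ^ m i)"
      by (subst prod.remove[OF rem]) (simp add: k)
    moreover have "?X = x s ^ Suc k * (\<Prod>i\<in>{..B} - {s}. x i ^ m i)"
      by (subst prod.remove[OF rem]) (simp add: k)
    ultimately have 3: "?X = x s * (\<Prod>s\<le>B. x s ^ ?m s)" by (simp add: mult.assoc)
    have "of_nat (m s) * fact T / ?F = fact T / (\<Prod>s\<le>B. fact (?m s))"
      unfolding 2 using s(2) by simp
    then show ?thesis
      unfolding seq_wt_eq[OF sub] 1 3 by (simp only: ac_simps)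
  qed
  then have "(\<Sum>s\<in>{s. s \<le> B \<and> m s \<noteq> 0}. x s * seq_wt x (m(s := m s - 1))) =
     (\<Sum>s\<in>{s. s \<le> B \<and> m s \<noteq> 0}. cscal (of_nat (m s) * fact T / ?F)) * ?X"
    by (simp add: sum_distrib_right)
  also have "(\<Sum>s\<in>{s. s \<le> B \<and> m s \<noteq> 0}. cscal (of_nat (m s) * fact T / ?F)) = (\<Sum>s\<le>B. cscal (of_nat (m s) * fact T / ?F) :: 'a)"
    by (intro sum.mono_neutral_left) auto
  also have "\<dots> = cscal (of_nat ?T * fact T / ?F)"
    by (simp add: cscal_sum[symmetric] sum_distrib_right sum_divide_distrib)
  also have "\<dots> * ?X = seq_wt x m"
    unfolding seq_wt_eq[OF m] T by simp
  finally show ?thesis ..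
qed

text \<open>A geometric series enumerates words by total size. Both sides satisfy the recursion that
  removes one letter \<open>s\<close>, on the right by \<open>seq_wt_rec\<close>.\<close>

theorem sum_mult_seqs:
  fixes x :: "nat \<Rightarrow> 'a::complex_algebra"
  assumes P: "P * (1 - Abs_fps (\<lambda>s. if s < 2 then 0 else x s)) = 1"
  shows "P $ N = (\<Sum>m\<in>mult_seqs N. seq_wt x m)"
proof (induction N rule: less_induct)
  case (less N)
  let ?T = "Abs_fps (\<lambda>s. if s < 2 then 0 else x s)"
  have P': "P = 1 + ?T * P" using P by (simp add: algebra_simps)
  show ?case
  proof (cases "N = 0")
    case True
    have "m = (\<lambda>_. 0)" if "m \<in> mult_seqs 0" for m
    proof
      fix s show "m s = 0"
        using that mult_seqs_iff[of 0 0 m] by (cases s) auto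
    qed
    then have "mult_seqs 0 = {\<lambda>_. 0}"
      by (auto simp: mult_seqs_def)
    moreover have "P $ 0 = 1" by (subst P') simp
    ultimately show ?thesis using True by (simp add: seq_wt_def multinomial_coeff_def)
  next
    case False
    have "P $ N = (\<Sum>s=0..N. ?T $ s * P $ (N - s))"
      using False by (subst P') (simp add: fps_mult_nth)
    also have "\<dots> = (\<Sum>s=2..N. x s * P $ (N - s))"
      by (intro sum.mono_neutral_cong_right) auto
    also have "\<dots> = (\<Sum>s=2..N. \<Sum>m\<in>mult_seqs (N - s). x s * seq_wt x m)"
      using less.IH by (intro sum.cong) (auto simp: sum_distrib_left)
    also have "\<dots> = (\<Sum>s=2..N. \<Sum>m | m \<in> mult_seqs N \<and> m s \<noteq> 0. x s * seq_wt x (m(s := m s - 1)))"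
    proof (rule sum.cong[OF refl])
      fix s assume s: "s \<in> {2..N}"
      have upd: "(\<Sum>i\<le>N. i * (m(s := c)) i) + s * m s = (\<Sum>i\<le>N. i * m i) + s * c" for m c
      proof -
        have rem: "finite {..N}" "s \<in> {..N}" using s by auto
        show ?thesis
          by (subst (1 2) sum.remove[OF rem]) simp
      qed
      note iffN = mult_seqs_iff[of N N, simplified] and iffs = mult_seqs_iff[of "N - s" N, simplified]
      show "(\<Sum>m\<in>mult_seqs (N - s). x s * seq_wt x m) =
        (\<Sum>m | m \<in> mult_seqs N \<and> m s \<noteq> 0. x s * seq_wt x (m(s := m s - 1)))"
      proof (rule sum.reindex_bij_witness[of _ "\<lambda>m. m(s := m s - 1)" "\<lambda>m. m(s := Suc (m s))"], goal_cases)
        case (2 m)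
        then show ?case using s upd[of m "Suc (m s)"] by (auto simp: iffN iffs)
      next
        case (4 m)
        then obtain k where "m s = Suc k" by (cases "m s") auto
        with 4 show ?case using s upd[of m "m s - 1"] by (auto simp: iffN iffs)
      qed auto
    qed
    also have "\<dots> = (\<Sum>m\<in>mult_seqs N. \<Sum>s\<in>{s \<in> {2..N}. m s \<noteq> 0}. x s * seq_wt x (m(s := m s - 1)))"
      by (rule sum.swap_restrict) (simp_all add: finite_mult_seqs)
    also have "\<dots> = (\<Sum>m\<in>mult_seqs N. seq_wt x m)"
    proof (intro sum.cong refl)
      fix m assume m: "m \<in> mult_seqs N"
      then have m': "m 0 = 0" "m 1 = 0" "\<forall>s>N. m s = 0" "(\<Sum>s\<le>N. s * m s) = N"
        using mult_seqs_iff[of N N] by auto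
      have "\<exists>s0. m s0 \<noteq> 0"
      proof (rule ccontr)
        assume "\<nexists>s0. m s0 \<noteq> 0"
        then show False using m'(4) False by simp
      qed
      then obtain s0 where s0: "m s0 \<noteq> 0" ..
      have sub: "{s. m s \<noteq> 0} \<subseteq> {..N}" using m'(3) by (rule support_atMost)
      have "{s \<in> {2..N}. m s \<noteq> 0} = {s. s \<le> N \<and> m s \<noteq> 0}"
      proof -
        have "2 \<le> s" if "m s \<noteq> 0" for s
          using that m'(1,2) by (cases "s = 0"; cases "s = 1") auto
        then show ?thesis by auto
      qed
      then show "(\<Sum>s\<in>{s \<in> {2..N}. m s \<noteq> 0}. x s * seq_wt x (m(s := m s - 1))) = seq_wt x m"
        by (simp only: seq_wt_rec[OF sub s0])
    qed
    finally show ?thesis .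
  qed
qed

section \<open>Jucys--Murphy elements in the semigroup algebra\<close>

lemma pp_supp_cycle [simp]: "pp_supp (cycle_pperm c) = set c"
  by transfer simp

lemma pp_perm_cycle [simp]: "pp_perm (cycle_pperm c) = cycle_of_list c"
  by transfer simp

lemma cycle_pperm_Cons: "cycle_pperm (b # c # cs) = cycle_pperm [b, c] + cycle_pperm (c # cs)"
  by (rule pp_eqI) auto

lemma single_central:
  fixes f :: "'a pp_alg"
  shows "Poly_Mapping.single 0 c * f = f * Poly_Mapping.single 0 c"
proof -
  have "Poly_Mapping.single 0 c * (\<Sum>p\<in>Poly_Mapping.keys f. Poly_Mapping.single p (Poly_Mapping.lookup f p)) =
      (\<Sum>p\<in>Poly_Mapping.keys f. Poly_Mapping.single p (Poly_Mapping.lookup f p)) * Poly_Mapping.single 0 c"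
    by (simp add: sum_distrib_left sum_distrib_right mult_single mult.commute)
  then show ?thesis by (simp only: pp_alg_sum_singles[symmetric])
qed

lemma single_eq_scale: "Poly_Mapping.single p c = Poly_Mapping.single 0 c * (Poly_Mapping.single p 1 :: 'a pp_alg)"
  by (simp add: mult_single)

lemma commute_if_commute_singles:
  fixes X :: "'a pp_alg"
  assumes X: "\<And>p. p \<in> Poly_Mapping.keys f \<Longrightarrow> X * Poly_Mapping.single p 1 = Poly_Mapping.single p 1 * X"
  shows "X * f = f * X"
proof -
  have "X * Poly_Mapping.single p c = Poly_Mapping.single p c * X" if "p \<in> Poly_Mapping.keys f" for p c
  proof -
    have "X * Poly_Mapping.single p c = Poly_Mapping.single 0 c * (X * Poly_Mapping.single p 1)"
      by (subst single_eq_scale) (simp only: mult.assoc[symmetric] single_central[of c X, symmetric])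
    also have "\<dots> = Poly_Mapping.single p c * X"
      by (subst (2) single_eq_scale) (simp only: mult.assoc X[OF that])
    finally show ?thesis .
  qed
  then have "X * (\<Sum>p\<in>Poly_Mapping.keys f. Poly_Mapping.single p (Poly_Mapping.lookup f p)) =
      (\<Sum>p\<in>Poly_Mapping.keys f. Poly_Mapping.single p (Poly_Mapping.lookup f p)) * X"
    by (simp add: sum_distrib_left sum_distrib_right)
  then show ?thesis by (simp only: pp_alg_sum_singles[symmetric])
qed

text \<open>The element ({b}, id): a central idempotent whose multiplication adds \<open>b\<close>
  to every support. It takes the place of 1 wherever \<open>b\<close> has to be in the
  support.\<close>

abbreviation pp_point :: "'a \<Rightarrow> 'a pp_alg" where
  "pp_point b \<equiv> Poly_Mapping.single (cycle_pperm [b]) 1"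

abbreviation pp_swap :: "'a \<Rightarrow> 'a \<Rightarrow> 'a pp_alg" where
  "pp_swap b c \<equiv> Poly_Mapping.single (cycle_pperm [b, c]) 1"

lemma pp_point_central: "pp_point b * f = f * pp_point b"
  by (rule commute_if_commute_singles) (auto simp: mult_single intro!: arg_cong2[of _ _ _ _ Poly_Mapping.single] pp_eqI)

lemma pp_point_idem: "pp_point b * pp_point b = pp_point b"
  by (auto simp: mult_single intro!: arg_cong2[of _ _ _ _ Poly_Mapping.single] pp_eqI)

lemma pp_swap_commute: "pp_swap b c = pp_swap c b"
  by (auto simp: intro!: arg_cong2[of _ _ _ _ Poly_Mapping.single] pp_eqI transpose_commute)

lemma pp_swap_square: "pp_swap b c * pp_swap b c = pp_point b * pp_point c"
  by (auto simp: mult_single intro!: arg_cong2[of _ _ _ _ Poly_Mapping.single] pp_eqI)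

lemma pp_point_point_central: "pp_point b * pp_point c * f = f * (pp_point b * pp_point c)"
  by (simp only: mult.assoc pp_point_central[of c f]) (simp only: mult.assoc[symmetric] pp_point_central[of b f])

lemma pp_point_point_mult: "x * y * (pp_point b * pp_point c) = (pp_point b * x) * (pp_point c * y)"
proof -
  have "x * y * (pp_point b * pp_point c) = pp_point b * pp_point c * (x * y)"
    by (rule pp_point_point_central[symmetric])
  also have "\<dots> = pp_point b * (pp_point c * x) * y"
    by (simp only: mult.assoc)
  also have "\<dots> = (pp_point b * x) * (pp_point c * y)"
    by (simp only: pp_point_central[of c x] mult.assoc)
  finally show ?thesis .
qed

lemma pp_swap_point: "pp_swap b c * pp_point b = pp_swap b c" "pp_swap b c * pp_point c = pp_swap b c"
  by (auto simp: mult_single intro!: arg_cong2[of _ _ _ _ Poly_Mapping.single] pp_eqI)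

lemma pp_point_swap: "pp_point b * pp_swap b c = pp_swap b c" "pp_point c * pp_swap b c = pp_swap b c"
  by (auto simp: mult_single intro!: arg_cong2[of _ _ _ _ Poly_Mapping.single] pp_eqI)

definition jm_elem :: "'a set \<Rightarrow> 'a \<Rightarrow> 'a pp_alg" where
  "jm_elem A b = (\<Sum>a\<in>A. pp_swap b a)"

lemma pp_point_jm_elem: "pp_point b * jm_elem A b = jm_elem A b"
  by (simp add: jm_elem_def sum_distrib_left pp_point_swap)

text \<open>Conjugation by \<open>p\<close> fixes \<open>b\<close> and permutes the transpositions
  of \<open>b\<close> with points of \<open>A\<close>. Supports agree because a point moved by
  \<open>p\<close> is in the support of \<open>p\<close>, together with its image.\<close>

lemma jm_elem_commute_single:
  assumes b: "b \<notin> A" and p: "pp_supp p \<subseteq> A"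
  shows "jm_elem A b * Poly_Mapping.single p 1 = Poly_Mapping.single p 1 * jm_elem A b"
proof -
  let ?w = "pp_perm p"
  have w: "?w permutes A" by (rule permutes_subset[OF pp_perm_permutes p])
  have wb: "?w b = b" using w b by (rule permutes_not_in)
  have *: "cycle_pperm [b, ?w a] + p = p + cycle_pperm [b, a]" for a
  proof (rule pp_eqI)
    have "?w a \<in> pp_supp p \<longleftrightarrow> a \<in> pp_supp p" "a \<notin> pp_supp p \<Longrightarrow> ?w a = a"
      using pp_perm_permutes[of p] by (auto simp: permutes_in_image permutes_not_in)
    then show "pp_supp (cycle_pperm [b, ?w a] + p) = pp_supp (p + cycle_pperm [b, a])"
      by (cases "a \<in> pp_supp p") auto
    show "pp_perm (cycle_pperm [b, ?w a] + p) = pp_perm (p + cycle_pperm [b, a])"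
    proof
      fix x
      have "?w x = ?w y \<longleftrightarrow> x = y" for y
        by (rule inj_eq[OF permutes_inj[OF w]])
      from this[of a] this[of b] have "transpose b (?w a) (?w x) = ?w (transpose b a x)"
        unfolding wb by (simp add: transpose_def wb)
      then show "pp_perm (cycle_pperm [b, ?w a] + p) x = pp_perm (p + cycle_pperm [b, a]) x"
        by simp
    qed
  qed
  have "jm_elem A b * Poly_Mapping.single p 1 = (\<Sum>a\<in>A. Poly_Mapping.single (cycle_pperm [b, a] + p) 1)"
    by (simp add: jm_elem_def sum_distrib_right mult_single)
  also have "\<dots> = (\<Sum>a\<in>A. Poly_Mapping.single (cycle_pperm [b, ?w a] + p) 1)"
    by (rule sum.reindex_bij_betw[OF permutes_imp_bij[OF w], symmetric])
  also have "\<dots> = Poly_Mapping.single p 1 * jm_elem A b"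
    by (simp add: jm_elem_def sum_distrib_left mult_single *)
  finally show ?thesis .
qed

lemma jm_elem_commute: "b \<notin> A \<Longrightarrow> f \<in> pp_alg_on A \<Longrightarrow> jm_elem A b * f = f * jm_elem A b"
  by (rule commute_if_commute_singles, rule jm_elem_commute_single) (auto simp: pp_alg_on_def)

lemma jm_moment_on_commute: "f \<in> pp_alg_on A \<Longrightarrow> jm_moment_on A k * f = f * jm_moment_on A k"
  by (rule commute_if_commute_singles, rule jm_moment_on_commute_single) (auto simp: pp_alg_on_def)

lemma pp_alg_on_mono: "A \<subseteq> B \<Longrightarrow> f \<in> pp_alg_on A \<Longrightarrow> f \<in> pp_alg_on B"
  by (auto simp: pp_alg_on_def)

lemma pp_alg_on_sum: "(\<And>i. i \<in> I \<Longrightarrow> f i \<in> pp_alg_on A) \<Longrightarrow> sum f I \<in> pp_alg_on A"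
  by (simp add: pp_alg_on_iff_theta pp_theta_sum)

lemma pp_alg_on_single: "pp_supp p \<subseteq> A \<Longrightarrow> Poly_Mapping.single p c \<in> pp_alg_on A"
  by (simp add: pp_alg_on_iff_theta pp_theta_single)

lemma pp_alg_on_mult: "f \<in> pp_alg_on A \<Longrightarrow> g \<in> pp_alg_on A \<Longrightarrow> f * g \<in> pp_alg_on A"
  by (simp add: pp_alg_on_iff_theta pp_theta_mult)

lemma jm_elem_in: "jm_elem A b \<in> pp_alg_on (insert b A)"
  unfolding jm_elem_def by (intro pp_alg_on_sum pp_alg_on_single) auto

lemma jm_moment_on_in: "jm_moment_on A k \<in> pp_alg_on A"
  unfolding jm_moment_on_def by (intro pp_alg_on_sum pp_alg_on_single) (auto simp: jm_tuples_def pp_supp_jm)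

subsection \<open>Relations between Jucys--Murphy elements\<close>

text \<open>
  The power with exponent \<open>0\<close> is \<open>pp_point b\<close>, so that \<open>b\<close> always belongs to the support.
  \<open>jm_trace m A\<close> is the Boolean cumulant of degree \<open>m + 2\<close> of the moments over \<open>A\<close>.
\<close>

definition jm_pow :: "'a set \<Rightarrow> 'a \<Rightarrow> nat \<Rightarrow> 'a pp_alg" where
  "jm_pow A b m = pp_point b * jm_elem A b ^ m"

definition jm_trace :: "nat \<Rightarrow> 'a set \<Rightarrow> 'a pp_alg" where
  "jm_trace m A = (\<Sum>c\<in>A. jm_pow (A - {c}) c m)"

context
  fixes A :: "'a set" and b c :: 'a
  assumes fin: "finite A" and b: "b \<notin> A" and c: "c \<in> A"
begin

private abbreviation "Jb \<equiv> jm_elem A b"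
private abbreviation "Jc \<equiv> jm_elem (A - {c}) c"
private abbreviation "s \<equiv> pp_swap b c"
private abbreviation "E \<equiv> pp_point b * pp_point c"

text \<open>(b c)(c a) = (b a)(b c) for \<open>a\<close> other than \<open>c\<close>; the summand (b
  c) of \<open>Jb\<close> has no counterpart in \<open>Jc\<close> and contributes its square
  \<open>E\<close>.\<close>

lemma pp_swap_jm_elem: "s * Jc = Jb * s - E"
proof -
  have "pp_swap b a * s = s * pp_swap c a" if "a \<in> A - {c}" for a
    using that b c by (auto simp: mult_single fun_eq_iff transpose_def intro!: arg_cong2[of _ _ _ _ Poly_Mapping.single] pp_eqI)
  then have "(\<Sum>a\<in>A - {c}. pp_swap b a * s) = s * Jc"
    by (simp add: jm_elem_def sum_distrib_left)
  moreover have "Jb * s = pp_swap b c * s + (\<Sum>a\<in>A - {c}. pp_swap b a * s)"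
    by (simp add: jm_elem_def distrib_right sum_distrib_right sum.remove[OF fin c])
  ultimately show ?thesis by (simp add: pp_swap_square)
qed

lemma jm_elem_swap: "Jc * s = s * Jb - E"
proof -
  have "s * pp_swap b a = pp_swap c a * s" if "a \<in> A - {c}" for a
    using that b c by (auto simp: mult_single fun_eq_iff transpose_def intro!: arg_cong2[of _ _ _ _ Poly_Mapping.single] pp_eqI)
  then have "(\<Sum>a\<in>A - {c}. s * pp_swap b a) = Jc * s"
    by (simp add: jm_elem_def sum_distrib_right)
  moreover have "s * Jb = s * pp_swap b c + (\<Sum>a\<in>A - {c}. s * pp_swap b a)"
    by (simp add: jm_elem_def distrib_left sum_distrib_left sum.remove[OF fin c])
  ultimately show ?thesis by (simp add: pp_swap_square)
qed

lemma jm_elem_commute_jm_elem: "Jb * Jc = Jc * Jb"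
proof -
  have "Jc \<in> pp_alg_on A"
    using jm_elem_in[of "A - {c}" c] c by (simp add: insert_absorb)
  then show ?thesis by (rule jm_elem_commute[OF b])
qed

text \<open>The sum is the divided difference of the m-th power at the commuting elements
  \<open>Jb\<close> and \<open>Jc\<close>.\<close>

lemma pp_swap_jm_elem_power: "s * Jc ^ m = Jb ^ m * s - (\<Sum>i<m. Jb ^ i * Jc ^ (m - 1 - i)) * E"
proof (induction m)
  case 0
  show ?case by (simp add: pp_point_swap)
next
  case (Suc m)
  have "s * Jc ^ Suc m = (s * Jc ^ m) * Jc"
    by (simp only: power_Suc2 mult.assoc)
  also have "\<dots> = Jb ^ m * (s * Jc) - (\<Sum>i<m. Jb ^ i * Jc ^ (m - 1 - i)) * Jc * E"
    by (simp only: Suc.IH left_diff_distrib mult.assoc pp_point_point_central[of b c Jc, simplified mult.assoc])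
  also have "(\<Sum>i<m. Jb ^ i * Jc ^ (m - 1 - i)) * Jc = (\<Sum>i<m. Jb ^ i * Jc ^ (m - i))"
    unfolding sum_distrib_right by (intro sum.cong refl) (simp add: mult.assoc Suc_diff_Suc flip: power_Suc2)
  also have "Jb ^ m * (s * Jc) = Jb ^ Suc m * s - Jb ^ m * E"
    by (simp only: pp_swap_jm_elem right_diff_distrib power_Suc2 mult.assoc)
  finally show ?case by (simp add: algebra_simps)
qed

lemma jm_elem_insert: "jm_elem (insert b A - {c}) c = Jc + s"
proof -
  have "insert b A - {c} = insert b (A - {c})" using b c by auto
  then show ?thesis using fin b by (simp add: jm_elem_def pp_swap_commute[of c b] add.commute)
qed

text \<open>\<open>L = Jc + s\<close> satisfies \<open>L s = s Jb\<close>, because the two terms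
  \<open>E\<close> cancel. As \<open>E\<close> is the square of \<open>s\<close>, this gives
  \<open>L^m E = s Jb^m s\<close>, which is expanded by moving \<open>s\<close> through powers
  twice.\<close>

lemma jm_elem_insert_power: "jm_elem (insert b A - {c}) c ^ m * E =
    Jc ^ m * E + (\<Sum>i<m. (Jb ^ (m - 1 - i) * s - (\<Sum>j<m - 1 - i. Jb ^ j * Jc ^ (m - 1 - i - 1 - j)) * E) * Jb ^ i)"
proof -
  define L where "L = jm_elem (insert b A - {c}) c"
  have Ls: "L * s = s * Jb"
    unfolding L_def jm_elem_insert by (simp add: distrib_right jm_elem_swap pp_swap_square)
  have Lms: "L ^ m * s = s * Jb ^ m" for m
    by (induction m) (simp_all add: mult.assoc Ls power_Suc2 del: power_Suc, simp_all add: mult.assoc[symmetric])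
  have Jbs: "Jb ^ m * s = s * Jc ^ m + (\<Sum>i<m. Jb ^ i * Jc ^ (m - 1 - i)) * E"
    by (simp add: pp_swap_jm_elem_power)
  have com: "Jb ^ i * Jc ^ j = Jc ^ j * Jb ^ i" for i j
    by (rule power_commuting_commutes[OF power_commuting_commutes[OF jm_elem_commute_jm_elem, symmetric], symmetric])
  have sE: "s * (x * E) = s * x" for x
  proof -
    have "s * (x * E) = E * (s * x)"
      by (simp only: pp_point_point_central[of b c "s * x"] mult.assoc[of s])
    also have "\<dots> = pp_point b * (pp_point c * s) * x"
      by (simp only: mult.assoc)
    finally show ?thesis by (simp only: pp_point_swap)
  qed
  have "L ^ m * E = (L ^ m * s) * s"
    by (simp add: mult.assoc pp_swap_square)
  also have "\<dots> = s * (Jb ^ m * s)" by (simp add: Lms mult.assoc)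
  also have "\<dots> = (s * s) * Jc ^ m + s * (\<Sum>i<m. Jb ^ i * Jc ^ (m - 1 - i)) * E"
    by (simp only: Jbs distrib_left mult.assoc)
  also have "s * (\<Sum>i<m. Jb ^ i * Jc ^ (m - 1 - i)) = (\<Sum>i<m. (s * Jc ^ (m - 1 - i)) * Jb ^ i)"
    by (simp add: sum_distrib_left com mult.assoc)
  also have "\<dots> * E = (\<Sum>i<m. (s * Jc ^ (m - 1 - i)) * Jb ^ i)"
    unfolding sum_distrib_right by (simp only: mult.assoc[of s] sE)
  finally show ?thesis
    by (simp only: pp_swap_jm_elem_power L_def pp_swap_square pp_point_point_central)
qed

end

text \<open>Summation over \<open>c\<close> turns the powers of its Jucys--Murphy element into
  traces, which are minus the coefficients of H. \<open>box_val_poly_part\<close> recognizes the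
  result as a polynomial part at the element of \<open>b\<close>.\<close>

theorem sum_swap_jm_pow:
  assumes fin: "finite A" and b: "b \<notin> A"
  shows "(\<Sum>c\<in>A. pp_swap b c * jm_pow (A - {c}) c m) =
    jm_pow A b (Suc m) - (\<Sum>i<m. jm_pow A b i * jm_trace (m - 1 - i) A)"
proof -
  have "pp_swap b c * jm_pow (A - {c}) c m = jm_pow A b m * pp_swap b c - (\<Sum>i<m. jm_pow A b i * jm_pow (A - {c}) c (m - 1 - i))"
    if "c \<in> A" for c
  proof -
    have "pp_swap b c * jm_pow (A - {c}) c m = pp_swap b c * jm_elem (A - {c}) c ^ m"
      by (simp only: jm_pow_def mult.assoc[symmetric] pp_swap_point)
    also have "\<dots> = jm_elem A b ^ m * (pp_point b * pp_swap b c) - (\<Sum>i<m. jm_elem A b ^ i * jm_elem (A - {c}) c ^ (m - 1 - i)) * (pp_point b * pp_point c)"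
      by (simp only: pp_swap_jm_elem_power[OF fin b that] pp_point_swap)
    also have "\<dots> = jm_pow A b m * pp_swap b c - (\<Sum>i<m. jm_pow A b i * jm_pow (A - {c}) c (m - 1 - i))"
      unfolding sum_distrib_right pp_point_point_mult jm_pow_def
      by (simp only: pp_point_central[of b "jm_elem A b ^ m"] mult.assoc)
    finally show ?thesis .
  qed
  then have "(\<Sum>c\<in>A. pp_swap b c * jm_pow (A - {c}) c m) =
    jm_pow A b m * (\<Sum>c\<in>A. pp_swap b c) - (\<Sum>c\<in>A. \<Sum>i<m. jm_pow A b i * jm_pow (A - {c}) c (m - 1 - i))"
    by (simp add: sum_subtractf sum_distrib_left)
  also have "(\<Sum>c\<in>A. \<Sum>i<m. jm_pow A b i * jm_pow (A - {c}) c (m - 1 - i)) =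
    (\<Sum>i<m. jm_pow A b i * jm_trace (m - 1 - i) A)"
    by (subst sum.swap) (simp add: jm_trace_def sum_distrib_left)
  also have "jm_pow A b m * (\<Sum>c\<in>A. pp_swap b c) = jm_pow A b (Suc m)"
    by (simp add: jm_pow_def jm_elem_def[symmetric] mult.assoc power_Suc2 del: power_Suc)
  finally show ?thesis .
qed

text \<open>The coefficient form of multiplying H by 1 - (z - x)^-2. Of the \<open>Suc m\<close>
  copies of \<open>jm_pow A b m\<close>, one is the new summand for \<open>b\<close>, and the
  \<open>m\<close> positions of a single transposition (b c) give the others after summation over
  \<open>c\<close>.\<close>

theorem jm_trace_insert:
  assumes fin: "finite A" and b: "b \<notin> A"
  shows "pp_point b * jm_trace m (insert b A) = of_nat (Suc m) * jm_pow A b m + pp_point b * jm_trace m A -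
    (\<Sum>i<m. \<Sum>j<m - 1 - i. jm_pow A b (i + j) * jm_trace (m - 1 - i - 1 - j) A)"
proof -
  let ?J = "jm_elem A b"
  have P: "pp_point b * (pp_point b * f) = pp_point b * f" for f by (metis mult.assoc pp_point_idem)
  have 1: "pp_point b * jm_pow (insert b A - {c}) c m = pp_point b * jm_pow (A - {c}) c m +
     (\<Sum>i<m. ?J ^ (m - 1 - i) * pp_swap b c * ?J ^ i) -
     (\<Sum>i<m. \<Sum>j<m - 1 - i. jm_pow A b (i + j) * jm_pow (A - {c}) c (m - 1 - i - 1 - j))" if c: "c \<in> A" for c
  proof -
    let ?K = "jm_elem (A - {c}) c"
    have com: "?J ^ i * ?K ^ j = ?K ^ j * ?J ^ i" for i j
      by (rule power_commuting_commutes[OF power_commuting_commutes[OF jm_elem_commute_jm_elem[OF fin b c], symmetric], symmetric])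
    have "(\<Sum>j<m - 1 - i. ?J ^ j * ?K ^ (m - 1 - i - 1 - j)) * (pp_point b * pp_point c) * ?J ^ i =
       (\<Sum>j<m - 1 - i. jm_pow A b (i + j) * jm_pow (A - {c}) c (m - 1 - i - 1 - j))" for i
    proof -
      have "?J ^ j * ?K ^ l * (pp_point b * pp_point c) * ?J ^ i = jm_pow A b (i + j) * jm_pow (A - {c}) c l" for j l
      proof -
        have "?J ^ j * ?K ^ l * (pp_point b * pp_point c) * ?J ^ i = ?J ^ j * (?K ^ l * ?J ^ i) * (pp_point b * pp_point c)"
          by (simp only: mult.assoc pp_point_point_central[of b c "?J ^ i", unfolded mult.assoc])
        also have "\<dots> = ?J ^ (i + j) * ?K ^ l * (pp_point b * pp_point c)"
          by (simp only: com[symmetric] mult.assoc[symmetric] power_add[symmetric] add.commute)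
        finally show ?thesis unfolding jm_pow_def by (simp only: pp_point_point_mult)
      qed
      then show ?thesis by (simp only: sum_distrib_right)
    qed
    then have "jm_elem (insert b A - {c}) c ^ m * (pp_point b * pp_point c) =
      ?K ^ m * (pp_point b * pp_point c) + (\<Sum>i<m. ?J ^ (m - 1 - i) * pp_swap b c * ?J ^ i) -
       (\<Sum>i<m. \<Sum>j<m - 1 - i. jm_pow A b (i + j) * jm_pow (A - {c}) c (m - 1 - i - 1 - j))"
      unfolding jm_elem_insert_power[OF fin b c]
      by (simp only: left_diff_distrib sum_subtractf) (simp add: algebra_simps)
    moreover have "f * (pp_point b * pp_point c) = pp_point b * (pp_point c * f)" for f
      by (simp only: pp_point_point_central[symmetric] mult.assoc)
    ultimately show ?thesis by (simp only: jm_pow_def)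
  qed
  have ins: "insert b A - {b} = A" using b by simp
  have sw: "(\<Sum>c\<in>A. \<Sum>i<m. ?J ^ (m - 1 - i) * pp_swap b c * ?J ^ i) = of_nat m * jm_pow A b m"
  proof -
    have "(\<Sum>c\<in>A. \<Sum>i<m. ?J ^ (m - 1 - i) * pp_swap b c * ?J ^ i) = (\<Sum>i<m. ?J ^ (m - 1 - i) * ?J * ?J ^ i)"
      by (subst sum.swap) (simp add: jm_elem_def sum_distrib_left sum_distrib_right)
    also have "\<dots> = (\<Sum>i<m. jm_pow A b m)"
    proof (intro sum.cong refl)
      fix i assume "i \<in> {..<m}"
      then obtain d where d: "m = Suc (i + d)" by (auto dest: less_imp_Suc_add)
      have "?J ^ d * ?J * ?J ^ i = ?J ^ (d + 1 + i)"
        by (simp only: power_add power_one_right)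
      then have "?J ^ (m - 1 - i) * ?J * ?J ^ i = ?J ^ m" and "m \<noteq> 0"
        by (simp_all add: d add.commute del: power_Suc)
      then show "?J ^ (m - 1 - i) * ?J * ?J ^ i = jm_pow A b m"
        unfolding jm_pow_def by (cases m) (simp_all add: mult.assoc[symmetric] pp_point_jm_elem)
    qed
    finally show ?thesis by simp
  qed
  have sw2: "(\<Sum>c\<in>A. \<Sum>i<m. \<Sum>j<m - 1 - i. jm_pow A b (i + j) * jm_pow (A - {c}) c (m - 1 - i - 1 - j)) =
     (\<Sum>i<m. \<Sum>j<m - 1 - i. jm_pow A b (i + j) * jm_trace (m - 1 - i - 1 - j) A)"
    unfolding jm_trace_def sum_distrib_left
    by (subst sum.swap, intro sum.cong refl, subst sum.swap) simp
  have "pp_point b * jm_trace m (insert b A) = pp_point b * jm_pow A b m + (\<Sum>c\<in>A. pp_point b * jm_pow (insert b A - {c}) c m)"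
    using fin b by (simp add: jm_trace_def ins distrib_left sum_distrib_left)
  also have "\<dots> = jm_pow A b m + (pp_point b * jm_trace m A + of_nat m * jm_pow A b m -
     (\<Sum>i<m. \<Sum>j<m - 1 - i. jm_pow A b (i + j) * jm_trace (m - 1 - i - 1 - j) A))"
    unfolding sw[symmetric] sw2[symmetric]
    by (simp add: 1 sum.distrib sum_subtractf jm_trace_def sum_distrib_left) (simp add: jm_pow_def P)
  finally show ?thesis by (simp add: algebra_simps)
qed

subsection \<open>First returns\<close>

lemma jm_perm_Nil [simp]: "jm_perm [] = id"
  by (simp add: jm_perm_def)

lemma jm_perm_Cons: "jm_perm (a # as) = transpose (Some a) None \<circ> jm_perm as"
  by (simp add: jm_perm_def)

lemma jm_perm_append: "jm_perm (as @ bs) = jm_perm as \<circ> jm_perm bs"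
  by (induction as) (simp_all add: jm_perm_Cons o_assoc)

lemma jm_perm_not_in: "c \<notin> set as \<Longrightarrow> jm_perm as (Some c) = Some c"
  by (rule permutes_not_in[OF jm_perm_permutes]) auto

text \<open>The head \<open>c\<close> requires that \<open>as\<close> send the star to
  \<open>c\<close>. The stretch \<open>mid\<close> before the next \<open>c\<close> fixes
  \<open>c\<close>, so by injectivity \<open>c # post\<close> already sends the star to
  \<open>c\<close>, and \<open>post\<close> fixes the star.\<close>

lemma jm_perm_first_return:
  "jm_perm (c # as) None = None \<longleftrightarrow>
     (\<exists>mid post. as = mid @ c # post \<and> c \<notin> set mid \<and> jm_perm post None = None)"
proof
  assume "jm_perm (c # as) None = None"
  then have *: "jm_perm as None = Some c"
    by (auto simp: jm_perm_Cons transpose_eq_iff)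
  have "c \<in> set as"
  proof (rule ccontr)
    assume "c \<notin> set as"
    then have "jm_perm as (Some c) = jm_perm as None"
      by (simp add: jm_perm_not_in *)
    then show False using permutes_inj[OF jm_perm_permutes, of as] by (auto dest: injD)
  qed
  then obtain mid post where as: "as = mid @ c # post" "c \<notin> set mid"
    by (metis split_list_first)
  have "jm_perm mid (jm_perm (c # post) None) = jm_perm mid (Some c)"
    using * as by (simp add: jm_perm_append jm_perm_not_in)
  then have "jm_perm (c # post) None = Some c"
    using permutes_inj[OF jm_perm_permutes, of mid] by (auto dest: injD)
  then have "jm_perm post None = None"
    by (auto simp: jm_perm_Cons transpose_eq_iff)
  with as show "\<exists>mid post. as = mid @ c # post \<and> c \<notin> set mid \<and> jm_perm post None = None"
    by blast
next
  assume "\<exists>mid post. as = mid @ c # post \<and> c \<notin> set mid \<and> jm_perm post None = None"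
  then show "jm_perm (c # as) None = None"
    by (auto simp: jm_perm_Cons jm_perm_append jm_perm_not_in)
qed

lemma pp_supp_sum_list: "pp_supp (sum_list (map (\<lambda>a. cycle_pperm [c, a]) mid)) = (if mid = [] then {} else insert c (set mid))"
  by (induction mid) auto

text \<open>Conjugation by (c star) turns each (a star) with \<open>a\<close> other than
  \<open>c\<close> into (c a).\<close>

lemma jm_perm_excursion:
  assumes "c \<notin> set mid"
  shows "transpose (Some c) None (jm_perm mid (transpose (Some c) None (Some y))) =
     Some (pp_perm (sum_list (map (\<lambda>a. cycle_pperm [c, a]) mid)) y)"
  using assms
proof (induction mid)
  case (Cons a mid)
  have *: "transpose (Some c) None (transpose (Some a) None (transpose (Some c) None (Some w))) = Some (transpose c a w)" for w
    using Cons.prems by (auto simp: transpose_def)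
  define X where "X = jm_perm mid (transpose (Some c) None (Some y))"
  define w where "w = pp_perm (sum_list (map (\<lambda>a. cycle_pperm [c, a]) mid)) y"
  have "transpose (Some c) None X = Some w"
    using Cons by (simp add: X_def w_def)
  then have "X = transpose (Some c) None (Some w)"
    by (metis transpose_involutory)
  then show ?case using * by (simp add: jm_perm_Cons flip: X_def w_def)
qed simp

text \<open>The term \<open>cycle_pperm [c]\<close> keeps \<open>c\<close> in the support when
  \<open>mid\<close> is empty.\<close>

lemma jm_pperm_first_return:
  assumes c: "c \<notin> set mid" and N: "jm_perm post None = None"
  shows "jm_pperm (c # mid @ c # post) =
    cycle_pperm [c] + sum_list (map (\<lambda>a. cycle_pperm [c, a]) mid) + jm_pperm post"
proof (rule pp_eqI)
  have N': "jm_perm (c # mid @ c # post) None = None"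
    by (subst jm_perm_first_return, intro exI[of _ mid] exI[of _ post] conjI refl c N)
  show "pp_supp (jm_pperm (c # mid @ c # post)) =
     pp_supp (cycle_pperm [c] + sum_list (map (\<lambda>a. cycle_pperm [c, a]) mid) + jm_pperm post)"
    by (auto simp: pp_supp_jm[OF N] pp_supp_jm[OF N'] pp_supp_sum_list)
  show "pp_perm (jm_pperm (c # mid @ c # post)) =
     pp_perm (cycle_pperm [c] + sum_list (map (\<lambda>a. cycle_pperm [c, a]) mid) + jm_pperm post)"
  proof
    fix x
    have "Some (pp_perm (jm_pperm (c # mid @ c # post)) x) =
        transpose (Some c) None (jm_perm mid (transpose (Some c) None (jm_perm post (Some x))))"
      unfolding pp_perm_jm[OF N'] by (simp add: jm_perm_Cons jm_perm_append)
    also have "\<dots> = Some (pp_perm (sum_list (map (\<lambda>a. cycle_pperm [c, a]) mid)) (pp_perm (jm_pperm post) x))"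
      unfolding pp_perm_jm[OF N, symmetric] jm_perm_excursion[OF c] ..
    finally show "pp_perm (jm_pperm (c # mid @ c # post)) x =
       pp_perm (cycle_pperm [c] + sum_list (map (\<lambda>a. cycle_pperm [c, a]) mid) + jm_pperm post) x"
      by simp
  qed
qed

lemma sum_single_power:
  assumes "finite A"
  shows "(\<Sum>a\<in>A. Poly_Mapping.single (g a) (1::complex)) ^ m =
    (\<Sum>xs | set xs \<subseteq> A \<and> length xs = m. Poly_Mapping.single (sum_list (map g xs) :: 'b pperm) 1)"
proof (induction m)
  case 0
  have "{xs. set xs \<subseteq> A \<and> xs = []} = {[]}" by auto
  then show ?case by simp
next
  case (Suc m)
  let ?L = "{xs. set xs \<subseteq> A \<and> length xs = m}"
  have "(\<Sum>a\<in>A. Poly_Mapping.single (g a) (1::complex)) ^ Suc m =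
     (\<Sum>a\<in>A. \<Sum>xs\<in>?L. Poly_Mapping.single (g a + sum_list (map g xs)) 1)"
    by (simp add: Suc.IH sum_product mult_single)
  also have "\<dots> = (\<Sum>(a, xs)\<in>A \<times> ?L. Poly_Mapping.single (sum_list (map g (a # xs))) 1)"
    by (simp add: sum.cartesian_product)
  also have "\<dots> = (\<Sum>xs | set xs \<subseteq> A \<and> length xs = Suc m. Poly_Mapping.single (sum_list (map g xs)) 1)"
    by (intro sum.reindex_bij_witness[of _ "\<lambda>xs. (hd xs, tl xs)" "\<lambda>(a, xs). a # xs"])
       (auto simp: length_Suc_conv)
  finally show ?case .
qed

lemma jm_pow_expand:
  assumes "finite A"
  shows "jm_pow A b m = (\<Sum>xs | set xs \<subseteq> A \<and> length xs = m.
    Poly_Mapping.single (cycle_pperm [b] + sum_list (map (\<lambda>a. cycle_pperm [b, a]) xs)) 1)"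
  unfolding jm_pow_def jm_elem_def sum_single_power[OF assms]
  by (simp add: sum_distrib_left mult_single)

lemma jm_moment_on_0: "jm_moment_on A 0 = 1"
proof -
  have "jm_tuples 0 A = {[]}" by (auto simp: jm_tuples_def)
  moreover have "jm_pperm [] = (0 :: 'a pperm)"
  proof (rule pp_eqI)
    show "pp_perm (jm_pperm []) = pp_perm (0 :: 'a pperm)"
      using pp_perm_jm[of "[] :: 'a list"] by (intro ext) simp
  qed (simp add: pp_supp_jm)
  ultimately show ?thesis by (simp add: jm_moment_on_def)
qed

text \<open>The relation between moments and Boolean cumulants. A tuple splits into its first letter
  \<open>c\<close>, the \<open>m\<close> letters up to the next \<open>c\<close>, and a shorter
  tuple; the two letters \<open>c\<close> account for the length \<open>n - 1 - m\<close> of the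
  last part.\<close>

theorem jm_moment_on_Suc:
  assumes fin: "finite A"
  shows "jm_moment_on A (Suc n) = (\<Sum>m<n. jm_trace m A * jm_moment_on A (n - 1 - m))"
proof -
  define L where "L c m = {xs. set xs \<subseteq> A - {c} \<and> length xs = m}" for c m
  define I where "I = Sigma {..<n} (\<lambda>m. Sigma A (\<lambda>c. L c m \<times> jm_tuples (n - 1 - m) A))"
  define F where "F = (\<lambda>(m :: nat, c :: 'a, mid, post). c # mid @ c # post)"
  have notin: "c \<notin> set mid" if "mid \<in> L c m" for c m mid
    using that by (auto simp: L_def)
  have finL: "finite (L c m)" for c m
    unfolding L_def using fin by (intro finite_lists_length_eq) auto
  have "inj_on F I"
  proof (rule inj_on_inverseI[where g = "\<lambda>as. (length (takeWhile (\<lambda>a. a \<noteq> hd as) (tl as)), hd as,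
      takeWhile (\<lambda>a. a \<noteq> hd as) (tl as), tl (dropWhile (\<lambda>a. a \<noteq> hd as) (tl as)))"])
    fix p assume "p \<in> I"
    then obtain m c mid post where p: "p = (m, c, mid, post)" "c \<notin> set mid" "length mid = m"
      using notin by (force simp: I_def L_def)
    have "takeWhile (\<lambda>a. a \<noteq> c) (mid @ c # post) = mid" "dropWhile (\<lambda>a. a \<noteq> c) (mid @ c # post) = c # post"
      using p(2) by (auto simp: takeWhile_append dropWhile_append)
    then show "(length (takeWhile (\<lambda>a. a \<noteq> hd (F p)) (tl (F p))), hd (F p),
      takeWhile (\<lambda>a. a \<noteq> hd (F p)) (tl (F p)), tl (dropWhile (\<lambda>a. a \<noteq> hd (F p)) (tl (F p)))) = p"
      using p by (simp add: F_def)
  qed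
  moreover have "F ` I = jm_tuples (Suc n) A"
  proof (intro equalityI subsetI)
    fix as assume "as \<in> F ` I"
    then obtain m c mid post where "m < n" "c \<in> A" "mid \<in> L c m" "post \<in> jm_tuples (n - 1 - m) A"
      and as: "as = c # mid @ c # post" by (auto simp: I_def F_def)
    moreover from this have "jm_perm as None = None"
      unfolding as by (subst jm_perm_first_return, intro exI[of _ mid] exI[of _ post] conjI refl notin[of mid c m])
        (auto simp: jm_tuples_def)
    ultimately show "as \<in> jm_tuples (Suc n) A" by (auto simp: L_def jm_tuples_def)
  next
    fix as assume as: "as \<in> jm_tuples (Suc n) A"
    then obtain c as' where as': "as = c # as'" by (auto simp: jm_tuples_def length_Suc_conv)
    with as obtain mid post where mp: "as' = mid @ c # post" "c \<notin> set mid" "jm_perm post None = None"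
      using jm_perm_first_return[of c as'] by (auto simp: jm_tuples_def)
    with as as' have "(length mid, c, mid, post) \<in> I"
      by (auto simp: I_def L_def jm_tuples_def)
    then show "as \<in> F ` I"
      by (rule rev_image_eqI) (simp add: F_def as' mp)
  qed
  ultimately have "jm_moment_on A (Suc n) = (\<Sum>p\<in>I. Poly_Mapping.single (jm_pperm (F p)) 1)"
    unfolding jm_moment_on_def by (metis (no_types, lifting) sum.reindex_cong)
  also have "\<dots> = (\<Sum>m<n. \<Sum>c\<in>A. \<Sum>(mid, post)\<in>L c m \<times> jm_tuples (n - 1 - m) A. Poly_Mapping.single (jm_pperm (c # mid @ c # post)) 1)"
    unfolding I_def using fin finL
    by (simp add: sum.Sigma finite_jm_tuples F_def split_def)
  also have "\<dots> = (\<Sum>m<n. \<Sum>c\<in>A. jm_pow (A - {c}) c m * jm_moment_on A (n - 1 - m))"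
  proof (intro sum.cong refl)
    fix m c
    have "jm_pow (A - {c}) c m * jm_moment_on A (n - 1 - m) =
      (\<Sum>(mid, post)\<in>L c m \<times> jm_tuples (n - 1 - m) A.
        Poly_Mapping.single (cycle_pperm [c] + sum_list (map (\<lambda>a. cycle_pperm [c, a]) mid) + jm_pperm post) 1)"
      using fin by (simp add: jm_pow_expand jm_moment_on_def sum_product mult_single sum.cartesian_product L_def)
    also have "\<dots> = (\<Sum>(mid, post)\<in>L c m \<times> jm_tuples (n - 1 - m) A. Poly_Mapping.single (jm_pperm (c # mid @ c # post)) 1)"
    proof (intro sum.cong refl, clarify)
      fix mid post assume "mid \<in> L c m" "post \<in> jm_tuples (n - 1 - m) A"
      then have "jm_pperm (c # mid @ c # post) =
          cycle_pperm [c] + sum_list (map (\<lambda>a. cycle_pperm [c, a]) mid) + jm_pperm post"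
        by (intro jm_pperm_first_return notin) (auto simp: jm_tuples_def)
      then show "Poly_Mapping.single (cycle_pperm [c] + sum_list (map (\<lambda>a. cycle_pperm [c, a]) mid) + jm_pperm post) 1 =
        Poly_Mapping.single (jm_pperm (c # mid @ c # post)) 1" by simp
    qed
    finally show "(\<Sum>(mid, post)\<in>L c m \<times> jm_tuples (n - 1 - m) A. Poly_Mapping.single (jm_pperm (c # mid @ c # post)) 1) =
      jm_pow (A - {c}) c m * jm_moment_on A (n - 1 - m)" ..
  qed
  finally show ?thesis by (simp add: jm_trace_def sum_distrib_right)
qed

subsection \<open>Commutative algebras of families\<close>

text \<open>The pointwise algebra generated by \<open>G\<close> with unit \<open>e\<close>. The unit
  is a parameter because families with a distinguished point have \<open>pp_point\<close> of that
  point as their unit.\<close>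

inductive_set pp_hull :: "('i \<Rightarrow> 'a pp_alg) \<Rightarrow> ('i \<Rightarrow> 'a pp_alg) set \<Rightarrow> ('i \<Rightarrow> 'a pp_alg) set"
  for e G where
  scal: "(\<lambda>i. Poly_Mapping.single 0 c * e i) \<in> pp_hull e G"
| gen: "g \<in> G \<Longrightarrow> g \<in> pp_hull e G"
| add: "f \<in> pp_hull e G \<Longrightarrow> g \<in> pp_hull e G \<Longrightarrow> (\<lambda>i. f i + g i) \<in> pp_hull e G"
| mult: "f \<in> pp_hull e G \<Longrightarrow> g \<in> pp_hull e G \<Longrightarrow> (\<lambda>i. f i * g i) \<in> pp_hull e G"

lemma pp_hull_unit:
  assumes "f \<in> pp_hull e G" "\<And>i. e i * e i = e i" "\<And>i f. e i * f = f * e i"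
    and "\<And>g i. g \<in> G \<Longrightarrow> e i * g i = g i"
  shows "e i * f i = f i"
  using assms(1)
proof induction
  case (scal c)
  then show ?case using assms(2)[of i] by (metis mult.assoc single_central)
next
  case (mult f g)
  then show ?case by (simp add: mult.assoc[symmetric])
next
  case (gen g)
  then show ?case by (rule assms(4))
qed (simp add: distrib_left)

lemma pp_hull_commute:
  assumes "f \<in> pp_hull e G" "g \<in> pp_hull e G" "\<And>i f. e i * f = f * e i"
    and G: "\<And>g g' i. g \<in> G \<Longrightarrow> g' \<in> G \<Longrightarrow> g i * g' i = g' i * g i"
  shows "f i * g i = g i * f i"
proof -
  have scal: "Poly_Mapping.single 0 c * e i * x = x * (Poly_Mapping.single 0 c * e i)" for c x
    using assms(3)[of i] by (metis mult.assoc single_central)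
  have mult: "x * y * z = z * (x * y)" if "x * z = z * x" "y * z = z * y" for x y z :: "'b pp_alg"
    using that by (metis mult.assoc)
  have 1: "f i * g i = g i * f i" if "g \<in> G" "f \<in> pp_hull e G" for f g
    using that(2,1) by induction (auto simp: scal G distrib_left distrib_right intro: mult)
  show ?thesis
    using assms(2,1) 
  proof (induction)
    case (mult h g)
    then show ?case by (metis mult.assoc)
  qed (auto simp: scal 1 distrib_left distrib_right)
qed

lemma pp_hull_uminus: "f \<in> pp_hull e G \<Longrightarrow> (\<And>i. e i * f i = f i) \<Longrightarrow> (\<lambda>i. - f i) \<in> pp_hull e G"
proof -
  assume f: "f \<in> pp_hull e G" and u: "\<And>i. e i * f i = f i"
  have "(\<lambda>i. Poly_Mapping.single 0 (-1) * e i * f i) \<in> pp_hull e G"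
    by (intro pp_hull.mult pp_hull.scal f)
  moreover have "Poly_Mapping.single 0 (-1) * e i * f i = - f i" for i
    by (simp add: mult.assoc u single_uminus)
  ultimately show ?thesis by simp
qed

lemma pp_hull_zero: "(\<lambda>i. 0) \<in> pp_hull e G"
  using pp_hull.scal[of 0] by simp

lemma pp_hull_one: "e \<in> pp_hull e G"
  using pp_hull.scal[of 1 e] by simp

typedef jm_alg = "pp_hull (\<lambda>_. 1) (range (\<lambda>k A. jm_moment_on A k)) :: (nat set \<Rightarrow> nat pp_alg) set"
  morphisms jm_val Abs_jm_alg
  using pp_hull_zero by blast

setup_lifting type_definition_jm_alg

instantiation jm_alg :: complex_algebra
begin

lift_definition zero_jm_alg :: jm_alg is "\<lambda>_. 0" by (rule pp_hull_zero)
lift_definition one_jm_alg :: jm_alg is "\<lambda>_. 1" by (rule pp_hull_one)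
lift_definition plus_jm_alg :: "jm_alg \<Rightarrow> jm_alg \<Rightarrow> jm_alg" is "\<lambda>f g A. f A + g A"
  by (rule pp_hull.add)
lift_definition times_jm_alg :: "jm_alg \<Rightarrow> jm_alg \<Rightarrow> jm_alg" is "\<lambda>f g A. f A * g A"
  by (rule pp_hull.mult)
lift_definition uminus_jm_alg :: "jm_alg \<Rightarrow> jm_alg" is "\<lambda>f A. - f A"
  by (rule pp_hull_uminus) simp_all
lift_definition minus_jm_alg :: "jm_alg \<Rightarrow> jm_alg \<Rightarrow> jm_alg" is "\<lambda>f g A. f A - g A"
  unfolding diff_conv_add_uminus by (intro pp_hull.add pp_hull_uminus) simp_all
lift_definition cscal_jm_alg :: "complex \<Rightarrow> jm_alg" is "\<lambda>c _. Poly_Mapping.single 0 c"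
  using pp_hull.scal[of _ "\<lambda>_. 1"] by simp

instance
proof
  fix a b c :: jm_alg and x y :: complex
  show "a * b = b * a"
  proof (transfer, rule ext)
    fix f g :: "nat set \<Rightarrow> nat pp_alg" and A
    assume "f \<in> pp_hull (\<lambda>_. 1) (range (\<lambda>k A. jm_moment_on A k))" "g \<in> pp_hull (\<lambda>_. 1) (range (\<lambda>k A. jm_moment_on A k))"
    then show "f A * g A = g A * f A"
      by (rule pp_hull_commute) (auto intro: jm_moment_on_commute jm_moment_on_in)
  qed
  show "(0 :: jm_alg) \<noteq> 1" by transfer (simp add: fun_eq_iff)
  show "cscal (x + y) = (cscal x + cscal y :: jm_alg)" by transfer (simp add: single_add)
  show "cscal (x * y) = (cscal x * cscal y :: jm_alg)" by transfer (simp add: mult_single)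
  show "cscal 1 = (1 :: jm_alg)" by transfer simp
qed (transfer; simp add: fun_eq_iff algebra_simps)+

end

text \<open>
  Families indexed by a finite set \<open>A\<close> and a further point \<open>b\<close>, which plays the role of the star;
  they vanish when \<open>A\<close> is infinite or contains \<open>b\<close>.  The moments over \<open>A\<close> (\<open>old_box\<close> below),
  the moments over \<open>insert b A\<close> (\<open>new_box\<close>) and the Jucys--Murphy element of \<open>b\<close> generate a
  commutative ring.
\<close>

definition box_unit :: "nat set \<times> nat \<Rightarrow> nat pp_alg" where
  "box_unit = (\<lambda>(A, b). if finite A \<and> b \<notin> A then pp_point b else 0)"

definition box_gens :: "(nat set \<times> nat \<Rightarrow> nat pp_alg) set" where
  "box_gens = range (\<lambda>k (A, b). box_unit (A, b) * jm_moment_on A k) \<union>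
     range (\<lambda>k (A, b). box_unit (A, b) * jm_moment_on (insert b A) k) \<union>
     {\<lambda>(A, b). box_unit (A, b) * jm_elem A b}"

lemma box_unit_idem: "box_unit i * box_unit i = box_unit i"
  by (auto simp: box_unit_def pp_point_idem split: prod.splits)

lemma box_unit_central: "box_unit i * f = f * box_unit i"
  by (auto simp: box_unit_def pp_point_central split: prod.splits)

lemma box_unit_left: "box_unit i * (box_unit i * f) = box_unit i * f"
  by (simp only: mult.assoc[symmetric] box_unit_idem)

lemma box_unit_mult: "(box_unit i * f) * (box_unit i * g) = box_unit i * (f * g)"
  by (metis mult.assoc box_unit_idem box_unit_central)

lemma box_gens_unit: "g \<in> box_gens \<Longrightarrow> box_unit i * g i = g i"
  by (cases i) (auto simp: box_gens_def box_unit_left)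

text \<open>The moments over \<open>insert b A\<close> commute with everything over
  \<open>insert b A\<close>, which includes the other generators; the Jucys--Murphy element of
  \<open>b\<close> and the moments over \<open>A\<close> commute with everything over
  \<open>A\<close>.\<close>

lemma box_gens_commute:
  assumes "g \<in> box_gens" "g' \<in> box_gens" shows "g i * g' i = g' i * g i"
proof -
  obtain A b where i: "i = (A, b)" by (cases i)
  let ?S = "range (jm_moment_on A) \<union> range (jm_moment_on (insert b A)) \<union> {jm_elem A b}"
  have *: "\<exists>f\<in>?S. g i = box_unit i * f" if "g \<in> box_gens" for g
    using that by (auto simp: box_gens_def i)
  from *[OF assms(1)] *[OF assms(2)] obtain f f' where f: "f \<in> ?S" "f' \<in> ?S" "g i = box_unit i * f" "g' i = box_unit i * f'"
    by blast
  show ?thesis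
  proof (cases "finite A \<and> b \<notin> A")
    case False
    then have "box_unit i = 0" by (auto simp: box_unit_def i)
    then show ?thesis by (simp add: f(3,4))
  next
    case True
    let ?B = "insert b A"
    have A: "jm_moment_on A k \<in> pp_alg_on ?B" for k
      by (rule pp_alg_on_mono[OF subset_insertI jm_moment_on_in])
    note c1 = jm_moment_on_commute[of _ ?B, OF jm_moment_on_in]
    note c2 = jm_moment_on_commute[of _ ?B, OF A]
    note c3 = jm_moment_on_commute[of _ ?B, OF jm_elem_in]
    note c4 = jm_moment_on_commute[of _ A, OF jm_moment_on_in]
    note c5 = jm_elem_commute[of b A, OF conjunct2[OF True] jm_moment_on_in]
    have "f * f' = f' * f"
      using f(1,2)
      by (elim UnE rangeE singletonE; hypsubst)
         (rule c1 c2 c2[symmetric] c3 c3[symmetric] c4 c5 c5[symmetric] refl)+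
    then show ?thesis by (simp only: f(3,4) box_unit_mult)
  qed
qed

typedef box_alg = "pp_hull box_unit box_gens" morphisms box_val Abs_box_alg
  using pp_hull_zero by blast

setup_lifting type_definition_box_alg

lemma box_hull_unit: "f \<in> pp_hull box_unit box_gens \<Longrightarrow> box_unit i * f i = f i"
  by (rule pp_hull_unit[where f = f and e = box_unit and G = box_gens])
     (auto simp: box_unit_idem box_gens_unit intro: box_unit_central)

instantiation box_alg :: complex_algebra
begin

lift_definition zero_box_alg :: box_alg is "\<lambda>_. 0" by (rule pp_hull_zero)
lift_definition one_box_alg :: box_alg is "box_unit" by (rule pp_hull_one)
lift_definition plus_box_alg :: "box_alg \<Rightarrow> box_alg \<Rightarrow> box_alg" is "\<lambda>f g A. f A + g A"
  by (rule pp_hull.add)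
lift_definition times_box_alg :: "box_alg \<Rightarrow> box_alg \<Rightarrow> box_alg" is "\<lambda>f g A. f A * g A"
  by (rule pp_hull.mult)
lift_definition uminus_box_alg :: "box_alg \<Rightarrow> box_alg" is "\<lambda>f A. - f A"
  by (rule pp_hull_uminus) (simp_all add: box_hull_unit)
lift_definition minus_box_alg :: "box_alg \<Rightarrow> box_alg \<Rightarrow> box_alg" is "\<lambda>f g A. f A - g A"
  unfolding diff_conv_add_uminus by (intro pp_hull.add pp_hull_uminus) (simp_all add: box_hull_unit)
lift_definition cscal_box_alg :: "complex \<Rightarrow> box_alg" is "\<lambda>c i. Poly_Mapping.single 0 c * box_unit i"
  by (rule pp_hull.scal)

instance
proof
  fix a b c :: box_alg and x y :: complex
  show "a * b = b * a"
    by (transfer, rule ext, rule pp_hull_commute) (auto intro: box_gens_commute box_unit_central)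
  show "1 * a = a" by transfer (simp add: fun_eq_iff box_hull_unit)
  show "(0 :: box_alg) \<noteq> 1"
  proof (transfer, rule notI)
    assume "(\<lambda>_. 0) = box_unit"
    then have "box_unit ({}, 0) = 0" by metis
    then have "pp_point (0 :: nat) = 0" by (simp add: box_unit_def)
    then show False by (metis lookup_single_eq lookup_zero zero_neq_one)
  qed
  show "cscal (x + y) = (cscal x + cscal y :: box_alg)" by transfer (simp add: single_add distrib_right)
  show "cscal (x * y) = (cscal x * cscal y :: box_alg)"
  proof (transfer, rule ext)
    fix x y i
    have "Poly_Mapping.single 0 (x * y) * box_unit i = (Poly_Mapping.single 0 x * Poly_Mapping.single 0 y) * (box_unit i * box_unit i)"
      by (simp add: box_unit_idem mult_single)
    also have "\<dots> = Poly_Mapping.single 0 x * box_unit i * (Poly_Mapping.single 0 y * box_unit i)"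
      by (metis mult.assoc box_unit_central)
    finally show "Poly_Mapping.single 0 (x * y) * box_unit i = Poly_Mapping.single 0 x * box_unit i * (Poly_Mapping.single 0 y * box_unit i)" .
  qed
  show "cscal 1 = (1 :: box_alg)" by transfer simp
qed (transfer; simp add: fun_eq_iff algebra_simps)+

end

section \<open>Homomorphisms, and the moments without and with the new point\<close>

locale complex_algebra_hom =
  fixes \<phi> :: "'a::complex_algebra \<Rightarrow> 'b::complex_algebra"
  assumes hom_add: "\<phi> (x + y) = \<phi> x + \<phi> y"
    and hom_mult: "\<phi> (x * y) = \<phi> x * \<phi> y"
    and hom_cscal: "\<phi> (cscal c) = cscal c"
begin

definition fps_map :: "'a fps \<Rightarrow> 'b fps" where
  "fps_map f = Abs_fps (\<lambda>n. \<phi> (f $ n))"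

lemma fps_map_nth [simp]: "fps_map f $ n = \<phi> (f $ n)"
  by (simp add: fps_map_def)

lemma hom_0 [simp]: "\<phi> 0 = 0"
  using hom_cscal[of 0] by simp

lemma hom_1 [simp]: "\<phi> 1 = 1"
  using hom_cscal[of 1] by simp

lemma hom_sum: "\<phi> (sum f A) = (\<Sum>i\<in>A. \<phi> (f i))"
  by (induction A rule: infinite_finite_induct) (simp_all add: hom_add)

lemma fps_map_mult: "fps_map (f * g) = fps_map f * fps_map g"
  by (simp add: fps_eq_iff fps_mult_nth hom_sum hom_mult)

lemma fps_map_1: "fps_map 1 = 1"
  by (simp add: fps_eq_iff)

lemma fps_map_shift_var: "fps_map (fps_shift_var a k f) = fps_shift_var a k (fps_map f)"
  by (simp add: fps_eq_iff fps_shift_var_nth hom_sum hom_mult hom_cscal)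

lemma fps_map_shift_prod: "fps_map (shift_prod f k) = shift_prod (fps_map f) k"
  by (induction k) (simp_all add: shift_prod_def fps_map_1 fps_map_mult fps_map_shift_var)

end

lift_definition old_box :: "jm_alg \<Rightarrow> box_alg" is "\<lambda>p (A, b). box_unit (A, b) * p A"
proof -
  fix p :: "nat set \<Rightarrow> nat pp_alg"
  assume "p \<in> pp_hull (\<lambda>_. 1) (range (\<lambda>k A. jm_moment_on A k))"
  then have "(\<lambda>i. box_unit i * p (fst i)) \<in> pp_hull box_unit box_gens"
  proof (induction rule: pp_hull.induct)
    case (scal c)
    then show ?case using pp_hull.scal[of c box_unit] by (simp add: single_central)
  next
    case (gen g)
    then show ?case by (intro pp_hull.gen) (auto simp: box_gens_def case_prod_unfold)
  next
    case (add f g)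
    then show ?case using pp_hull.add by (fastforce simp: distrib_left)
  next
    case (mult f g)
    then show ?case using pp_hull.mult by (fastforce simp: box_unit_mult)
  qed
  then show "(\<lambda>(A, b). box_unit (A, b) * p A) \<in> pp_hull box_unit box_gens"
    by (simp add: case_prod_unfold)
qed

lift_definition new_box :: "jm_alg \<Rightarrow> box_alg" is "\<lambda>p (A, b). box_unit (A, b) * p (insert b A)"
proof -
  fix p :: "nat set \<Rightarrow> nat pp_alg"
  assume "p \<in> pp_hull (\<lambda>_. 1) (range (\<lambda>k A. jm_moment_on A k))"
  then have "(\<lambda>i. box_unit i * p (insert (snd i) (fst i))) \<in> pp_hull box_unit box_gens"
  proof (induction rule: pp_hull.induct)
    case (scal c)
    then show ?case using pp_hull.scal[of c box_unit] by (simp add: single_central)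
  next
    case (gen g)
    then show ?case by (intro pp_hull.gen) (auto simp: box_gens_def case_prod_unfold)
  next
    case (add f g)
    then show ?case using pp_hull.add by (fastforce simp: distrib_left)
  next
    case (mult f g)
    then show ?case using pp_hull.mult by (fastforce simp: box_unit_mult)
  qed
  then show "(\<lambda>(A, b). box_unit (A, b) * p (insert b A)) \<in> pp_hull box_unit box_gens"
    by (simp add: case_prod_unfold)
qed

interpretation old: complex_algebra_hom old_box
proof
  show "old_box (x + y) = old_box x + old_box y" for x y
    by transfer (auto simp: distrib_left)
  show "old_box (x * y) = old_box x * old_box y" for x y
    by transfer (auto simp: box_unit_mult)
  show "old_box (cscal c) = cscal c" for c
    by transfer (auto simp: single_central)
qed

interpretation new: complex_algebra_hom new_box
proof
  show "new_box (x + y) = new_box x + new_box y" for x y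
    by transfer (auto simp: distrib_left)
  show "new_box (x * y) = new_box x * new_box y" for x y
    by transfer (auto simp: box_unit_mult)
  show "new_box (cscal c) = cscal c" for c
    by transfer (auto simp: single_central)
qed

lift_definition box_x :: box_alg is "\<lambda>(A, b). box_unit (A, b) * jm_elem A b"
  by (rule pp_hull.gen) (simp add: box_gens_def)

lift_definition jm_mom :: "nat \<Rightarrow> jm_alg" is "\<lambda>k A. jm_moment_on A k"
  by (rule pp_hull.gen) auto

lemma jm_val_0 [simp]: "jm_val 0 A = 0" by transfer simp
lemma jm_val_1 [simp]: "jm_val 1 A = 1" by transfer simp
lemma jm_val_add: "jm_val (p + q) A = jm_val p A + jm_val q A" by transfer simp
lemma jm_val_mult: "jm_val (p * q) A = jm_val p A * jm_val q A" by transfer simp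
lemma jm_val_sum: "jm_val (sum f I) A = (\<Sum>i\<in>I. jm_val (f i) A)"
  by (induction I rule: infinite_finite_induct) (simp_all add: jm_val_add)
lemma jm_val_mom: "jm_val (jm_mom k) A = jm_moment_on A k" by transfer simp
lemma jm_val_of_nat: "jm_val (of_nat n) A = of_nat n"
  by (induction n) (simp_all add: jm_val_add)

lemma box_val_0 [simp]: "box_val 0 i = 0" by transfer simp
lemma box_val_add: "box_val (p + q) i = box_val p i + box_val q i" by transfer simp
lemma box_val_diff: "box_val (p - q) i = box_val p i - box_val q i" by transfer simp
lemma box_val_mult: "box_val (p * q) i = box_val p i * box_val q i" by transfer simp
lemma box_val_sum: "box_val (sum f I) i = (\<Sum>j\<in>I. box_val (f j) i)"
  by (induction I rule: infinite_finite_induct) (simp_all add: box_val_add)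
lemma box_val_of_nat_mult: "box_val (of_nat n * p) i = of_nat n * box_val p i"
  by (induction n) (simp_all add: box_val_add distrib_right)

context
  fixes A :: "nat set" and b :: nat
  assumes fin: "finite A" and b: "b \<notin> A"
begin

lemma box_val_1: "box_val 1 (A, b) = pp_point b"
  using fin b by transfer (simp add: box_unit_def)

lemma box_val_x_power: "box_val (box_x ^ m) (A, b) = jm_pow A b m"
proof (induction m)
  case 0
  show ?case by (simp add: box_val_1 jm_pow_def)
next
  case (Suc m)
  have "box_val box_x (A, b) = jm_elem A b"
    using fin b by transfer (simp add: box_unit_def pp_point_jm_elem)
  then show ?case
    by (simp add: box_val_mult Suc jm_pow_def mult.assoc[symmetric] pp_point_central[of b "jm_elem A b"])
qed

lemma box_val_old: "box_val (old_box p) (A, b) = pp_point b * jm_val p A"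
  using fin b by (simp add: old_box.rep_eq box_unit_def)

lemma box_val_new: "box_val (new_box p) (A, b) = pp_point b * jm_val p (insert b A)"
  using fin b by (simp add: new_box.rep_eq box_unit_def)

lemma jm_pow_point: "jm_pow A b m * (pp_point b * f) = jm_pow A b m * f"
proof -
  have "jm_pow A b m * pp_point b = jm_pow A b m"
    unfolding jm_pow_def by (simp only: mult.assoc pp_point_central[of b "jm_elem A b ^ m", symmetric]) (simp only: mult.assoc[symmetric] pp_point_idem)
  then show ?thesis by (simp only: mult.assoc[symmetric])
qed

end

lemma box_alg_eqI:
  assumes "\<And>A b. finite A \<Longrightarrow> b \<notin> A \<Longrightarrow> box_val p (A, b) = box_val q (A, b)"
  shows "p = q"
proof -
  have "box_val p i = box_val q i" for i
  proof (cases i)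
    case (Pair A b)
    show ?thesis
    proof (cases "finite A \<and> b \<notin> A")
      case False
      have "box_val r i = 0" for r
        using box_hull_unit[OF box_val[of r], of i] False by (auto simp: Pair box_unit_def)
      then show ?thesis by simp
    qed (use assms Pair in auto)
  qed
  then show ?thesis by (metis ext box_val_inject)
qed

subsection \<open>The reciprocal of the moment series\<close>

definition moment_fps :: "jm_alg fps" where
  "moment_fps = Abs_fps jm_mom"

text \<open>With weight 1 this stands for H, because G(z) is z^-1 times the moment series at
  1/z.\<close>

definition recip_fps :: "jm_alg fps" where
  "recip_fps = fps_left_inverse moment_fps 1"

lemma jm_mom_0 [simp]: "jm_mom 0 = 1"
  by transfer (simp add: jm_moment_on_0)

lemma recip_moment: "recip_fps * moment_fps = 1"
  unfolding recip_fps_def by (rule fps_left_inverse) (simp add: moment_fps_def)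

text \<open>The values at \<open>A\<close> lie in a noncommutative ring. There the first-return
  relation exhibits \<open>B\<close> as a left inverse of the moment series and \<open>V\<close> is
  a right inverse, so the two coincide.\<close>

lemma jm_val_recip:
  assumes fin: "finite A"
  shows "jm_val (recip_fps $ n) A = (if n = 0 then 1 else if n = 1 then 0 else - jm_trace (n - 2) A)"
proof -
  define V M B where "V = Abs_fps (\<lambda>n. jm_val (recip_fps $ n) A)"
    and "M = Abs_fps (\<lambda>n. jm_moment_on A n)"
    and "B = Abs_fps (\<lambda>n. if n = 0 then 1 else if n = 1 then 0 else - jm_trace (n - 2) A)"
  have "M $ n = jm_val (moment_fps $ n) A" for n
    by (simp add: M_def moment_fps_def jm_val_mom)
  then have "(M * V) $ n = jm_val ((recip_fps * moment_fps) $ n) A" for n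
    by (subst mult.commute[of recip_fps]) (simp add: fps_mult_nth jm_val_sum jm_val_mult V_def)
  then have MV: "M * V = 1"
    by (intro fps_ext) (simp add: recip_moment)
  have "B * M = 1"
  proof (rule fps_ext)
    fix n
    show "(B * M) $ n = 1 $ n"
    proof (cases n)
      case 0
      then show ?thesis by (simp add: B_def M_def jm_moment_on_0)
    next
      case (Suc n')
      have "(B * M) $ n = M $ n + (\<Sum>i=Suc 0..n. B $ i * M $ (n - i))"
        by (simp add: fps_mult_nth sum.atLeast_Suc_atMost B_def)
      also have "(\<Sum>i=Suc 0..n. B $ i * M $ (n - i)) = (\<Sum>i=2..n. B $ i * M $ (n - i))"
        by (subst sum.atLeast_Suc_atMost) (simp_all add: Suc B_def numeral_2_eq_2)
      also have "\<dots> = - (\<Sum>m<n'. jm_trace m A * jm_moment_on A (n' - 1 - m))"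
        unfolding sum_negf[symmetric]
        by (intro sum.reindex_bij_witness[of _ "\<lambda>m. m + 2" "\<lambda>i. i - 2"]) (auto simp: Suc B_def M_def)
      finally show ?thesis by (simp add: Suc M_def jm_moment_on_Suc[OF fin])
    qed
  qed
  then have "V = B * (M * V)" by (metis mult.assoc mult_1_left)
  then have "V = B" by (simp add: MV)
  then show ?thesis by (auto simp: V_def B_def fps_eq_iff)
qed

definition "h_old = old.fps_map recip_fps"
definition "h_new = new.fps_map recip_fps"

lemma recip_fps_0: "recip_fps $ 0 = 1"
  by (simp add: recip_fps_def)

lemma jm_mom_1: "jm_mom 1 = 0"
proof (transfer, rule ext)
  fix A :: "nat set"
  have "jm_tuples 1 A = {}"
    by (auto simp: jm_tuples_def length_Suc_conv jm_perm_Cons)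
  then show "jm_moment_on A 1 = 0" by (simp add: jm_moment_on_def)
qed

lemma recip_fps_1: "recip_fps $ 1 = 0"
proof -
  have "(recip_fps * moment_fps) $ 1 = 0" by (simp add: recip_moment)
  then show ?thesis
    using jm_mom_1 by (simp add: fps_mult_nth moment_fps_def)
qed

text \<open>The index of \<open>h\<close> is \<open>n - j\<close>, written so that
  \<open>jm_val_recip\<close> turns it into the trace of degree
  \<open>n - 1 - 1 - j\<close>.\<close>

lemma poly_part_h:
  assumes "h $ 0 = 1" "h $ 1 = 0"
  shows "poly_part n h y = y ^ n + (\<Sum>j<n - 1. y ^ j * h $ (n - 1 - 1 - j + 2))"
proof -
  have "poly_part n h y = (\<Sum>j\<le>n. y ^ j * h $ (n - j))"
    unfolding poly_part_def
    by (intro sum.reindex_bij_witness[of _ "\<lambda>j. n - j" "\<lambda>j. n - j"]) (auto simp: mult.commute)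
  also have "\<dots> = y ^ n + (\<Sum>j<n. y ^ j * h $ (n - j))"
    using assms by (simp add: lessThan_Suc_atMost[symmetric])
  also have "(\<Sum>j<n. y ^ j * h $ (n - j)) = (\<Sum>j<n - 1. y ^ j * h $ (n - j))"
    using assms by (cases n) auto
  also have "\<dots> = (\<Sum>j<n - 1. y ^ j * h $ (n - 1 - 1 - j + 2))"
    by (intro sum.cong refl arg_cong2[of _ _ _ _ "(*)"] arg_cong[of _ _ "($) h"]) auto
  finally show ?thesis .
qed

lemma h_old_01: "h_old $ 0 = 1" "h_old $ 1 = 0"
  by (simp_all add: h_old_def recip_fps_0 recip_fps_1[simplified])

lemma box_val_poly_part:
  assumes "finite A" "b \<notin> A"
  shows "box_val (poly_part n h_old box_x) (A, b) =
    jm_pow A b n - (\<Sum>j<n - 1. jm_pow A b j * jm_trace (n - 1 - 1 - j) A)"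
proof -
  have "box_val (box_x ^ j * h_old $ (m + 2)) (A, b) = - (jm_pow A b j * jm_trace m A)" for j m
    using assms by (simp add: h_old_def box_val_mult box_val_x_power box_val_old jm_pow_point jm_val_recip)
  then show ?thesis
    by (simp only: poly_part_h[OF h_old_01] box_val_add box_val_sum box_val_x_power[OF assms])
      (simp add: sum_negf)
qed

text \<open>Subtracting (z - x)^-2 H is \<open>jm_trace_insert\<close>, read coefficient by
  coefficient. The denominators are cleared by (z - x)^2 - 1 = (z - x - 1)(z - x + 1).\<close>

lemma h_new_rel: "h_new * fps_lin box_x 0 * fps_lin box_x 0 = h_old * fps_lin box_x 1 * fps_lin box_x (- 1)"
proof -
  let ?g = "fps_geo box_x"
  have *: "h_new = h_old - fps_X\<^sup>2 * (h_old * ?g * ?g)"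
  proof (rule fps_ext)
    fix n :: nat
    consider "n = 0" | "n = 1" | m where "n = m + 2"
      by (metis One_nat_def add_2_eq_Suc' old.nat.exhaust)
    then show "h_new $ n = (h_old - fps_X\<^sup>2 * (h_old * ?g * ?g)) $ n"
    proof cases
      case (3 m)
      have "box_val ((h_old * ?g * ?g) $ m) (A, b) = of_nat (Suc m) * jm_pow A b m -
         (\<Sum>i<m. \<Sum>j<m - 1 - i. jm_pow A b (i + j) * jm_trace (m - 1 - i - 1 - j) A)"
        if "finite A" "b \<notin> A" for A b
      proof -
        have "(h_old * ?g * ?g) $ m = (\<Sum>i\<le>m. box_x ^ i * poly_part (m - i) h_old box_x)"
        proof -
          have "h_old * ?g * ?g = ?g * (h_old * ?g)"
            by (simp only: ac_simps)
          then show ?thesis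
            by (simp only: fps_mult_nth[of ?g] poly_part_eq_nth atLeast0AtMost) (simp add: fps_geo_def)
        qed
        moreover have "box_val (box_x ^ i * poly_part n h_old box_x) (A, b) = jm_pow A b (n + i) -
            (\<Sum>j<n - 1. jm_pow A b (i + j) * jm_trace (n - 1 - 1 - j) A)" for i n
        proof -
          have p: "jm_pow A b i * jm_pow A b j = jm_pow A b (i + j)" for i j
            using that by (simp add: box_val_x_power[symmetric] power_add box_val_mult)
          show ?thesis
            by (simp add: box_val_mult box_val_poly_part[OF that] box_val_x_power[OF that] right_diff_distrib
                sum_distrib_left mult.assoc[symmetric] p add.commute)
        qed
        ultimately have "box_val ((h_old * ?g * ?g) $ m) (A, b) = (\<Sum>i\<le>m. jm_pow A b m -
            (\<Sum>j<m - i - 1. jm_pow A b (i + j) * jm_trace (m - i - 1 - 1 - j) A))"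
          by (simp add: box_val_sum)
        also have "\<dots> = of_nat (Suc m) * jm_pow A b m - (\<Sum>i\<le>m. \<Sum>j<m - i - 1. jm_pow A b (i + j) * jm_trace (m - i - 1 - 1 - j) A)"
          by (simp add: sum_subtractf)
        also have "(\<Sum>i\<le>m. \<Sum>j<m - i - 1. jm_pow A b (i + j) * jm_trace (m - i - 1 - 1 - j) A) =
            (\<Sum>i<m. \<Sum>j<m - 1 - i. jm_pow A b (i + j) * jm_trace (m - 1 - i - 1 - j) A)"
          by (simp add: lessThan_Suc_atMost[symmetric] diff_right_commute)
        finally show ?thesis .
      qed
      then have "h_new $ (m + 2) = h_old $ (m + 2) - (h_old * ?g * ?g) $ m"
        by (intro box_alg_eqI)
           (simp add: h_new_def h_old_def box_val_diff box_val_old box_val_new jm_val_recip jm_trace_insert)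
      then show ?thesis
        using fps_X_power_mult_nth[of 2 "h_old * ?g * ?g" "m + 2"] 3 by simp
    qed (simp_all add: h_new_def h_old_def recip_fps_0 recip_fps_1[simplified] fps_X_power_mult_nth)
  qed
  have "h_new * fps_lin box_x 0 * fps_lin box_x 0 =
      h_old * fps_lin box_x 0 * fps_lin box_x 0 - fps_X\<^sup>2 * h_old * (?g * fps_lin box_x 0) * (?g * fps_lin box_x 0)"
    unfolding * by (simp add: algebra_simps)
  also have "?g * fps_lin box_x 0 = 1"
    using fps_geo_fps_lin[of box_x 0] by simp
  also have "h_old * fps_lin box_x 0 * fps_lin box_x 0 - fps_X\<^sup>2 * h_old * 1 * 1 = h_old * (fps_lin box_x 1 * fps_lin box_x (- 1))"
  proof -
    have "fps_lin box_x 1 = fps_lin box_x 0 - fps_X" "fps_lin box_x (- 1) = fps_lin box_x 0 + fps_X"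
      by (simp_all add: fps_lin_def cscal_minus fps_const_add[symmetric] fps_const_sub[symmetric] algebra_simps
          del: fps_const_add fps_const_sub)
    then show ?thesis by (simp only:) (simp add: algebra_simps power2_eq_square)
  qed
  finally show ?thesis by (simp only: mult.assoc)
qed

subsection \<open>Cycles\<close>

definition cycle_sum :: "nat \<Rightarrow> nat set \<Rightarrow> nat \<Rightarrow> nat pp_alg" where
  "cycle_sum k A b = (\<Sum>as | length as = k \<and> distinct as \<and> set as \<subseteq> A.
     Poly_Mapping.single (cycle_pperm (b # as)) 1)"

lemma sum_distinct_lists_Suc:
  assumes "finite A"
  shows "(\<Sum>as | length as = Suc k \<and> distinct as \<and> set as \<subseteq> A. f as) =
    (\<Sum>c\<in>A. \<Sum>as | length as = k \<and> distinct as \<and> set as \<subseteq> A - {c}. f (c # as))"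
proof -
  have fin: "finite {as. length as = k \<and> distinct as \<and> set as \<subseteq> A - {c}}" for c
    by (rule finite_subset[OF _ finite_lists_length_eq[OF assms, of k]]) auto
  show ?thesis
    using assms fin
    by (subst sum.Sigma)
       (auto intro!: sum.reindex_bij_witness[of _ "\<lambda>(c, as). c # as" "\<lambda>as. (hd as, tl as)"] simp: length_Suc_conv)
qed

lemma cycle_sum_0: "cycle_sum 0 A b = pp_point b"
proof -
  have "{as. length as = 0 \<and> distinct as \<and> set as \<subseteq> A} = {[]}" by auto
  then show ?thesis by (simp add: cycle_sum_def)
qed

lemma cycle_sum_Suc:
  assumes "finite A"
  shows "cycle_sum (Suc k) A b = (\<Sum>c\<in>A. pp_swap b c * cycle_sum k (A - {c}) c)"
  unfolding cycle_sum_def sum_distinct_lists_Suc[OF assms]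
  by (simp add: sum_distrib_left mult_single cycle_pperm_Cons[symmetric])

lemma cc_ind_on_cycle_sum:
  assumes "finite A"
  shows "cc_ind_on A [Suc k] = (\<Sum>c\<in>A. cycle_sum k (A - {c}) c)"
proof -
  have "cc_ind_on A [Suc k] = (\<Sum>as | length as = Suc k \<and> distinct as \<and> set as \<subseteq> A. Poly_Mapping.single (cycle_pperm as) 1)"
    unfolding cc_ind_on_def
    by (auto intro!: sum.reindex_bij_witness[of _ "\<lambda>as. [as]" "hd"] simp: cc_families_def length_Suc_conv)
  then show ?thesis
    by (simp add: cycle_sum_def sum_distinct_lists_Suc[OF assms])
qed

text \<open>\<open>k + 1\<close> times the sum of all cycles of length \<open>k + 1\<close> through \<open>b\<close>, as a polynomial in \<open>box_x\<close>.\<close>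

definition cycle_poly :: "nat \<Rightarrow> box_alg" where
  "cycle_poly k = (shift_prod h_old (Suc k) * fps_geo box_x * fps_geo (box_x + of_nat k)) $ k"

text \<open>The coefficient of \<open>y^(k - j)\<close> in the difference of the polynomial parts of
  the \<open>k\<close>-fold product at \<open>y + k\<close> and at \<open>y - 1\<close>.\<close>

definition step_coeff :: "nat \<Rightarrow> nat \<Rightarrow> jm_alg" where
  "step_coeff k j =
     fps_shift_var (of_nat k) (of_nat k) (shift_prod recip_fps k) $ j -
     fps_shift_var (- 1) (of_nat k) (shift_prod recip_fps k) $ j"

text \<open>The coefficients are taken over the enlarged set. At the index
  \<open>(A - {c}, c)\<close> this set is \<open>A\<close> for every \<open>c\<close>, so they can
  be pulled out of a sum over \<open>c\<close>.\<close>

lemma cycle_poly_new: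
  "of_nat (Suc (Suc k)) * cycle_poly k = (\<Sum>j\<le>Suc k. box_x ^ (Suc k - j) * new_box (step_coeff (Suc k) j))"
proof -
  have "of_nat (Suc (Suc k)) * cycle_poly k =
      poly_part (Suc k) (shift_prod h_new (Suc k)) (box_x + cscal (of_nat (Suc k))) -
      poly_part (Suc k) (shift_prod h_new (Suc k)) (box_x + cscal (- 1))"
    unfolding cycle_poly_def shift_prod_add_box_poly_part[OF h_new_rel] by (simp add: cscal_minus del: of_nat_Suc)
  also have "\<dots> = (\<Sum>j\<le>Suc k. box_x ^ (Suc k - j) * new_box (step_coeff (Suc k) j))"
  proof -
    have "new_box (p - q) = new_box p - new_box q" for p q
      using new.hom_add[of "p - q" q] by (simp add: eq_diff_eq)
    moreover have "fps_shift_var a c (shift_prod h_new n) $ j = new_box (fps_shift_var a c (shift_prod recip_fps n) $ j)" for a c n j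
      by (simp only: h_new_def new.fps_map_shift_prod[symmetric] new.fps_map_shift_var[symmetric] new.fps_map_nth)
    ultimately show ?thesis
      unfolding poly_part_shift_var[symmetric] step_coeff_def
      unfolding poly_part_def sum_subtractf[symmetric]
      by (simp only: right_diff_distrib mult.commute)
  qed
  finally show ?thesis .
qed

lemma cycle_poly_old:
  "of_nat (Suc k) * cycle_poly (Suc k) =
    (\<Sum>j\<le>Suc k. poly_part (Suc (Suc k - j)) h_old box_x * old_box (step_coeff (Suc k) j))"
proof -
  have "old_box (p - q) = old_box p - old_box q" for p q
    using old.hom_add[of "p - q" q] by (simp add: eq_diff_eq)
  moreover have "fps_shift_var a c (shift_prod h_old n) $ j = old_box (fps_shift_var a c (shift_prod recip_fps n) $ j)" for a c n j
    by (simp only: h_old_def old.fps_map_shift_prod[symmetric] old.fps_map_shift_var[symmetric] old.fps_map_nth)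
  ultimately show ?thesis
    unfolding cycle_poly_def shift_prod_geo_poly_part shift_prod_step[symmetric] step_coeff_def
    unfolding sum_subtractf[symmetric]
    by (simp only: right_diff_distrib mult.commute)
qed

lemma pp_alg_of_nat_cancel:
  fixes x y :: "'a pp_alg"
  assumes "of_nat (Suc k) * x = of_nat (Suc k) * y" shows "x = y"
proof -
  let ?c = "Poly_Mapping.single 0 (1 / of_nat (Suc k)) :: 'a pp_alg"
  have "(of_nat (Suc k) :: 'a pp_alg) = Poly_Mapping.single 0 (of_nat (Suc k))"
    by (rule single_of_nat[symmetric])
  then have "?c * of_nat (Suc k) = 1"
    by (simp only: mult_single) (simp del: of_nat_Suc)
  moreover have "?c * of_nat (Suc k) * x = ?c * of_nat (Suc k) * y"
    by (simp only: mult.assoc assms)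
  ultimately show ?thesis by simp
qed

text \<open>Splitting off the first transposition (b c) leaves a shorter cycle through
  \<open>c\<close> over \<open>A - {c}\<close>. \<open>cycle_poly_new\<close> expands it with
  coefficients independent of \<open>c\<close>, \<open>sum_swap_jm_pow\<close> sums over
  \<open>c\<close>, and \<open>cycle_poly_old\<close> recognizes the result.\<close>

lemma cycle_sum_eq:
  "finite A \<Longrightarrow> b \<notin> A \<Longrightarrow> of_nat (Suc k) * cycle_sum k A b = box_val (cycle_poly k) (A, b)"
proof (induction k arbitrary: A b)
  case 0
  have "cycle_poly 0 = 1"
    by (simp add: cycle_poly_def shift_prod_def fps_geo_def h_old_01)
  with 0 show ?case by (simp add: cycle_sum_0 box_val_1)
next
  case (Suc k)
  note fin = Suc.prems(1) and b = Suc.prems(2)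
  have c: "finite (A - {c})" "c \<notin> A - {c}" for c using fin by auto
  \<comment> \<open>\<open>cycle_poly_new\<close> needs the factor \<open>k + 2\<close> and
    \<open>cycle_poly_old\<close> produces \<open>k + 1\<close>; the latter is cancelled at the
    end.\<close>
  have "of_nat (Suc k) * (of_nat (Suc (Suc k)) * cycle_sum (Suc k) A b) =
      (\<Sum>c\<in>A. pp_swap b c * (of_nat (Suc (Suc k)) * (of_nat (Suc k) * cycle_sum k (A - {c}) c)))"
  proof -
    have "of_nat m * (of_nat n * (x * y)) = x * (of_nat n * (of_nat m * y))" for m n and x y :: "nat pp_alg"
    proof -
      have "of_nat m * (of_nat n * (x * y)) = of_nat (n * m) * x * y"
        by (simp only: mult.assoc[symmetric] of_nat_mult[symmetric] mult.commute[of m])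
      also have "\<dots> = x * of_nat (n * m) * y"
        by (simp only: mult_of_nat_commute)
      finally show ?thesis by (simp only: of_nat_mult mult.assoc)
    qed
    then show ?thesis
      unfolding cycle_sum_Suc[OF fin] sum_distrib_left by (intro sum.cong refl)
  qed
  also have "\<dots> = (\<Sum>c\<in>A. pp_swap b c * box_val (of_nat (Suc (Suc k)) * cycle_poly k) (A - {c}, c))"
    by (simp only: Suc.IH[OF c] box_val_of_nat_mult)
  also have "\<dots> = (\<Sum>c\<in>A. \<Sum>j\<le>Suc k. pp_swap b c * (jm_pow (A - {c}) c (Suc k - j) * jm_val (step_coeff (Suc k) j) A))"
    by (intro sum.cong refl)
       (simp only: cycle_poly_new box_val_sum box_val_mult box_val_x_power[OF c] box_val_new[OF c] jm_pow_point[OF c]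
         sum_distrib_left, simp add: insert_absorb)
  also have "\<dots> = (\<Sum>j\<le>Suc k. (\<Sum>c\<in>A. pp_swap b c * jm_pow (A - {c}) c (Suc k - j)) * jm_val (step_coeff (Suc k) j) A)"
    by (subst sum.swap) (simp only: sum_distrib_right mult.assoc)
  also have "\<dots> = (\<Sum>j\<le>Suc k. box_val (poly_part (Suc (Suc k - j)) h_old box_x) (A, b) * jm_val (step_coeff (Suc k) j) A)"
    unfolding sum_swap_jm_pow[OF fin b] box_val_poly_part[OF fin b] by simp
  also have "\<dots> = box_val (of_nat (Suc k) * cycle_poly (Suc k)) (A, b)"
  proof -
    have "box_val p (A, b) * pp_point b = box_val p (A, b)" for p
      using box_val_1[OF fin b] by (metis box_val_mult mult_1_right)
    then have "box_val p (A, b) * (pp_point b * f) = box_val p (A, b) * f" for p f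
      by (metis mult.assoc)
    then show ?thesis
      by (simp only: cycle_poly_old box_val_sum box_val_mult box_val_old[OF fin b])
  qed
  also have "\<dots> = of_nat (Suc k) * box_val (cycle_poly (Suc k)) (A, b)"
    by (rule box_val_of_nat_mult)
  finally have *: "of_nat (Suc k) * (of_nat (Suc (Suc k)) * cycle_sum (Suc k) A b) = of_nat (Suc k) * box_val (cycle_poly (Suc k)) (A, b)" .
  from pp_alg_of_nat_cancel[OF *] show ?case .
qed

text \<open>The expansion of \<open>cycle_sum_eq\<close> is now summed over \<open>c\<close> without
  a transposition, so the powers become traces, that is, coefficients of H, and
  \<open>shift_prod_residue\<close> sums them.\<close>

theorem cc_ind_on_eq:
  assumes fin: "finite A"
  shows "of_nat (Suc k) * cc_ind_on A [Suc k] = - jm_val (shift_prod recip_fps (Suc k) $ Suc (Suc k)) A"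
proof -
  have c: "finite (A - {c})" "c \<notin> A - {c}" for c using fin by auto
  have "of_nat (Suc (Suc k)) * (of_nat (Suc k) * cc_ind_on A [Suc k]) =
      (\<Sum>c\<in>A. box_val (of_nat (Suc (Suc k)) * cycle_poly k) (A - {c}, c))"
    by (simp only: cc_ind_on_cycle_sum[OF fin] sum_distrib_left cycle_sum_eq[OF c] box_val_of_nat_mult)
  also have "\<dots> = (\<Sum>c\<in>A. \<Sum>j\<le>Suc k. jm_pow (A - {c}) c (Suc k - j) * jm_val (step_coeff (Suc k) j) A)"
    by (intro sum.cong refl)
       (simp only: cycle_poly_new box_val_sum box_val_mult box_val_x_power[OF c] box_val_new[OF c] jm_pow_point[OF c]
         sum_distrib_left, simp add: insert_absorb)
  also have "\<dots> = (\<Sum>j\<le>Suc k. jm_trace (Suc k - j) A * jm_val (step_coeff (Suc k) j) A)"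
    by (subst sum.swap) (simp only: sum_distrib_right jm_trace_def)
  also have "\<dots> = - jm_val (\<Sum>j\<le>Suc k. recip_fps $ (Suc k - j + 2) * step_coeff (Suc k) j) A"
    by (simp only: jm_val_sum jm_val_mult jm_val_recip[OF fin]) (simp add: sum_negf del: sum.atMost_Suc)
  also have "(\<Sum>j\<le>Suc k. recip_fps $ (Suc k - j + 2) * step_coeff (Suc k) j) =
      of_nat (Suc (Suc k)) * shift_prod recip_fps (Suc k) $ Suc (Suc k)"
    unfolding shift_prod_residue[OF recip_fps_0 recip_fps_1, symmetric] step_coeff_def sum_subtractf[symmetric]
    by (simp only: right_diff_distrib mult.commute)
  finally have "of_nat (Suc (Suc k)) * (of_nat (Suc k) * cc_ind_on A [Suc k]) =
      of_nat (Suc (Suc k)) * - jm_val (shift_prod recip_fps (Suc k) $ Suc (Suc k)) A"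
    by (simp only: jm_val_mult jm_val_of_nat mult_minus_right)
  then show ?thesis by (rule pp_alg_of_nat_cancel)
qed

section \<open>Passage to the projective limit\<close>

lift_definition to_limit :: "jm_alg \<Rightarrow> pp_limit" is "\<lambda>p q. p {1..q}"
proof -
  fix p :: "nat set \<Rightarrow> nat pp_alg"
  assume "p \<in> pp_hull (\<lambda>_. 1) (range (\<lambda>k A. jm_moment_on A k))"
  then have "p {1..q} \<in> pp_alg_on {1..q} \<and> (q \<le> r \<longrightarrow> pp_theta {1..q} (p {1..r}) = p {1..q})" for q r
  proof (induction rule: pp_hull.induct)
    case (gen g)
    then obtain k where g: "g = (\<lambda>A. jm_moment_on A k)" by blast
    show ?case
      using pp_proj[of "jm_moment k"] by (simp add: g jm_moment.rep_eq)
  qed (simp_all add: pp_alg_on_iff_theta pp_theta_single pp_theta_add pp_theta_mult)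
  then show "(\<forall>q. p {1..q} \<in> pp_alg_on {1..q}) \<and> (\<forall>q r. q \<le> r \<longrightarrow> pp_theta {1..q} (p {1..r}) = p {1..q})"
    by blast
qed

lemma to_limit_0 [simp]: "to_limit 0 = 0"
  by (rule pp_limit_eqI) (simp add: to_limit.rep_eq zero_pp_limit.rep_eq)

lemma to_limit_1 [simp]: "to_limit 1 = 1"
  by (rule pp_limit_eqI) (simp add: to_limit.rep_eq one_pp_limit.rep_eq)

lemma to_limit_add: "to_limit (p + q) = to_limit p + to_limit q"
  by (rule pp_limit_eqI) (simp add: to_limit.rep_eq plus_pp_limit.rep_eq jm_val_add)

lemma to_limit_mult: "to_limit (p * q) = to_limit p * to_limit q"
  by (rule pp_limit_eqI) (simp add: to_limit.rep_eq times_pp_limit.rep_eq jm_val_mult)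

lemma to_limit_scale: "to_limit (cscal c * p) = c *\<^sub>C to_limit p"
  by (rule pp_limit_eqI)
     (simp add: to_limit.rep_eq pp_scale.rep_eq jm_val_mult cscal_jm_alg.rep_eq mult_map_scale_conv_mult)

lemma to_limit_mom: "to_limit (jm_mom k) = jm_moment k"
  by (rule pp_limit_eqI) (simp add: to_limit.rep_eq jm_moment.rep_eq jm_val_mom)

lemma to_limit_sum: "to_limit (sum f I) = (\<Sum>i\<in>I. to_limit (f i))"
  by (induction I rule: infinite_finite_induct) (simp_all add: to_limit_add)

lemma to_limit_power: "to_limit (p ^ n) = to_limit p ^ n"
  by (induction n) (simp_all add: to_limit_mult)

lemma to_limit_prod_list: "to_limit (prod_list ps) = prod_list (map to_limit ps)"
  by (induction ps) (simp_all add: to_limit_mult)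

text \<open>Frobenius's character formula for a cycle, as an identity of the limit algebra.\<close>

theorem cc_ind_frobenius:
  "cc_ind [Suc k] = to_limit (cscal (- 1 / of_nat (Suc k)) * shift_prod recip_fps (Suc k) $ Suc (Suc k))"
proof (rule pp_limit_eqI)
  fix q
  let ?c = "Poly_Mapping.single 0 (- 1 / of_nat (Suc k)) :: nat pp_alg"
  let ?v = "jm_val (shift_prod recip_fps (Suc k) $ Suc (Suc k)) {1..q}"
  have "of_nat (Suc k) * ?c = (Poly_Mapping.single 0 (of_nat (Suc k)) * ?c :: nat pp_alg)"
    by (simp only: single_of_nat)
  also have "\<dots> = - 1"
    by (simp only: mult_single) (simp del: of_nat_Suc add: single_uminus)
  finally have "of_nat (Suc k) * (?c * ?v) = - ?v"
    by (simp only: mult.assoc[symmetric]) simp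
  then have "of_nat (Suc k) * cc_ind_on {1..q} [Suc k] = of_nat (Suc k) * (?c * ?v)"
    using cc_ind_on_eq[of "{1..q}" k] by simp
  then have "cc_ind_on {1..q} [Suc k] = ?c * ?v"
    by (rule pp_alg_of_nat_cancel)
  then show "pp_proj (cc_ind [Suc k]) q =
      pp_proj (to_limit (cscal (- 1 / of_nat (Suc k)) * shift_prod recip_fps (Suc k) $ Suc (Suc k))) q"
    by (simp only: cc_ind.rep_eq to_limit.rep_eq jm_val_mult cscal_jm_alg.rep_eq)
qed

subsection \<open>Degrees\<close>

lemma jm_degree_le_mono: "d \<le> d' \<Longrightarrow> x \<in> jm_degree_le d \<Longrightarrow> x \<in> jm_degree_le d'"
  unfolding jm_degree_le_def by (rule set_rev_mp, assumption, rule pp_limit.span_mono) force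

lemma jm_degree_le_mult:
  assumes "x \<in> jm_degree_le d" "y \<in> jm_degree_le d'"
  shows "x * y \<in> jm_degree_le (d + d')"
proof -
  let ?G = "\<lambda>d. {prod_list (map jm_moment js) | js. (\<forall>j\<in>set js. 2 \<le> j) \<and> int (sum_list js) \<le> d}"
  have scale: "(c *\<^sub>C a) * b = c *\<^sub>C (a * b)" "a * (c *\<^sub>C b) = c *\<^sub>C (a * b)" for c a b
  proof -
    have "(Poly_Mapping.single 0 c * f) * g = Poly_Mapping.single 0 c * (f * g)"
      "f * (Poly_Mapping.single 0 c * g) = Poly_Mapping.single 0 c * (f * g)" for f g :: "nat pp_alg"
      by (simp_all only: mult.assoc[symmetric] single_central[of c f, symmetric])
    then show "(c *\<^sub>C a) * b = c *\<^sub>C (a * b)" "a * (c *\<^sub>C b) = c *\<^sub>C (a * b)"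
      by (auto intro!: pp_limit_eqI simp: times_pp_limit.rep_eq pp_scale.rep_eq mult_map_scale_conv_mult)
  qed
  have 1: "a * b \<in> jm_degree_le (d + d')" if "a \<in> ?G d" "b \<in> ?G d'" for a b
  proof -
    from that(1) obtain js where "a = prod_list (map jm_moment js)" "\<forall>j\<in>set js. 2 \<le> j" "int (sum_list js) \<le> d"
      by blast
    moreover from that(2) obtain ks where "b = prod_list (map jm_moment ks)" "\<forall>j\<in>set ks. 2 \<le> j" "int (sum_list ks) \<le> d'"
      by blast
    ultimately have "a * b = prod_list (map jm_moment (js @ ks))" "\<forall>j\<in>set (js @ ks). 2 \<le> j" "int (sum_list (js @ ks)) \<le> d + d'"
      by auto
    then show ?thesis unfolding jm_degree_le_def by (blast intro: pp_limit.span_base)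
  qed
  have 2: "a * y \<in> jm_degree_le (d + d')" if a: "a \<in> ?G d" for a
    using assms(2) unfolding jm_degree_le_def[of d']
  proof (induction rule: pp_limit.span_induct_alt)
    case base
    then show ?case by (simp add: jm_degree_le_def pp_limit.span_zero)
  next
    case (step c b z)
    then show ?case
      using 1[OF a, of b] unfolding jm_degree_le_def
      by (simp add: distrib_left scale pp_limit.span_add pp_limit.span_scale)
  qed
  show ?thesis
    using assms(1) unfolding jm_degree_le_def[of d]
  proof (induction rule: pp_limit.span_induct_alt)
    case base
    then show ?case by (simp add: jm_degree_le_def pp_limit.span_zero)
  next
    case (step c a z)
    then show ?case
      using 2[of a] unfolding jm_degree_le_def
      by (simp add: distrib_right scale pp_limit.span_add pp_limit.span_scale)
  qed
qed

text \<open>Degrees are pulled back from the limit, where the error term of the final statement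
  lives.\<close>

definition jm_deg :: "int \<Rightarrow> jm_alg set" where
  "jm_deg d = {p. to_limit p \<in> jm_degree_le d}"

interpretation jm_deg: degree_filtration jm_deg
proof
  show "0 \<in> jm_deg d" for d
    by (simp add: jm_deg_def jm_degree_le_def pp_limit.span_zero)
  show "x + y \<in> jm_deg d" if "x \<in> jm_deg d" "y \<in> jm_deg d" for x y d
    using that by (simp add: jm_deg_def jm_degree_le_def to_limit_add pp_limit.span_add)
  show "x * y \<in> jm_deg (d + d')" if "x \<in> jm_deg d" "y \<in> jm_deg d'" for x y d d'
    using that by (simp add: jm_deg_def to_limit_mult jm_degree_le_mult)
  show "cscal c \<in> jm_deg 0" for c
  proof -
    have "prod_list (map jm_moment []) \<in> jm_degree_le 0"
      unfolding jm_degree_le_def by (rule pp_limit.span_base) (rule CollectI, rule exI[of _ "[]"], simp)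
    then have "c *\<^sub>C 1 \<in> jm_degree_le 0"
      by (simp add: jm_degree_le_def pp_limit.span_scale)
    then show ?thesis using to_limit_scale[of c 1] by (simp add: jm_deg_def)
  qed
  show "x \<in> jm_deg d'" if "d \<le> d'" "x \<in> jm_deg d" for x d d'
    using that by (auto simp: jm_deg_def intro: jm_degree_le_mono)
qed

text \<open>Products in \<open>jm_degree_le\<close> have indices at least 2; the two other moments
  are constants, 1 and 0.\<close>

lemma jm_mom_deg: "jm_mom k \<in> jm_deg (int k)"
proof -
  consider "k = 0" | "k = 1" | "2 \<le> k" by linarith
  then show ?thesis
  proof cases
    case 1
    then show ?thesis using jm_deg.deg_cscal[of 1] by simp
  next
    case 2
    then show ?thesis using jm_mom_1 by (simp add: jm_deg.deg_0)
  next
    case 3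
    have "prod_list (map jm_moment [k]) \<in> jm_degree_le (int k)"
      unfolding jm_degree_le_def by (rule pp_limit.span_base) (rule CollectI, rule exI[of _ "[k]"], simp add: 3)
    then show ?thesis by (simp add: jm_deg_def to_limit_mom)
  qed
qed

lemma recip_fps_deg: "jm_deg.fil 0 recip_fps"
proof -
  have "recip_fps $ n \<in> jm_deg (int n)" for n
  proof (induction n rule: less_induct)
    case (less n)
    show ?case
    proof (cases "n = 0")
      case True
      then show ?thesis using jm_deg.deg_cscal[of 1] by (simp add: recip_fps_0)
    next
      case False
      have "(recip_fps * moment_fps) $ n = 0" using False by (simp add: recip_moment)
      then have "(\<Sum>i<n. recip_fps $ i * jm_mom (n - i)) + recip_fps $ n = 0"
        by (simp add: fps_mult_nth moment_fps_def atLeast0AtMost lessThan_Suc_atMost[symmetric])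
      then have "recip_fps $ n = - (\<Sum>i<n. recip_fps $ i * jm_mom (n - i))"
        by (simp add: eq_neg_iff_add_eq_0 add.commute)
      also have "\<dots> \<in> jm_deg (int n)"
      proof (intro jm_deg.deg_uminus jm_deg.deg_sum)
        fix i assume "i \<in> {..<n}"
        then have "i < n" by simp
        then show "recip_fps $ i * jm_mom (n - i) \<in> jm_deg (int n)"
          using jm_deg.deg_mult[OF less[of i] jm_mom_deg[of "n - i"]] by (simp add: of_nat_diff)
      qed
      finally show ?thesis .
    qed
  qed
  then show ?thesis by (simp add: jm_deg.fil_def)
qed

subsection \<open>Free cumulants\<close>

definition jm_cumulant :: "nat \<Rightarrow> jm_alg" where
  "jm_cumulant n = nc_sum0 jm_mom moebius_wt 1 n 0"

lemma NC_eq_nc_on: "NC n = nc_on {1..n}"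
  by (simp add: NC_def nc_on_def)

lemma to_limit_jm_cumulant:
  assumes n: "1 \<le> n"
  shows "to_limit (jm_cumulant n) = free_cumulant n"
proof -
  have 1: "Moeb (kreweras n \<rho>) = kblock_wt moebius_wt n 0 (kpart \<rho> {1..n})" if "\<rho> \<in> NC n" for \<rho>
    unfolding kreweras_eq_kpart[OF that] Moeb_def kblock_wt_def
  proof (intro prod.cong refl)
    fix C assume C: "C \<in> kpart \<rho> {1..n}"
    then have "C \<noteq> {}" by (auto simp: kpart_def kclass_def)
    moreover have "finite C" using kpart_mem_subset[OF C] by (rule finite_subset) simp
    ultimately have "card C \<noteq> 0" by simp
    then show "(- 1) ^ (card C - 1) * catalan (card C - 1) = moebius_wt (card C + (if n \<in> C then 0 else 0))"
      by (simp add: moebius_wt_def)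
  qed
  have 2: "jm_moment_partition \<rho> = to_limit (block_wt jm_mom 1 0 \<rho>)" for \<rho>
  proof -
    let ?l = "sorted_list_of_multiset (image_mset card (mset_set \<rho>))"
    have "prod_list (map jm_mom ?l) = prod_mset (image_mset jm_mom (image_mset card (mset_set \<rho>)))"
      by (simp only: prod_mset_prod_list[symmetric] mset_map mset_sorted_list_of_multiset)
    also have "\<dots> = block_wt jm_mom 1 0 \<rho>"
      by (simp add: block_wt_def prod_unfold_prod_mset image_mset.compositionality o_def)
    finally have "to_limit (prod_list (map jm_mom ?l)) = to_limit (block_wt jm_mom 1 0 \<rho>)" by simp
    then show ?thesis
      by (simp add: jm_moment_partition_def to_limit_prod_list o_def to_limit_mom)
  qed
  have "jm_cumulant n = (\<Sum>\<rho>\<in>NC n. cscal (Moeb (kreweras n \<rho>)) * block_wt jm_mom 1 0 \<rho>)"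
    unfolding jm_cumulant_def nc_sum0_def nc_sum_def if_P[OF n] NC_eq_nc_on[symmetric]
    by (intro sum.cong refl) (simp only: 1 mult.commute)
  then show ?thesis
    by (simp only: to_limit_sum to_limit_scale free_cumulant_def 2)
qed

lemma to_limit_seq_wt:
  assumes "m \<in> mult_seqs N"
  shows "cumulant_prod m = to_limit (\<Prod>s | m s \<noteq> 0. (cscal (of_nat (s - 1)) * jm_cumulant s) ^ m s)"
proof -
  let ?S = "{s. m s \<noteq> 0}"
  have pos: "1 \<le> s" if "m s \<noteq> 0" for s
    using assms that by (cases s) (auto simp: mult_seqs_def)
  have fin: "finite ?S" using assms by (simp add: mult_seqs_def)
  have "(\<Prod>s\<in>?S. (cscal (of_nat (s - 1)) * jm_cumulant s) ^ m s) =
      prod_list (map (\<lambda>s. (cscal (of_nat (s - 1)) * jm_cumulant s) ^ m s) (sorted_list_of_set ?S))"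
    using prod.distinct_set_conv_list[of "sorted_list_of_set ?S" "\<lambda>s. (cscal (of_nat (s - 1)) * jm_cumulant s) ^ m s"] fin
    by simp
  then have "to_limit (\<Prod>s\<in>?S. (cscal (of_nat (s - 1)) * jm_cumulant s) ^ m s) =
      prod_list (map (\<lambda>s. (of_nat (s - 1) *\<^sub>C to_limit (jm_cumulant s)) ^ m s) (sorted_list_of_set ?S))"
    by (simp only: to_limit_prod_list map_map o_def to_limit_power to_limit_scale)
  also have "\<dots> = cumulant_prod m"
    unfolding cumulant_prod_def using fin
  proof (intro arg_cong[of _ _ prod_list] map_cong refl)
    fix s assume "s \<in> set (sorted_list_of_set ?S)"
    then have "1 \<le> s" using pos fin by simp
    then show "(of_nat (s - 1) *\<^sub>C to_limit (jm_cumulant s)) ^ m s = (of_nat (s - 1) *\<^sub>C free_cumulant s) ^ m s"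
      by (simp only: to_limit_jm_cumulant)
  qed
  finally show ?thesis ..
qed

theorem theorem4p14:
  fixes n :: nat
  assumes "n \<ge> 2"
  shows "\<exists>E \<in> jm_degree_le (int n - 4).
    cc_ind [n - 1] =
      free_cumulant n
      + (\<Sum>m \<in> mult_seqs (n - 2).
           (1 / 4 * of_nat (n choose 3) * multinomial_coeff m) *\<^sub>C cumulant_prod m)
      + E"
proof -
  obtain k where n: "n = k + 2" using assms by (metis add.commute le_Suc_ex)
  define h r V where "h = recip_fps" and "r = 1 + nc_fps0 jm_mom moebius_wt 0"
    and "V = nc_fps0 jm_mom moebius_wt 1"
  have Vr: "V * r = 1" and Mr: "fps_comp (fps_X * V) moment_fps = r"
    using free_cumulant_functional_equation[of jm_mom, OF jm_mom_0]
    by (simp_all add: V_def r_def moment_fps_def)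
  \<comment> \<open>Composition is multiplicative, so the composite of \<open>h\<close> inverts the
    composed moment series \<open>r\<close>, as \<open>V\<close> does.\<close>
  have "fps_comp (fps_X * V) h * r = 1"
    using recip_moment by (simp add: h_def Mr[symmetric] fps_comp_mult[symmetric] fps_comp_1)
  then have "fps_comp (fps_X * V) h = V"
    using Vr by (metis mult.assoc mult.commute mult_1_right)
  then interpret lagrange V r h
    using Vr by unfold_locales
  have r_nth_eq: "r $ s = (if s = 0 then 1 else jm_cumulant s)" for s
    by (auto simp: r_def nc_fps0_def jm_cumulant_def nc_sum0_def moebius_wt_def)
  have h2: "jm_deg.fil 0 h" unfolding h_def by (rule recip_fps_deg)
  let ?K = "of_nat (Suc k) :: complex"
  obtain E where E: "E \<in> jm_deg (int (Suc k) - 3)"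
    and exp: "shift_prod h (Suc k) $ Suc (Suc k) = (h ^ Suc k) $ Suc (Suc k) +
      cscal (sum_sq (Suc k)) * (h ^ (Suc k - 2) * second_order h) $ Suc (Suc k) + E"
    using jm_deg.shift_prod_residue_expansion[OF h2, of "Suc k"] by blast
  have K0: "?K \<noteq> 0" by (simp del: of_nat_Suc)
  have first: "cscal (- 1 / ?K) * (h ^ Suc k) $ Suc (Suc k) = jm_cumulant n"
  proof -
    have "cscal ?K * jm_cumulant n = cscal ?K * (cscal (- 1 / ?K) * (h ^ Suc k) $ Suc (Suc k))"
    proof -
      have "cscal ?K * (cscal (- 1 / ?K) * x) = - x" for x :: jm_alg
        using K0 by (simp only: mult.assoc[symmetric] cscal_mult[symmetric]) (simp add: cscal_minus del: of_nat_Suc)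
      moreover have "of_nat (Suc k) * jm_cumulant n = - (h ^ Suc k) $ Suc (Suc k)"
        using r_nth[of k] by (simp add: r_nth_eq n del: of_nat_Suc power_Suc)
      ultimately show ?thesis by (simp only: cscal_of_nat fps_neg_nth)
    qed
    then show ?thesis using K0 by (metis cscal_cancel)
  qed
  have second: "cscal (- 1 / ?K) * (cscal (sum_sq (Suc k)) * (h ^ (Suc k - 2) * second_order h) $ Suc (Suc k)) =
      cscal (1 / 4 * of_nat (n choose 3)) * P $ k"
  proof (cases k)
    \<comment> \<open>For n = 2 both sides vanish: there is a single factor, with shift 0, and
      \<open>2 choose 3\<close> is 0.\<close>
    case 0
    then show ?thesis by (simp add: n sum_sq_def eval_nat_numeral)
  next
    case (Suc l)
    have "(h ^ (Suc k - 2) * second_order h) $ Suc (Suc k) =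
      (h ^ l * (fps_X\<^sup>2 * h * fps_deriv (fps_deriv h) - (h - fps_X * fps_deriv h)\<^sup>2)) $ Suc l"
      unfolding second_order_eq Suc
      using fps_X_power_mult_nth[of 2 "h ^ l * (fps_X\<^sup>2 * h * fps_deriv (fps_deriv h) - (h - fps_X * fps_deriv h)\<^sup>2)" "Suc (Suc (Suc l))"]
      by (simp add: mult.left_commute)
    also have "\<dots> = - of_nat (Suc k) * P $ k"
      unfolding residue_second_order P_nth Suc by simp
    finally have "cscal (- 1 / ?K) * (cscal (sum_sq (Suc k)) * (h ^ (Suc k - 2) * second_order h) $ Suc (Suc k)) =
       cscal (- 1 / ?K * sum_sq (Suc k) * - ?K) * P $ k"
      by (simp only: cscal_mult cscal_minus cscal_of_nat mult.assoc)
    also have "- 1 / ?K * sum_sq (Suc k) * - ?K = 1 / 4 * of_nat (n choose 3)"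
    proof -
      have "- 1 / ?K * sum_sq (Suc k) * - ?K = sum_sq (Suc k)"
        using K0 by (simp del: of_nat_Suc)
      \<comment> \<open>With \<open>n - 1\<close> factors, \<open>sum_sq\<close> is
        \<open>(n - 1) ((n - 1)^2 - 1) / 24 = n (n - 1) (n - 2) / 24\<close>.\<close>
      also have "\<dots> = 1 / 4 * of_nat (n choose 3)"
        by (simp add: n sum_sq_def binomial_gbinomial gbinomial_prod_rev numeral_3_eq_3 field_simps power2_eq_square)
      finally show ?thesis .
    qed
    finally show ?thesis .
  qed
  \<comment> \<open>\<open>X\<close> times the derivative multiplies coefficient \<open>s\<close> by
    \<open>s\<close>. The resulting factor \<open>1 - s\<close> removes \<open>s = 1\<close>, so
    \<open>P\<close> is a geometric series in the terms with \<open>s\<close> at least 2, as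
    \<open>sum_mult_seqs\<close> requires.\<close>
  have T: "r - fps_X * fps_deriv r = 1 - Abs_fps (\<lambda>s. if s < 2 then 0 else cscal (of_nat (s - 1)) * jm_cumulant s)"
  proof (rule fps_ext)
    fix s
    show "(r - fps_X * fps_deriv r) $ s =
      (1 - Abs_fps (\<lambda>s. if s < 2 then 0 else cscal (of_nat (s - 1)) * jm_cumulant s)) $ s"
      by (cases "s = 0"; cases "s = 1") (simp_all add: nth_X_deriv r_nth_eq of_nat_diff cscal_diff algebra_simps)
  qed
  have Pk: "P $ k = (\<Sum>m\<in>mult_seqs k. seq_wt (\<lambda>s. cscal (of_nat (s - 1)) * jm_cumulant s) m)"
    by (rule sum_mult_seqs) (use P_inverse T in simp)
  have "cc_ind [n - 1] = to_limit (cscal (- 1 / ?K) * shift_prod h (Suc k) $ Suc (Suc k))"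
    using cc_ind_frobenius[of k] by (simp add: n h_def)
  also have "cscal (- 1 / ?K) * shift_prod h (Suc k) $ Suc (Suc k) =
      jm_cumulant n + cscal (1 / 4 * of_nat (n choose 3)) * P $ k + cscal (- 1 / ?K) * E"
    unfolding exp distrib_left first second ..
  also have "to_limit \<dots> = free_cumulant n
      + (\<Sum>m \<in> mult_seqs (n - 2). (1 / 4 * of_nat (n choose 3) * multinomial_coeff m) *\<^sub>C cumulant_prod m)
      + to_limit (cscal (- 1 / ?K) * E)"
  proof -
    have "to_limit (cscal (1 / 4 * of_nat (n choose 3)) * P $ k) =
      (\<Sum>m \<in> mult_seqs (n - 2). (1 / 4 * of_nat (n choose 3) * multinomial_coeff m) *\<^sub>C cumulant_prod m)"
      unfolding Pk sum_distrib_left to_limit_sum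
    proof (intro sum.cong)
      fix m assume "m \<in> mult_seqs (n - 2)"
      then show "to_limit (cscal (1 / 4 * of_nat (n choose 3)) * seq_wt (\<lambda>s. cscal (of_nat (s - 1)) * jm_cumulant s) m) =
          (1 / 4 * of_nat (n choose 3) * multinomial_coeff m) *\<^sub>C cumulant_prod m"
        by (simp only: to_limit_seq_wt seq_wt_def mult.assoc[symmetric] cscal_mult[symmetric] to_limit_scale)
    qed (simp add: n)
    then show ?thesis
      using to_limit_jm_cumulant[of n] by (simp add: to_limit_add n)
  qed
  finally have eq: "cc_ind [n - 1] = free_cumulant n
      + (\<Sum>m \<in> mult_seqs (n - 2). (1 / 4 * of_nat (n choose 3) * multinomial_coeff m) *\<^sub>C cumulant_prod m)
      + to_limit (cscal (- 1 / ?K) * E)" .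
  have "cscal (- 1 / ?K) * E \<in> jm_deg (int (Suc k) - 3)"
    by (rule jm_deg.deg_scale[OF E])
  then have "to_limit (cscal (- 1 / ?K) * E) \<in> jm_degree_le (int n - 4)"
    by (simp add: jm_deg_def n)
  with eq show ?thesis by blast
qed

end
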